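(* Let $X_a\subset\mathbb{C}^m$ be the germ at $a$ of an embedded complex manifold of dimension $n\ge1$, and let $\Phi=(\Phi_1,\dots,\Phi_m):(\mathbb{C}^n,b)\to(\mathbb{C}^m,a)$ be a local parametrisation of $X_a$. If $a$ is a $D$-invariant point of degree $d$, then $$\binom{n+d}{n}+\theta_{\mathcal{O}_{n,b},\Phi}(d)-d\ \le\ \dim_{\mathbb{C}}\mathbb{C}[\Phi]^d=\sum_{i=0}^{d}\chi(\overline{X}_a,i)\ \le\ \binom{m+d}{m}.$$ Hence, if $a$ is a $D$-invariant point of degree $\infty$, then $$1\le\alpha(\Phi)\le\dim\overline{X}_a\le m.$$
   Context: $\mathcal{O}_{n,b}=\mathbb{C}\{t-b\}$ is the ring of germs of holomorphic functions at $b\in\mathbb{C}^n$. A local parametrisation of $X_a$ is a holomorphic map germ $\Phi:(\mathbb{C}^n,b)\to(\mathbb{C}^m,a)$ inducing a biholomorphic germ $(\mathbb{C}^n,b)\to X_a$. $\mathbb{C}[x]^d$ is the space of polynomials of degree $\le d$ in $x=(x_1,\dots,x_m)$; $\mathbb{C}[\Phi]^d=\{F\circ\Phi:F\in\mathbb{C}[x]^d\}\subset\mathcal{O}_{n,b}$; $P^d(X_a)$ is the space of germs at $a$ of restrictions to $X_a$ of elements of $\mathbb{C}[x]^d$ (so $P^d(X_a)\cong\mathbb{C}[\Phi]^d$), and $P^{-1}(X_a)=0$. Least space: for $0\neq f=\sum c_\nu(t-b)^\nu\in\mathcal{O}_{n,b}$ with $k$ the smallest $|\nu|$ such that $c_\nu\neq0$,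 $f_b{\downarrow}=\sum_{|\nu|=k}c_\nu\tau^\nu\in\mathbb{C}[\tau]$, $\tau=(\tau_1,\dots,\tau_n)$; $0_b{\downarrow}=0$; $\mathbb{C}[\Phi]^d_b{\downarrow}$ is the linear span of the $f_b{\downarrow}$, $f\in\mathbb{C}[\Phi]^d$. The point $a$ is a $D$-invariant point of degree $d$ if $\mathbb{C}[\Phi]^d_b{\downarrow}$ is closed under all $\partial/\partial\tau_i$ (this is independent of the choice of local parametrisation); it is a $D$-invariant point of degree $\infty$ if this holds for all $d\in\mathbb{N}$. Zero-estimate function: $\theta_{\mathcal{O}_{n,b},\Phi}(d)=\max\{\deg p:p\in\mathbb{C}[\Phi]^d_b{\downarrow}\setminus\{0\}\}=\sup\{\mathrm{ord}_b(F\circ\Phi):F\in\mathbb{C}[x]^d,\ F\circ\Phi\ne0\}$, where $\mathrm{ord}_b$ is the vanishing order at $b$. Transcendency index: $\alpha(\Phi)=\limsup_{d\to\infty}\log_d\theta_{\mathcal{O}_{n,b},\Phi}(d)$. $\overline{X}_a$ is the Zariski closure of $X_a$, i.e. the smallest algebraic subset of $\mathbb{C}^m$ containing some representative of the germ $X_a$. Its Hilbert function is $\chi(\overline{X}_a,d)=\dim_{\mathbb{C}}P^d(X_a)-\dim_{\mathbb{C}}P^{d-1}(X_a)$. *)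

theory Defs
  imports "HOL-Analysis.Analysis" "HOL-Library.Poly_Mapping"
begin

section \<open>Polynomials in several variables\<close>

text \<open>
  Multi-indices in the variables indexed by a finite type are vectors of natural numbers;
  a polynomial maps each exponent to its coefficient.
\<close>

type_synonym 'n mpoly = "(nat ^ 'n) \<Rightarrow>\<^sub>0 complex"

definition weight :: "nat ^ 'n \<Rightarrow> nat"
  where "weight \<nu> = (\<Sum>i\<in>UNIV. \<nu> $ i)"

definition monomial :: "complex ^ 'n \<Rightarrow> nat ^ 'n \<Rightarrow> complex"
  where "monomial x \<nu> = (\<Prod>i\<in>UNIV. (x $ i) ^ (\<nu> $ i))"

definition mp_eval :: "'n::finite mpoly \<Rightarrow> complex ^ 'n \<Rightarrow> complex"
  where "mp_eval p x = (\<Sum>\<nu>\<in>Poly_Mapping.keys p. Poly_Mapping.lookup p \<nu> * monomial x \<nu>)"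

definition mp_scale :: "complex \<Rightarrow> 'n::finite mpoly \<Rightarrow> 'n mpoly"
  where "mp_scale c p = Poly_Mapping.map ((*) c) p"

text \<open>Only meaningful for nonzero polynomials.\<close>

definition mp_degree :: "'n::finite mpoly \<Rightarrow> nat"
  where "mp_degree p = Max (weight ` Poly_Mapping.keys p)"

definition polys_upto :: "nat \<Rightarrow> 'm::finite mpoly set"
  where "polys_upto d = {p. \<forall>\<nu>\<in>Poly_Mapping.keys p. weight \<nu> \<le> d}"

text \<open>
  Subtraction of exponents is truncated, but the terms where this happens have
  coefficient \<open>0\<close>.
\<close>

definition mp_deriv :: "'n::finite \<Rightarrow> 'n mpoly \<Rightarrow> 'n mpoly"
  where "mp_deriv i p = (\<Sum>\<nu>\<in>Poly_Mapping.keys p.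
           Poly_Mapping.single (\<nu> - axis i 1) (of_nat (\<nu> $ i) * Poly_Mapping.lookup p \<nu>))"

lemma lookup_mp_scale: "Poly_Mapping.lookup (mp_scale c p) \<nu> = c * Poly_Mapping.lookup p \<nu>"
  by (simp add: mp_scale_def Poly_Mapping.map.rep_eq when_def)

global_interpretation mp: vector_space mp_scale
  by standard (rule poly_mapping_eqI; simp add: lookup_mp_scale lookup_add algebra_simps)+

section \<open>Germs of functions\<close>

text \<open>
  Germs at all points share one type: the germ of \<open>f\<close> at \<open>b\<close> is represented by the germ
  at the origin of \<open>\<lambda>t. f (b + t)\<close>.
\<close>

definition germ_eq :: "('a::real_normed_vector \<Rightarrow> complex) \<Rightarrow> ('a \<Rightarrow> complex) \<Rightarrow> bool"
  where "germ_eq f g \<longleftrightarrow> eventually (\<lambda>t. f t = g t) (nhds 0)"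

lemma equivp_germ_eq: "equivp germ_eq"
proof (rule equivpI)
  show "reflp germ_eq"
    by (simp add: reflp_def germ_eq_def)
  show "symp germ_eq"
    by (simp add: symp_def germ_eq_def eq_commute)
  show "transp germ_eq"
    unfolding transp_def germ_eq_def by (auto elim: eventually_elim2)
qed

quotient_type (overloaded) 'a germ = "'a::real_normed_vector \<Rightarrow> complex" / germ_eq
  by (rule equivp_germ_eq)

instantiation germ :: (real_normed_vector) ab_group_add
begin

lift_definition zero_germ :: "'a germ" is "\<lambda>_. 0" .

lift_definition plus_germ :: "'a germ \<Rightarrow> 'a germ \<Rightarrow> 'a germ" is "\<lambda>f g t. f t + g t"
  unfolding germ_eq_def by (auto elim: eventually_elim2)

lift_definition uminus_germ :: "'a germ \<Rightarrow> 'a germ" is "\<lambda>f t. - f t"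
  unfolding germ_eq_def by (auto elim: eventually_mono)

lift_definition minus_germ :: "'a germ \<Rightarrow> 'a germ \<Rightarrow> 'a germ" is "\<lambda>f g t. f t - g t"
  unfolding germ_eq_def by (auto elim: eventually_elim2)

instance
  by standard (transfer; simp add: germ_eq_def algebra_simps)+

end

lift_definition germ_scale :: "complex \<Rightarrow> 'a::real_normed_vector germ \<Rightarrow> 'a germ"
  is "\<lambda>c f t. c * f t"
  unfolding germ_eq_def by (auto elim: eventually_mono)

global_interpretation germ: vector_space germ_scale
  by standard (transfer; simp add: germ_eq_def algebra_simps)+

lift_definition germ_at :: "'a::real_normed_vector \<Rightarrow> ('a \<Rightarrow> complex) \<Rightarrow> 'a germ"
  is "\<lambda>b f t. f (b + t)" .

section \<open>Holomorphic functions of several variables\<close>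

text \<open>
  Holomorphy at a point is the existence of a power series expansion, converging
  (unconditionally) to the function on a polydisc around that point.
\<close>

definition has_expansion ::
  "(complex ^ 'n \<Rightarrow> complex) \<Rightarrow> complex ^ 'n \<Rightarrow> (nat ^ 'n \<Rightarrow> complex) \<Rightarrow> bool"
  where "has_expansion f b c \<longleftrightarrow>
    (\<exists>r>0. \<forall>t. (\<forall>i. cmod (t $ i - b $ i) < r) \<longrightarrow>
       ((\<lambda>\<nu>. c \<nu> * monomial (t - b) \<nu>) has_sum f t) UNIV)"

definition hol_at :: "(complex ^ 'n \<Rightarrow> complex) \<Rightarrow> complex ^ 'n \<Rightarrow> bool"
  where "hol_at f b \<longleftrightarrow> (\<exists>c. has_expansion f b c)"

definition hol_map_on :: "(complex ^ 'n) set \<Rightarrow> (complex ^ 'n \<Rightarrow> complex ^ 'k) \<Rightarrow> bool"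
  where "hol_map_on U f \<longleftrightarrow> (\<forall>p\<in>U. \<forall>j. hol_at (\<lambda>t. f t $ j) p)"

text \<open>The coefficients \<open>c\<^sub>\<nu>\<close> of a germ \<open>f = \<Sum> c\<^sub>\<nu> (t - b)\<^sup>\<nu>\<close> of a holomorphic function at \<open>b\<close>.\<close>

definition taylor :: "complex ^ 'n \<Rightarrow> (complex ^ 'n) germ \<Rightarrow> nat ^ 'n \<Rightarrow> complex"
  where "taylor b g = (THE c. \<exists>f. g = germ_at b f \<and> has_expansion f b c)"

section \<open>Embedded complex manifolds and local parametrisations\<close>

definition biholomorphic_between ::
  "(complex ^ 'n) set \<Rightarrow> (complex ^ 'k) set \<Rightarrow> (complex ^ 'n \<Rightarrow> complex ^ 'k)
     \<Rightarrow> (complex ^ 'k \<Rightarrow> complex ^ 'n) \<Rightarrow> bool"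
  where "biholomorphic_between U V \<phi> \<psi> \<longleftrightarrow>
    open U \<and> open V \<and> homeomorphism U V \<phi> \<psi> \<and> hol_map_on U \<phi> \<and> hol_map_on V \<psi>"

text \<open>
  Around each of its points, a submanifold is straightened to a coordinate subspace of
  dimension \<open>n\<close> by a holomorphic change of coordinates of the ambient space.
\<close>

definition embedded_complex_manifold :: "nat \<Rightarrow> (complex ^ 'm) set \<Rightarrow> bool"
  where "embedded_complex_manifold n X \<longleftrightarrow>
    (\<forall>p\<in>X. \<exists>U V \<phi> \<psi> I. p \<in> U \<and> biholomorphic_between U V \<phi> \<psi> \<and> card I = n \<and>
       \<phi> ` (X \<inter> U) = V \<inter> {z :: complex ^ 'm. \<forall>j. j \<notin> I \<longrightarrow> z $ j = 0})"

text \<open>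
  A function on an embedded manifold is holomorphic iff it is locally the restriction of a
  holomorphic function on the ambient space, so the germ of the inverse of \<open>\<Phi>\<close> is
  given by a holomorphic map \<open>\<Psi>\<close> on a neighbourhood of \<open>a\<close>.
\<close>

definition local_parametrisation ::
  "(complex ^ 'm) set \<Rightarrow> complex ^ 'm \<Rightarrow> (complex ^ 'n \<Rightarrow> complex ^ 'm) \<Rightarrow> complex ^ 'n \<Rightarrow> bool"
  where "local_parametrisation X a \<Phi> b \<longleftrightarrow> \<Phi> b = a \<and>
    (\<exists>W U \<Psi>. open W \<and> b \<in> W \<and> open U \<and> a \<in> U \<and>
       hol_map_on W \<Phi> \<and> hol_map_on U \<Psi> \<and> homeomorphism W (X \<inter> U) \<Phi> \<Psi>)"

section \<open>Polynomials on a germ, least spaces\<close>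

definition pullback_polys ::
  "(complex ^ 'n \<Rightarrow> complex ^ 'm) \<Rightarrow> complex ^ 'n \<Rightarrow> nat \<Rightarrow> (complex ^ 'n) germ set"
  where "pullback_polys \<Phi> b d = (\<lambda>F. germ_at b (\<lambda>t. mp_eval F (\<Phi> t))) ` polys_upto d"

text \<open>
  The germ at \<open>a\<close> of the restriction of a function to \<open>X\<close> is encoded by the germ of its
  extension by zero outside \<open>X\<close>.
\<close>

definition restricted_polys ::
  "(complex ^ 'm) set \<Rightarrow> complex ^ 'm \<Rightarrow> nat \<Rightarrow> (complex ^ 'm) germ set"
  where "restricted_polys X a d =
    (\<lambda>F. germ_at a (\<lambda>x. if x \<in> X then mp_eval F x else 0)) ` polys_upto d"

definition least_form :: "complex ^ 'n \<Rightarrow> (complex ^ 'n) germ \<Rightarrow> 'n mpoly"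
  where "least_form b g = (if g = 0 then 0 else
    (let c = taylor b g; k = (LEAST k. \<exists>\<nu>. weight \<nu> = k \<and> c \<nu> \<noteq> 0)
     in \<Sum>\<nu> | weight \<nu> = k. Poly_Mapping.single \<nu> (c \<nu>)))"

definition least_space ::
  "(complex ^ 'n \<Rightarrow> complex ^ 'm) \<Rightarrow> complex ^ 'n \<Rightarrow> nat \<Rightarrow> 'n mpoly set"
  where "least_space \<Phi> b d = mp.span (least_form b ` pullback_polys \<Phi> b d)"

text \<open>
  D-invariance of the point \<open>\<Phi> b\<close>, expressed through the local parametrisation \<open>\<Phi>\<close>.
\<close>

definition D_invariant ::
  "(complex ^ 'n \<Rightarrow> complex ^ 'm) \<Rightarrow> complex ^ 'n \<Rightarrow> nat \<Rightarrow> bool"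
  where "D_invariant \<Phi> b d \<longleftrightarrow> (\<forall>p\<in>least_space \<Phi> b d. \<forall>i. mp_deriv i p \<in> least_space \<Phi> b d)"

definition D_invariant_infinity ::
  "(complex ^ 'n \<Rightarrow> complex ^ 'm) \<Rightarrow> complex ^ 'n \<Rightarrow> bool"
  where "D_invariant_infinity \<Phi> b \<longleftrightarrow> (\<forall>d. D_invariant \<Phi> b d)"

definition zero_estimate ::
  "(complex ^ 'n \<Rightarrow> complex ^ 'm) \<Rightarrow> complex ^ 'n \<Rightarrow> nat \<Rightarrow> nat"
  where "zero_estimate \<Phi> b d = Max (mp_degree ` (least_space \<Phi> b d - {0}))"

definition transcendency_index ::
  "(complex ^ 'n \<Rightarrow> complex ^ 'm) \<Rightarrow> complex ^ 'n \<Rightarrow> ereal"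
  where "transcendency_index \<Phi> b =
    limsup (\<lambda>d. ereal (log (real d) (real (zero_estimate \<Phi> b d))))"

section \<open>Algebraic sets, Zariski closure of a germ\<close>

definition algebraic_set :: "(complex ^ 'm) set \<Rightarrow> bool"
  where "algebraic_set Z \<longleftrightarrow> (\<exists>S :: 'm mpoly set. Z = {x. \<forall>p\<in>S. mp_eval p x = 0})"

definition irreducible_algebraic_set :: "(complex ^ 'm) set \<Rightarrow> bool"
  where "irreducible_algebraic_set Z \<longleftrightarrow> algebraic_set Z \<and> Z \<noteq> {} \<and>
    (\<forall>A B. algebraic_set A \<longrightarrow> algebraic_set B \<longrightarrow> Z = A \<union> B \<longrightarrow> Z = A \<or> Z = B)"

text \<open>
  The (Krull) dimension for the Zariski topology: the supremum of the lengths of strictly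
  increasing chains of irreducible algebraic subsets.
\<close>

definition algebraic_dim :: "(complex ^ 'm) set \<Rightarrow> enat"
  where "algebraic_dim Z = Sup {enat k | k. \<exists>C :: nat \<Rightarrow> (complex ^ 'm) set.
    (\<forall>i\<le>k. irreducible_algebraic_set (C i) \<and> C i \<subseteq> Z) \<and> (\<forall>i<k. C i \<subset> C (Suc i))}"

text \<open>The smallest (for inclusion) algebraic set containing a representative of the germ \<open>X\<^sub>a\<close>.\<close>

definition zariski_closure :: "(complex ^ 'm) set \<Rightarrow> complex ^ 'm \<Rightarrow> (complex ^ 'm) set"
  where "zariski_closure X a =
    (LEAST Z. algebraic_set Z \<and> (\<exists>U. open U \<and> a \<in> U \<and> X \<inter> U \<subseteq> Z))"

text \<open>The Hilbert function of the Zariski closure of \<open>X\<^sub>a\<close>; the polynomials of degree at most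
  \<open>-1\<close> give the zero space.\<close>

definition hilbert_function :: "(complex ^ 'm) set \<Rightarrow> complex ^ 'm \<Rightarrow> nat \<Rightarrow> int"
  where "hilbert_function X a d = int (germ.dim (restricted_polys X a d)) -
    (if d = 0 then 0 else int (germ.dim (restricted_polys X a (d - 1))))"

end

theory Submission
  imports Defs "HOL-Complex_Analysis.Conformal_Mappings"
begin

text \<open>
  Taking least forms does not increase dimension, and since \<open>\<Phi>\<close> is an immersion the least space
  of degree \<open>d\<close> contains all polynomials of degree at most \<open>d\<close>; differentiating an element of
  maximal degree \<open>\<theta>\<close> yields one more dimension for every degree between \<open>d\<close> and \<open>\<theta>\<close>.

  Let \<open>r\<close> be the largest number of coordinates that are algebraically independent on the germ.
  The standard monomials with respect to a monomial order show that the dimension of the space of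
  polynomials of degree at most \<open>d\<close> on the germ is \<open>O(d\<^sup>r)\<close>, hence so is \<open>\<theta>\<close>. Solving, near a
  generic point, for the remaining coordinates as holomorphic functions of \<open>r\<close> independent ones
  gives a graph inside the Zariski closure. The Zariski closures of its slices, in which more and
  more coordinates are frozen, form a chain of irreducible sets of length \<open>r\<close>. Conversely, the
  number of independent coordinates strictly grows along any such chain.
\<close>

section \<open>Linear algebra\<close>

text \<open>\<open>algebraic_dim\<close> is a supremum over chains of irreducible closed sets, so
  the lower bound \<open>r\<close> has to be met by an explicit chain. Algebraic slices of the
  closure may be reducible. Images of convex slices under maps holomorphic along lines do better: a
  product of two such functions vanishes on a convex slice only if one factor does, so the closure
  of the image is irreducible. Hence the chain is cut out of an analytic graph, and holomorphy in
  several variables is used only on complex lines. The rest is counting in place of field theory. On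
  a set with at most \<open>r\<close> independent coordinates the polynomials of degree at most
  \<open>d\<close> span a space of dimension O(d^r). This bounds \<theta>; it also bounds the number
  of independent products x^\<alpha> p^\<beta>, and this forces the number of independent
  coordinates to drop on a proper closed subset of an irreducible set. The monomial order behind the
  count is not graded, so normal forms may have degree up to \<open>K * d\<close>; the factor
  \<open>K\<close> leaves the exponent \<open>r\<close> unchanged.\<close>

lemma (in vector_space) card_independent_family_le:
  assumes "finite I" and "finite T" and sp: "\<And>i. i \<in> I \<Longrightarrow> f i \<in> span T"
    and ind: "\<And>c. (\<Sum>i\<in>I. scale (c i) (f i)) = 0 \<Longrightarrow> \<forall>i\<in>I. c i = 0"
  shows "card I \<le> card T"
proof -
  have inj: "inj_on f I"
  proof (rule inj_onI, rule ccontr)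
    fix i j assume ij: "i \<in> I" "j \<in> I" "f i = f j" "i \<noteq> j"
    \<comment> \<open>A repeated vector is already a dependence of the family, namely
      \<open>f i - f j = 0\<close>.\<close>
    let ?c = "\<lambda>k. if k = i then 1 else if k = j then - 1 else (0::'a)"
    have "(\<Sum>k\<in>I. scale (?c k) (f k)) = (\<Sum>k\<in>{i,j}. scale (?c k) (f k))"
      using ij \<open>finite I\<close> by (intro sum.mono_neutral_right) auto
    also have "\<dots> = 0" using ij by simp
    finally show False using ind[of ?c] ij by force
  qed
  have "independent (f ` I)"
  proof (rule ccontr)
    assume "\<not> independent (f ` I)"
    then obtain u where u: "(\<exists>v\<in>f ` I. u v \<noteq> 0)" "(\<Sum>v\<in>f ` I. scale (u v) v) = 0"
      using dependent_finite[of "f ` I"] \<open>finite I\<close> by auto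
    have "(\<Sum>i\<in>I. scale (u (f i)) (f i)) = 0"
      using u(2) by (simp add: sum.reindex[OF inj])
    from ind[OF this] u(1) show False by auto
  qed
  then have "card (f ` I) \<le> card T"
    using independent_span_bound[of T "f ` I"] assms by auto
  then show ?thesis using card_image[OF inj] by simp
qed

text \<open>\<open>dim\<close> is the cardinality of a basis, which is 0 for an infinite one; the
  finite spanning set \<open>T\<close> excludes that case.\<close>

lemma (in vector_space) card_independent_family_le_dim:
  assumes "finite I" and "finite T" "V \<subseteq> span T" and V: "\<And>i. i \<in> I \<Longrightarrow> f i \<in> V"
    and ind: "\<And>c. (\<Sum>i\<in>I. scale (c i) (f i)) = 0 \<Longrightarrow> \<forall>i\<in>I. c i = 0"
  shows "card I \<le> dim V"
proof -
  obtain B where B: "B \<subseteq> V" "independent B" "V \<subseteq> span B" "card B = dim V"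
    using basis_exists by blast
  have "finite B"
    using independent_span_bound[of T B] \<open>finite T\<close> B \<open>V \<subseteq> span T\<close> by (meson order_trans)
  then have "card I \<le> card B"
    using assms B by (intro card_independent_family_le[where f = f]) auto
  with B show ?thesis by simp
qed

section \<open>Multi-indices and monomials\<close>

lemma weight_add: "weight (\<nu> + \<mu>) = weight \<nu> + weight \<mu>"
  by (simp add: weight_def sum.distrib)

lemma weight_zero [simp]: "weight 0 = 0"
  by (simp add: weight_def)

lemma weight_eq_0_iff [simp]: "weight \<nu> = 0 \<longleftrightarrow> \<nu> = 0"
  by (auto simp: weight_def vec_eq_iff)

lemma weight_axis [simp]: "weight (axis i k) = k"
  by (simp add: weight_def axis_def)

lemma nth_le_weight: "\<nu> $ i \<le> weight \<nu>"
  unfolding weight_def by (rule member_le_sum) auto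

lemma weight_eq_1E:
  assumes "weight \<nu> = 1" obtains i where "\<nu> = axis i 1"
proof -
  obtain i where "\<nu> $ i \<noteq> 0" using assms by (metis weight_eq_0_iff zero_neq_one vec_eq_iff zero_index)
  have "weight \<nu> = \<nu> $ i + (\<Sum>j\<in>UNIV - {i}. \<nu> $ j)"
    by (simp add: weight_def sum.remove)
  with assms \<open>\<nu> $ i \<noteq> 0\<close> have 1: "\<nu> $ i = 1" "(\<Sum>j\<in>UNIV - {i}. \<nu> $ j) = 0" by linarith+
  then have "\<forall>j\<in>UNIV - {i}. \<nu> $ j = 0" by simp
  with 1 have "\<nu> = axis i 1" by (simp add: vec_eq_iff axis_def)
  then show ?thesis by (rule that)
qed

lemma finite_exponents_le: "finite {\<nu> :: nat ^ 'n::finite. \<forall>i. \<nu> $ i \<le> d i}"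
proof -
  have "inj_on vec_nth {\<nu> :: nat ^ 'n. \<forall>i. \<nu> $ i \<le> d i}"
    by (auto simp: inj_on_def vec_eq_iff)
  moreover have "vec_nth ` {\<nu> :: nat ^ 'n. \<forall>i. \<nu> $ i \<le> d i} \<subseteq> Pi\<^sub>E UNIV (\<lambda>i. {..d i})"
    by auto
  moreover have "finite (Pi\<^sub>E (UNIV :: 'n set) (\<lambda>i. {..d i}))"
    by (rule finite_PiE) auto
  ultimately show ?thesis
    by (meson finite_imageD finite_subset)
qed

lemma finite_weight_le [simp]: "finite {\<nu> :: nat ^ 'n::finite. weight \<nu> \<le> d}"
  by (rule finite_subset[OF _ finite_exponents_le[of "\<lambda>_. d"]])
    (use nth_le_weight order_trans in blast)

lemma finite_weight_eq [simp]: "finite {\<nu> :: nat ^ 'n::finite. weight \<nu> = d}"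
  by (rule finite_subset[OF _ finite_weight_le[of d]]) auto

text \<open>Stars and bars: appending the slack \<open>d - weight \<nu>\<close> turns an exponent
  into a list of CARD('n) + 1 naturals with sum exactly \<open>d\<close>.\<close>

lemma card_weight_le:
  "card {\<nu> :: nat ^ 'n::finite. weight \<nu> \<le> d} = (CARD('n) + d) choose CARD('n)"
proof -
  let ?N = "CARD('n)"
  obtain h :: "nat \<Rightarrow> 'n" where h: "bij_betw h {0..<?N} UNIV"
    using ex_bij_betw_nat_finite[of "UNIV :: 'n set"] by auto
  have sum_h: "(\<Sum>k\<leftarrow>[0..<?N]. g (h k)) = (\<Sum>i\<in>UNIV. g i)" for g :: "'n \<Rightarrow> nat"
    using sum.reindex_bij_betw[OF h, of g] by (simp add: interv_sum_list_conv_sum_set_nat)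
  let ?F = "\<lambda>\<nu> :: nat ^ 'n. map (\<lambda>k. \<nu> $ h k) [0..<?N] @ [d - weight \<nu>]"
  have "bij_betw ?F {\<nu>. weight \<nu> \<le> d} {l. size l = ?N + 1 \<and> sum_list l = d}"
  proof (rule bij_betw_imageI)
    show "inj_on ?F {\<nu>. weight \<nu> \<le> d}"
    proof (rule inj_onI)
      fix \<nu> \<mu> :: "nat ^ 'n" assume "?F \<nu> = ?F \<mu>"
      then have "\<forall>k\<in>{0..<?N}. \<nu> $ h k = \<mu> $ h k" by simp
      then have "\<forall>i. \<nu> $ i = \<mu> $ i"
        using h by (metis UNIV_I bij_betw_imp_surj_on imageE)
      then show "\<nu> = \<mu>" by (simp add: vec_eq_iff)
    qed
    show "?F ` {\<nu>. weight \<nu> \<le> d} = {l. size l = ?N + 1 \<and> sum_list l = d}"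
    proof (intro equalityI subsetI)
      fix l assume "l \<in> ?F ` {\<nu>. weight \<nu> \<le> d}"
      then show "l \<in> {l. size l = ?N + 1 \<and> sum_list l = d}"
        using sum_h by (auto simp: weight_def)
    next
      fix l :: "nat list" assume "l \<in> {l. size l = ?N + 1 \<and> sum_list l = d}"
      then have l: "size l = ?N + 1" "sum_list l = d" by auto
      then obtain l' x where l': "l = l' @ [x]" "size l' = ?N"
        by (metis Suc_eq_plus1 length_Suc_conv_rev)
      define \<nu> :: "nat ^ 'n" where "\<nu> = (\<chi> i. l' ! inv_into {0..<?N} h i)"
      have \<nu>: "\<nu> $ h k = l' ! k" if "k < ?N" for k
        using that h by (simp add: \<nu>_def bij_betw_def inv_into_f_f)
      have map: "map (\<lambda>k. \<nu> $ h k) [0..<?N] = l'"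
        using l'(2) \<nu> by (intro nth_equalityI) auto
      have "weight \<nu> = sum_list l'"
        unfolding weight_def sum_h[symmetric] map ..
      then have "weight \<nu> \<le> d" "?F \<nu> = l" using l l' map by auto
      then show "l \<in> ?F ` {\<nu>. weight \<nu> \<le> d}" by blast
    qed
  qed
  then have "card {\<nu> :: nat ^ 'n. weight \<nu> \<le> d} = (d + (?N + 1) - 1) choose d"
    unfolding card_length_sum_list[symmetric] by (rule bij_betw_same_card)
  also have "\<dots> = (?N + d) choose ?N"
    using binomial_symmetric[of ?N "?N + d"] by (simp add: add.commute)
  finally show ?thesis .
qed

lemma monomial_add: "monomial x (\<nu> + \<mu>) = monomial x \<nu> * monomial x \<mu>"
  by (simp add: monomial_def power_add prod.distrib)

lemma monomial_zero [simp]: "monomial x 0 = 1"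
  by (simp add: monomial_def)

lemma monomial_axis: "monomial x (axis i k) = x $ i ^ k"
proof -
  have "monomial x (axis i k) = (\<Prod>j\<in>UNIV. if j = i then x $ i ^ k else 1)"
    unfolding monomial_def by (rule prod.cong) (auto simp: axis_def)
  then show ?thesis by simp
qed

lemma monomial_scale: "monomial (s *s v) \<nu> = s ^ weight \<nu> * monomial v \<nu>"
  by (simp add: monomial_def weight_def power_mult_distrib prod.distrib power_sum)

lemma norm_monomial_le:
  assumes "\<And>i. cmod (x $ i) \<le> r"
  shows "cmod (monomial x \<nu>) \<le> r ^ weight \<nu>"
proof -
  have "cmod (monomial x \<nu>) = (\<Prod>i\<in>UNIV. cmod (x $ i) ^ (\<nu> $ i))"
    by (simp add: monomial_def norm_power flip: prod_norm)
  also have "\<dots> \<le> (\<Prod>i\<in>UNIV. r ^ (\<nu> $ i))"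
    by (intro prod_mono) (simp add: assms power_mono)
  finally show ?thesis by (simp add: weight_def power_sum)
qed

text \<open>
  Exponents are compared through their codes \<open>\<Prod>\<^sub>i p\<^sub>i\<^bsup>\<nu>\<^sub>i\<^esup>\<close> for distinct
  primes \<open>p\<^sub>i\<close>: this gives a monomial order, and \<open>prime_code \<nu> ^ k\<close> is the value of the monomial
  \<open>\<nu>\<close> at the point \<open>(p\<^sub>i\<^bsup>k\<^esup>)\<^sub>i\<close>.
\<close>

definition index_prime :: "'n::finite \<Rightarrow> nat"
  where "index_prime = (SOME f. inj f \<and> (\<forall>i. prime (f i)))"

definition prime_code :: "nat ^ 'n::finite \<Rightarrow> nat"
  where "prime_code \<nu> = (\<Prod>i\<in>UNIV. index_prime i ^ (\<nu> $ i))"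

lemma inj_index_prime: "inj (index_prime :: 'n::finite \<Rightarrow> nat)"
  and prime_index_prime: "prime (index_prime (i :: 'n))"
proof -
  obtain P :: "nat set" where P: "P \<subseteq> {p. prime p}" "finite P" "card P = CARD('n)"
    using infinite_arbitrarily_large[OF primes_infinite, where n = "CARD('n)"] by metis
  then obtain f :: "'n \<Rightarrow> nat" where "bij_betw f UNIV P"
    using finite_same_card_bij[of "UNIV :: 'n set" P] by auto
  then have "inj f \<and> (\<forall>i. prime (f i))"
    using P by (auto simp: bij_betw_def)
  then have "inj (index_prime :: 'n \<Rightarrow> nat) \<and> (\<forall>i :: 'n. prime (index_prime i))"
    unfolding index_prime_def by (rule someI[where P = "\<lambda>f. inj f \<and> (\<forall>i. prime (f i))"])
  then show "inj (index_prime :: 'n \<Rightarrow> nat)" "prime (index_prime (i :: 'n))" by auto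
qed

lemma prime_code_add: "prime_code (\<nu> + \<mu>) = prime_code \<nu> * prime_code \<mu>"
  by (simp add: prime_code_def power_add prod.distrib)

lemma prime_code_pos: "prime_code \<nu> > 0"
  unfolding prime_code_def by (intro prod_pos) (simp add: prime_gt_0_nat prime_index_prime)

lemma inj_prime_code: "inj prime_code"
proof (rule injI)
  fix \<nu> \<mu> :: "nat ^ 'n" assume eq: "prime_code \<nu> = prime_code \<mu>"
  have "multiplicity (index_prime i) (prime_code \<nu>) = \<nu> $ i" for i and \<nu> :: "nat ^ 'n"
  proof -
    have "prime_code \<nu> = (\<Prod>p\<in>range (index_prime :: 'n \<Rightarrow> nat). p ^ (\<nu> $ inv index_prime p))"
      unfolding prime_code_def by (subst prod.reindex) (simp_all add: inj_index_prime inv_f_f[OF inj_index_prime])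
    then show ?thesis
      using multiplicity_prod_prime_powers[of "range (index_prime :: 'n \<Rightarrow> nat)" "index_prime i"
          "\<lambda>p. \<nu> $ inv index_prime p"]
      by (auto simp: inv_f_f[OF inj_index_prime] intro: prime_index_prime)
  qed
  then show "\<nu> = \<mu>" using eq by (metis vec_eq_iff)
qed

text \<open>The code order does not refine the degree. This bound and the reverse one below compare
  the two up to a constant factor, which is how degrees stay under control when monomials are
  rewritten by smaller codes.\<close>

lemma prime_code_ge: "2 ^ weight \<nu> \<le> prime_code \<nu>"
  unfolding weight_def prime_code_def power_sum
  by (intro prod_mono) (simp add: power_mono prime_ge_2_nat prime_index_prime)

lemma prime_code_le: "\<exists>K. \<forall>\<nu> :: nat ^ 'n::finite. prime_code \<nu> \<le> 2 ^ (K * weight \<nu>)"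
proof -
  define K where "K = Max (range (index_prime :: 'n \<Rightarrow> nat))"
  have "index_prime i \<le> (2::nat) ^ K" for i :: 'n
  proof -
    have "index_prime i \<le> K" by (simp add: K_def)
    then show ?thesis by (meson less_exp less_imp_le order_trans)
  qed
  then have "prime_code \<nu> \<le> (\<Prod>i\<in>UNIV. (2 ^ K) ^ (\<nu> $ i))" for \<nu> :: "nat ^ 'n"
    unfolding prime_code_def by (intro prod_mono) (simp add: power_mono)
  then have "prime_code \<nu> \<le> 2 ^ (K * weight \<nu>)" for \<nu> :: "nat ^ 'n"
    by (simp add: weight_def power_sum[symmetric] power_mult)
  then show ?thesis by blast
qed

lemma monomial_index_prime: "monomial (\<chi> i. of_nat (index_prime i) ^ k) \<nu> = of_nat (prime_code \<nu>) ^ k"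
  by (simp add: monomial_def prime_code_def power_mult[symmetric] mult.commute prod_power_distrib)

section \<open>Polynomials and polynomial functions\<close>

lemma mp_eval_superset:
  assumes "finite A" "Poly_Mapping.keys p \<subseteq> A"
  shows "mp_eval p x = (\<Sum>\<nu>\<in>A. Poly_Mapping.lookup p \<nu> * monomial x \<nu>)"
  unfolding mp_eval_def using assms
  by (intro sum.mono_neutral_left) (auto simp: in_keys_iff)

lemma mp_eval_zero [simp]: "mp_eval 0 x = 0"
  by (simp add: mp_eval_def)

lemma mp_eval_single [simp]: "mp_eval (Poly_Mapping.single \<nu> c) x = c * monomial x \<nu>"
  by (subst mp_eval_superset[of "{\<nu>}"]) (auto simp: )

lemma mp_eval_add: "mp_eval (p + q) x = mp_eval p x + mp_eval q x"
proof -
  let ?A = "Poly_Mapping.keys p \<union> Poly_Mapping.keys q"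
  have "Poly_Mapping.keys (p + q) \<subseteq> ?A" by (rule Poly_Mapping.keys_add)
  then show ?thesis
    by (simp add: mp_eval_superset[of ?A] lookup_add algebra_simps sum.distrib)
qed

lemma mp_eval_scale: "mp_eval (mp_scale c p) x = c * mp_eval p x"
proof -
  have "Poly_Mapping.keys (mp_scale c p) \<subseteq> Poly_Mapping.keys p"
    by (auto simp: in_keys_iff lookup_mp_scale)
  then show ?thesis
    by (simp add: mp_eval_superset[of "Poly_Mapping.keys p"] lookup_mp_scale sum_distrib_left mult.assoc)
qed

lemma mp_eval_sum: "mp_eval (sum f A) x = (\<Sum>a\<in>A. mp_eval (f a) x)"
  by (induction A rule: infinite_finite_induct) (auto simp: mp_eval_add)

lemma poly_mapping_eq_sum_single:
  "p = (\<Sum>\<nu>\<in>Poly_Mapping.keys p. Poly_Mapping.single \<nu> (Poly_Mapping.lookup p \<nu>))"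
  by (rule poly_mapping_eqI)
    (simp add: lookup_sum lookup_single when_def in_keys_iff)

lemma mp_eval_mult: "mp_eval (p * q) x = mp_eval p x * mp_eval q x"
proof -
  have "p * q = (\<Sum>\<nu>\<in>Poly_Mapping.keys p. \<Sum>\<mu>\<in>Poly_Mapping.keys q.
      Poly_Mapping.single (\<nu> + \<mu>) (Poly_Mapping.lookup p \<nu> * Poly_Mapping.lookup q \<mu>))"
    by (subst (1) poly_mapping_eq_sum_single[of p], subst (1) poly_mapping_eq_sum_single[of q])
      (simp add: sum_product mult_single)
  then have "mp_eval (p * q) x = (\<Sum>\<nu>\<in>Poly_Mapping.keys p. \<Sum>\<mu>\<in>Poly_Mapping.keys q.
      Poly_Mapping.lookup p \<nu> * Poly_Mapping.lookup q \<mu> * monomial x (\<nu> + \<mu>))"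
    by (simp only: mp_eval_sum mp_eval_single)
  also have "\<dots> = mp_eval p x * mp_eval q x"
    unfolding mp_eval_def[of p] mp_eval_def[of q]
    by (simp add: monomial_add sum_product mult_ac)
  finally show ?thesis .
qed

text \<open>At the points \<open>(p\<^sub>i\<^bsup>k\<^esup>)\<^sub>i\<close> the monomial of largest code dominates as \<open>k\<close> grows.\<close>

lemma mp_eval_eq_0_imp:
  assumes "\<And>x. mp_eval p x = 0"
  shows "p = 0"
proof (rule ccontr)
  assume "p \<noteq> 0"
  define A where "A = Poly_Mapping.keys p"
  have A: "finite A" "A \<noteq> {}" using \<open>p \<noteq> 0\<close> by (auto simp: A_def)
  then have "Max (prime_code ` A) \<in> prime_code ` A" by simp
  then obtain \<mu> where "\<mu> \<in> A" "prime_code \<mu> = Max (prime_code ` A)" by auto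
  with A have \<mu>: "\<mu> \<in> A" "\<And>\<nu>. \<nu> \<in> A \<Longrightarrow> prime_code \<nu> \<le> prime_code \<mu>" by auto
  have "(\<lambda>k. \<Sum>\<nu>\<in>A - {\<mu>}. Poly_Mapping.lookup p \<nu> * (of_nat (prime_code \<nu>) / of_nat (prime_code \<mu>)) ^ k) \<longlonglongrightarrow> 0"
  proof (rule tendsto_null_sum, rule tendsto_mult_right_zero)
    fix \<nu> assume \<nu>: "\<nu> \<in> A - {\<mu>}"
    then have "prime_code \<nu> < prime_code \<mu>" using \<mu>(2)[of \<nu>] inj_prime_code by (metis DiffD1 DiffD2 injD insertI1 nat_less_le)
    then show "(\<lambda>k. (of_nat (prime_code \<nu>) / of_nat (prime_code \<mu>)) ^ k :: complex) \<longlonglongrightarrow> 0"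
      using prime_code_pos[of \<mu>] by (intro LIMSEQ_power_zero) (simp add: norm_divide)
  qed
  \<comment> \<open>Dividing the equation at the \<open>k\<close>-th point by the dominant value
    makes this sum independent of \<open>k\<close>, so it equals its limit 0.\<close>
  moreover have "(\<Sum>\<nu>\<in>A - {\<mu>}. Poly_Mapping.lookup p \<nu> * (of_nat (prime_code \<nu>) / of_nat (prime_code \<mu>)) ^ k)
      = - Poly_Mapping.lookup p \<mu>" for k
  proof -
    have nz: "(of_nat (prime_code \<mu>) :: complex) ^ k \<noteq> 0" using prime_code_pos[of \<mu>] by simp
    have "0 = (\<Sum>\<nu>\<in>A. Poly_Mapping.lookup p \<nu> * of_nat (prime_code \<nu>) ^ k)"
      using assms[of "\<chi> i. of_nat (index_prime i) ^ k"]
      by (simp add: mp_eval_def monomial_index_prime A_def)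
    also have "\<dots> = Poly_Mapping.lookup p \<mu> * of_nat (prime_code \<mu>) ^ k
        + (\<Sum>\<nu>\<in>A - {\<mu>}. Poly_Mapping.lookup p \<nu> * of_nat (prime_code \<nu>) ^ k)"
      using A \<mu> by (simp add: sum.remove)
    finally have "(\<Sum>\<nu>\<in>A - {\<mu>}. Poly_Mapping.lookup p \<nu> * of_nat (prime_code \<nu>) ^ k)
      = - Poly_Mapping.lookup p \<mu> * of_nat (prime_code \<mu>) ^ k"
      unfolding eq_commute[of 0] add_eq_0_iff by simp
    then have "(\<Sum>\<nu>\<in>A - {\<mu>}. Poly_Mapping.lookup p \<nu> * of_nat (prime_code \<nu>) ^ k) / of_nat (prime_code \<mu>) ^ k
      = - Poly_Mapping.lookup p \<mu>" using nz by simp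
    then show ?thesis by (simp add: sum_divide_distrib power_divide)
  qed
  ultimately have "Poly_Mapping.lookup p \<mu> = 0" by (simp add: LIMSEQ_const_iff)
  then show False using \<mu>(1) by (simp add: A_def in_keys_iff)
qed

lemma mp_span_single:
  fixes A :: "(nat ^ 'n::finite) set"
  shows "mp.span ((\<lambda>\<nu>. Poly_Mapping.single \<nu> 1) ` A) = {p. Poly_Mapping.keys p \<subseteq> A}"
proof (intro equalityI subsetI)
  fix p :: "'n mpoly" assume "p \<in> mp.span ((\<lambda>\<nu>. Poly_Mapping.single \<nu> 1) ` A)"
  moreover have "mp.span ((\<lambda>\<nu>. Poly_Mapping.single \<nu> 1) ` A) \<subseteq> {p. Poly_Mapping.keys p \<subseteq> A}"
  proof (rule mp.span_minimal)
    show "mp.subspace {p. Poly_Mapping.keys p \<subseteq> A}"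
    proof (rule mp.subspaceI)
      show "p + q \<in> {p. Poly_Mapping.keys p \<subseteq> A}"
        if "p \<in> {p. Poly_Mapping.keys p \<subseteq> A}" "q \<in> {p. Poly_Mapping.keys p \<subseteq> A}" for p q :: "'n mpoly"
        using that Poly_Mapping.keys_add[of p q] by blast
      show "mp_scale c p \<in> {p. Poly_Mapping.keys p \<subseteq> A}"
        if "p \<in> {p. Poly_Mapping.keys p \<subseteq> A}" for c and p :: "'n mpoly"
        using that by (auto simp: subset_iff in_keys_iff lookup_mp_scale)
    qed simp
  qed auto
  ultimately show "p \<in> {p. Poly_Mapping.keys p \<subseteq> A}" by blast
next
  fix p :: "'n mpoly" assume p: "p \<in> {p. Poly_Mapping.keys p \<subseteq> A}"
  have "Poly_Mapping.single \<nu> (Poly_Mapping.lookup p \<nu>)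
      = mp_scale (Poly_Mapping.lookup p \<nu>) (Poly_Mapping.single \<nu> 1)" for \<nu>
    by (rule poly_mapping_eqI) (simp add: lookup_mp_scale lookup_single when_def)
  then have "p = (\<Sum>\<nu>\<in>Poly_Mapping.keys p. mp_scale (Poly_Mapping.lookup p \<nu>) (Poly_Mapping.single \<nu> 1))"
    using poly_mapping_eq_sum_single[of p] by simp
  also have "\<dots> \<in> mp.span ((\<lambda>\<nu>. Poly_Mapping.single \<nu> 1) ` A)"
    using p by (intro mp.span_sum mp.span_scale mp.span_base) auto
  finally show "p \<in> mp.span ((\<lambda>\<nu>. Poly_Mapping.single \<nu> 1) ` A)" .
qed

lemma polys_upto_eq_span:
  "polys_upto d = mp.span ((\<lambda>\<nu>. Poly_Mapping.single \<nu> 1) ` {\<nu>. weight \<nu> \<le> d})"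
  by (auto simp: mp_span_single polys_upto_def)

lemma subspace_polys_upto: "mp.subspace (polys_upto d)"
  by (simp add: polys_upto_eq_span)

lemma polys_upto_mult: "p \<in> polys_upto d \<Longrightarrow> q \<in> polys_upto e \<Longrightarrow> p * q \<in> polys_upto (d + e)"
  using Poly_Mapping.keys_mult[of p q] unfolding polys_upto_def
  by (fastforce simp: weight_add add_mono)

lemma polys_upto_mono: "d \<le> e \<Longrightarrow> polys_upto d \<subseteq> polys_upto e"
  by (auto simp: polys_upto_def)

lemma in_polys_upto: "\<exists>d. p \<in> polys_upto d"
  unfolding polys_upto_def
  by (rule exI[of _ "Max (weight ` Poly_Mapping.keys p)"]) auto

text \<open>Polynomial functions in the coordinates of \<open>T\<close>, generated by rules instead
  of coefficients: whatever is stable under sums and products, such as holomorphy, passes to them by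
  rule induction. \<open>polyfun_imp_mp_eval\<close> leads back to coefficients.\<close>

inductive_set polyfun :: "'m::finite set \<Rightarrow> (complex ^ 'm \<Rightarrow> complex) set" for T where
  polyfun_const: "(\<lambda>_. c) \<in> polyfun T"
| polyfun_var: "i \<in> T \<Longrightarrow> (\<lambda>x. x $ i) \<in> polyfun T"
| polyfun_add: "f \<in> polyfun T \<Longrightarrow> g \<in> polyfun T \<Longrightarrow> (\<lambda>x. f x + g x) \<in> polyfun T"
| polyfun_mult: "f \<in> polyfun T \<Longrightarrow> g \<in> polyfun T \<Longrightarrow> (\<lambda>x. f x * g x) \<in> polyfun T"

lemma polyfun_mono: "f \<in> polyfun T \<Longrightarrow> T \<subseteq> T' \<Longrightarrow> f \<in> polyfun T'"
  by (induction rule: polyfun.induct) (auto intro: polyfun.intros)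

lemma polyfun_diff: "f \<in> polyfun T \<Longrightarrow> g \<in> polyfun T \<Longrightarrow> (\<lambda>x. f x - g x) \<in> polyfun T"
  using polyfun_add[of f T "\<lambda>x. (- 1) * g x"] polyfun_mult[OF polyfun_const, of g T "-1"] by simp

lemma polyfun_power: "f \<in> polyfun T \<Longrightarrow> (\<lambda>x. f x ^ k) \<in> polyfun T"
  by (induction k) (auto intro: polyfun.intros)

lemma polyfun_sum: "(\<And>i. i \<in> I \<Longrightarrow> f i \<in> polyfun T) \<Longrightarrow> (\<lambda>x. \<Sum>i\<in>I. f i x) \<in> polyfun T"
  by (induction I rule: infinite_finite_induct) (auto intro: polyfun.intros)

lemma polyfun_prod: "(\<And>i. i \<in> I \<Longrightarrow> f i \<in> polyfun T) \<Longrightarrow> (\<lambda>x. \<Prod>i\<in>I. f i x) \<in> polyfun T"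
  by (induction I rule: infinite_finite_induct) (auto intro: polyfun.intros)

lemma polyfun_mp_eval: "mp_eval p \<in> polyfun UNIV"
  unfolding mp_eval_def[abs_def] monomial_def
  by (intro polyfun_sum polyfun_mult polyfun_const polyfun_prod polyfun_power polyfun_var) auto

lemma polyfun_cong: "f \<in> polyfun T \<Longrightarrow> (\<And>i. i \<in> T \<Longrightarrow> x $ i = y $ i) \<Longrightarrow> f x = f y"
  by (induction rule: polyfun.induct) auto

lemma polyfun_imp_mp_eval:
  assumes "f \<in> polyfun T"
  shows "\<exists>p. f = mp_eval p \<and> (\<forall>\<nu>\<in>Poly_Mapping.keys p. \<forall>i. i \<notin> T \<longrightarrow> \<nu> $ i = 0)"
  using assms
proof (induction rule: polyfun.induct)
  case (polyfun_const c)
  show ?case by (rule exI[of _ "Poly_Mapping.single 0 c"]) auto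
next
  case (polyfun_var i)
  then show ?case
    by (intro exI[of _ "Poly_Mapping.single (axis i 1) 1"])
      (auto simp: monomial_axis fun_eq_iff, auto simp: axis_def split: if_splits)
next
  case (polyfun_add f g)
  then obtain p q where "f = mp_eval p" "g = mp_eval q"
    "\<forall>\<nu>\<in>Poly_Mapping.keys p. \<forall>i. i \<notin> T \<longrightarrow> \<nu> $ i = 0"
    "\<forall>\<nu>\<in>Poly_Mapping.keys q. \<forall>i. i \<notin> T \<longrightarrow> \<nu> $ i = 0" by auto
  then show ?case
    using Poly_Mapping.keys_add[of p q] by (intro exI[of _ "p + q"]) (auto simp: mp_eval_add)
next
  case (polyfun_mult f g)
  then obtain p q where "f = mp_eval p" "g = mp_eval q"
    "\<forall>\<nu>\<in>Poly_Mapping.keys p. \<forall>i. i \<notin> T \<longrightarrow> \<nu> $ i = 0"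
    "\<forall>\<nu>\<in>Poly_Mapping.keys q. \<forall>i. i \<notin> T \<longrightarrow> \<nu> $ i = 0" by auto
  note pq = this
  show ?case
  proof (intro exI conjI ballI allI impI)
    show "(\<lambda>x. f x * g x) = mp_eval (p * q)" using pq by (simp add: mp_eval_mult fun_eq_iff)
    fix \<nu> i assume "\<nu> \<in> Poly_Mapping.keys (p * q)" "i \<notin> T"
    moreover then obtain \<alpha> \<beta> where "\<nu> = \<alpha> + \<beta>" "\<alpha> \<in> Poly_Mapping.keys p" "\<beta> \<in> Poly_Mapping.keys q"
      using Poly_Mapping.keys_mult[of p q] by blast
    ultimately show "\<nu> $ i = 0" using pq by simp
  qed
qed

section \<open>Zariski closures and irreducibility\<close>

definition zariski_hull :: "(complex ^ 'm) set \<Rightarrow> (complex ^ 'm) set"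
  where "zariski_hull E = {x. \<forall>p. (\<forall>y\<in>E. mp_eval p y = 0) \<longrightarrow> mp_eval p x = 0}"

text \<open>The ideal of polynomials vanishing on \<open>E\<close> is prime or the unit ideal.\<close>

definition prime_vanishing :: "(complex ^ 'm) set \<Rightarrow> bool"
  where "prime_vanishing E \<longleftrightarrow> (\<forall>f\<in>polyfun UNIV. \<forall>g\<in>polyfun UNIV.
    (\<forall>x\<in>E. f x * g x = 0) \<longrightarrow> (\<forall>x\<in>E. f x = 0) \<or> (\<forall>x\<in>E. g x = 0))"

lemma subset_zariski_hull: "E \<subseteq> zariski_hull E"
  by (auto simp: zariski_hull_def)

lemma algebraic_set_zariski_hull: "algebraic_set (zariski_hull E)"
  unfolding algebraic_set_def zariski_hull_def
  by (rule exI[of _ "{p. \<forall>y\<in>E. mp_eval p y = 0}"]) auto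

lemma zariski_hull_minimal:
  assumes "algebraic_set Z" "E \<subseteq> Z"
  shows "zariski_hull E \<subseteq> Z"
  using assms unfolding algebraic_set_def zariski_hull_def by blast

lemma polyfun_zero_zariski_hull:
  assumes "f \<in> polyfun T" "\<And>y. y \<in> E \<Longrightarrow> f y = 0" "x \<in> zariski_hull E"
  shows "f x = 0"
  using assms polyfun_imp_mp_eval[OF assms(1)] by (auto simp: zariski_hull_def)

lemma algebraic_set_Int: "algebraic_set A \<Longrightarrow> algebraic_set B \<Longrightarrow> algebraic_set (A \<inter> B)"
  unfolding algebraic_set_def by (clarify, rule_tac x = "S \<union> Sa" in exI) auto

lemma algebraic_set_zeros:
  assumes "f \<in> polyfun T" shows "algebraic_set {x. f x = 0}"
proof -
  obtain p where "f = mp_eval p" using polyfun_imp_mp_eval[OF assms] by blast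
  then show ?thesis unfolding algebraic_set_def by (intro exI[of _ "{p}"]) simp
qed

text \<open>A cover by two proper closed subsets would give \<open>p\<close> and \<open>q\<close>
  whose product vanishes on \<open>E\<close> although neither factor does: each is nonzero somewhere
  on the hull, and vanishing on \<open>E\<close> passes to the hull.\<close>

lemma irreducible_zariski_hull:
  assumes "prime_vanishing E" "E \<noteq> {}"
  shows "irreducible_algebraic_set (zariski_hull E)"
proof -
  have "zariski_hull E = A \<or> zariski_hull E = B"
    if A: "algebraic_set A" and B: "algebraic_set B" and AB: "zariski_hull E = A \<union> B" for A B
  proof (rule ccontr)
    assume "\<not> ?thesis"
    with AB obtain x y where x: "x \<in> zariski_hull E" "x \<notin> A" and y: "y \<in> zariski_hull E" "y \<notin> B"
      by blast
    from A x obtain p where p: "\<And>z. z \<in> A \<Longrightarrow> mp_eval p z = 0" "mp_eval p x \<noteq> 0"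
      unfolding algebraic_set_def by blast
    from B y obtain q where q: "\<And>z. z \<in> B \<Longrightarrow> mp_eval q z = 0" "mp_eval q y \<noteq> 0"
      unfolding algebraic_set_def by blast
    have "\<forall>z\<in>E. mp_eval p z * mp_eval q z = 0"
      using p q AB subset_zariski_hull[of E] by auto
    then have "(\<forall>z\<in>E. mp_eval p z = 0) \<or> (\<forall>z\<in>E. mp_eval q z = 0)"
      using assms(1) polyfun_mp_eval unfolding prime_vanishing_def by blast
    then show False
      using x y p q by (auto simp: zariski_hull_def)
  qed
  moreover have "zariski_hull E \<noteq> {}"
    using assms subset_zariski_hull by auto
  ultimately show ?thesis
    unfolding irreducible_algebraic_set_def by (auto simp: algebraic_set_zariski_hull)
qed

lemma irreducible_imp_prime_vanishing:
  assumes "irreducible_algebraic_set Z"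
  shows "prime_vanishing Z"
  unfolding prime_vanishing_def
proof (intro ballI impI)
  fix f g :: "complex ^ 'a \<Rightarrow> complex"
  assume fg: "f \<in> polyfun UNIV" "g \<in> polyfun UNIV" "\<forall>x\<in>Z. f x * g x = 0"
  let ?A = "Z \<inter> {x. f x = 0}" and ?B = "Z \<inter> {x. g x = 0}"
  have Z: "algebraic_set Z" using assms by (simp add: irreducible_algebraic_set_def)
  have "algebraic_set ?A" "algebraic_set ?B"
    using fg by (auto intro!: algebraic_set_Int[OF Z] algebraic_set_zeros)
  moreover have "Z = ?A \<union> ?B" using fg by auto
  ultimately have "Z = ?A \<or> Z = ?B"
    using assms unfolding irreducible_algebraic_set_def by metis
  then show "(\<forall>x\<in>Z. f x = 0) \<or> (\<forall>x\<in>Z. g x = 0)" by blast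
qed

lemma prime_vanishingD:
  assumes "prime_vanishing E" "f \<in> polyfun UNIV" "g \<in> polyfun UNIV"
    and "\<And>x. x \<in> E \<Longrightarrow> f x * g x = 0" "\<not> (\<forall>x\<in>E. f x = 0)"
  shows "\<forall>x\<in>E. g x = 0"
proof -
  have "(\<forall>x\<in>E. f x = 0) \<or> (\<forall>x\<in>E. g x = 0)"
    using assms(1)[unfolded prime_vanishing_def, rule_format, OF assms(2,3)] assms(4) by blast
  then show ?thesis using assms(5) by simp
qed

lemma prime_vanishing_power:
  assumes "prime_vanishing E" "f \<in> polyfun UNIV" "g \<in> polyfun UNIV"
    and "\<forall>x\<in>E. f x ^ k * g x = 0" "\<not> (\<forall>x\<in>E. f x = 0)"
  shows "\<forall>x\<in>E. g x = 0"
  using assms(4)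
proof (induction k)
  case 0
  then show ?case by simp
next
  case (Suc k)
  have "(\<lambda>x. f x ^ k * g x) \<in> polyfun UNIV"
    by (intro polyfun_mult polyfun_power assms)
  moreover have "\<forall>x\<in>E. f x * (f x ^ k * g x) = 0"
    using Suc.prems by (simp add: mult.assoc)
  ultimately have "\<forall>x\<in>E. f x ^ k * g x = 0"
    using prime_vanishingD[OF assms(1,2) _ _ assms(5)] by blast
  then show ?case by (rule Suc.IH)
qed

text \<open>Source of generic points: finitely many conditions of the form
  \<open>f i x \<noteq> 0\<close>, each satisfiable on \<open>E\<close>, are satisfiable
  together.\<close>

lemma prime_vanishing_prod:
  assumes "prime_vanishing E" "finite I" "E \<noteq> {}"
    and "\<And>i. i \<in> I \<Longrightarrow> f i \<in> polyfun UNIV \<and> (\<exists>x\<in>E. f i x \<noteq> 0)"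
  shows "\<exists>x\<in>E. \<forall>i\<in>I. f i x \<noteq> 0"
proof -
  have "\<exists>x\<in>E. (\<Prod>i\<in>I. f i x) \<noteq> 0"
    using assms(2,4)
  proof (induction I rule: finite_induct)
    case empty
    then show ?case using assms(3) by auto
  next
    case (insert i I)
    have "f i \<in> polyfun UNIV" "(\<lambda>x. \<Prod>i\<in>I. f i x) \<in> polyfun UNIV"
      using insert by (auto intro: polyfun_prod)
    moreover have "\<not> (\<forall>x\<in>E. f i x = 0)" "\<not> (\<forall>x\<in>E. (\<Prod>i\<in>I. f i x) = 0)"
      using insert by auto
    ultimately have "\<not> (\<forall>x\<in>E. f i x * (\<Prod>i\<in>I. f i x) = 0)"
      using prime_vanishingD[OF assms(1)] by blast
    then show ?case using insert by simp
  qed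
  then show ?thesis using assms(2) by (auto simp: prod_zero_iff)
qed

section \<open>Functions that are holomorphic along complex lines\<close>

text \<open>Identity theorems only need the complex line joining two points, and holomorphy on lines
  is inherited by polynomial expressions and uniform limits through one-variable theory. Joint
  continuity is included because it supplies the open neighbourhoods on which roots are
  continued.\<close>

definition line_hol :: "(complex ^ 'm) set \<Rightarrow> (complex ^ 'm \<Rightarrow> complex) \<Rightarrow> bool"
  where "line_hol B f \<longleftrightarrow> continuous_on B f \<and>
    (\<forall>p v. (\<lambda>s. f (p + s *s v)) holomorphic_on {s. p + s *s v \<in> B})"

lemma continuous_line: "continuous_on S (\<lambda>s. p + s *s (v :: complex ^ 'm))"
  unfolding vector_scalar_mult_def by (intro continuous_intros)

lemma open_line:
  assumes "open B" shows "open {s. p + s *s (v :: complex ^ 'm) \<in> B}"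
  using open_vimage[OF assms continuous_line[of UNIV p v]] by (simp add: vimage_def)

lemma convex_line:
  assumes "convex B" shows "convex {s. p + s *s (v :: complex ^ 'm) \<in> B}"
proof (rule convexI, clarify)
  fix s t :: complex and a b :: real
  assume *: "p + s *s v \<in> B" "p + t *s v \<in> B" "0 \<le> a" "0 \<le> b" "a + b = 1"
  have "p + (a *\<^sub>R s + b *\<^sub>R t) *s v = a *\<^sub>R (p + s *s v) + b *\<^sub>R (p + t *s v)"
  proof (subst vec_eq_iff, intro allI)
    fix i
    have "a *\<^sub>R (p $ i) + b *\<^sub>R (p $ i) = p $ i"
      using * by (simp flip: scaleR_add_left)
    then have "p $ i + (a *\<^sub>R s + b *\<^sub>R t) * v $ i = a *\<^sub>R (p $ i + s * v $ i) + b *\<^sub>R (p $ i + t * v $ i)"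
      by (simp add: algebra_simps)
    then show "(p + (a *\<^sub>R s + b *\<^sub>R t) *s v) $ i = (a *\<^sub>R (p + s *s v) + b *\<^sub>R (p + t *s v)) $ i"
      by (simp only: vector_add_component vector_smult_component vector_scaleR_component)
  qed
  then show "p + (a *\<^sub>R s + b *\<^sub>R t) *s v \<in> B"
    using * convexD[OF assms] by simp
qed

lemma line_hol_subset: "line_hol B f \<Longrightarrow> B' \<subseteq> B \<Longrightarrow> line_hol B' f"
  unfolding line_hol_def by (fast intro: continuous_on_subset holomorphic_on_subset)

lemma line_hol_cong: "line_hol B f \<Longrightarrow> (\<And>x. x \<in> B \<Longrightarrow> f x = g x) \<Longrightarrow> line_hol B g"
  unfolding line_hol_def
  by (auto cong: continuous_on_cong elim!: allE holomorphic_transform)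

lemma line_hol_const: "line_hol B (\<lambda>_. c)"
  by (simp add: line_hol_def)

lemma line_hol_coord: "line_hol B (\<lambda>x. x $ i)"
  unfolding line_hol_def by (auto intro!: continuous_intros holomorphic_intros)

lemma line_hol_add: "line_hol B f \<Longrightarrow> line_hol B g \<Longrightarrow> line_hol B (\<lambda>x. f x + g x)"
  unfolding line_hol_def by (auto intro!: continuous_intros holomorphic_intros)

lemma line_hol_mult: "line_hol B f \<Longrightarrow> line_hol B g \<Longrightarrow> line_hol B (\<lambda>x. f x * g x)"
  unfolding line_hol_def by (auto intro!: continuous_intros holomorphic_intros)

lemma line_hol_sum: "(\<And>i. i \<in> I \<Longrightarrow> line_hol B (f i)) \<Longrightarrow> line_hol B (\<lambda>x. \<Sum>i\<in>I. f i x)"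
  by (induction I rule: infinite_finite_induct) (auto intro: line_hol_const line_hol_add)

lemma line_hol_power: "line_hol B f \<Longrightarrow> line_hol B (\<lambda>x. f x ^ k)"
  by (induction k) (auto intro: line_hol_const line_hol_mult)

lemma line_hol_polyfun:
  assumes "f \<in> polyfun T" "\<And>i. i \<in> T \<Longrightarrow> line_hol B (\<lambda>u. G u $ i)"
  shows "line_hol B (\<lambda>u. f (G u))"
  using assms by (induction) (auto intro: line_hol_const line_hol_add line_hol_mult)

lemma line_hol_uniform_limit:
  assumes "open B" "\<And>n. line_hol B (f n)" "uniform_limit B f g sequentially"
  shows "line_hol B g"
  unfolding line_hol_def
proof (intro conjI allI)
  show "continuous_on B g"
    using assms by (intro uniform_limit_theorem[OF _ assms(3)]) (auto simp: line_hol_def)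
  fix p v
  let ?S = "{s. p + s *s v \<in> B}"
  have S: "open ?S" using assms(1) by (rule open_line)
  have ul: "uniform_limit ?S (\<lambda>n s. f n (p + s *s v)) (\<lambda>s. g (p + s *s v)) sequentially"
    using assms(3) unfolding uniform_limit_iff by (auto elim!: eventually_mono)
  show "(\<lambda>s. g (p + s *s v)) holomorphic_on ?S"
  proof (rule holomorphic_uniform_sequence[OF S])
    show "(\<lambda>s. f n (p + s *s v)) holomorphic_on ?S" for n
      using assms(2) by (simp add: line_hol_def)
    show "\<exists>d>0. cball s d \<subseteq> ?S \<and>
        uniform_limit (cball s d) (\<lambda>n s. f n (p + s *s v)) (\<lambda>s. g (p + s *s v)) sequentially"
      if "s \<in> ?S" for s
      using open_contains_cball[THEN iffD1, OF S] that uniform_limit_on_subset[OF ul] by blast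
  qed
qed

text \<open>The parameters \<open>s\<close> for which the line from \<open>p\<close> to
  \<open>q\<close> stays in \<open>B\<close> form an open convex, hence connected, set containing
  \<open>U\<close> and 1. The one-variable identity theorem carries the zeros from \<open>U\<close>
  to \<open>s = 1\<close>, that is, to \<open>q\<close>.\<close>

lemma line_hol_continuation:
  assumes B: "open B" "convex B" and g: "line_hol B g" and "p \<in> B" "q \<in> B"
    and U: "open U" "0 \<in> U" "\<And>s. s \<in> U \<Longrightarrow> p + s *s (q - p) \<in> B"
    and 0: "\<And>s. s \<in> U \<Longrightarrow> g (p + s *s (q - p)) = 0"
  shows "g q = 0"
proof -
  define l where "l s = p + s *s (q - p)" for s
  define S where "S = {s. l s \<in> B}"
  have "open S" "connected S"
    unfolding S_def l_def
    by (rule open_line[OF B(1)], rule convex_connected[OF convex_line[OF B(2)]])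
  moreover have "(\<lambda>s. g (l s)) holomorphic_on S"
    using g unfolding line_hol_def S_def l_def by blast
  moreover have "U \<subseteq> S" using U(3) unfolding S_def l_def by blast
  moreover have l1: "l 1 = q" by (simp add: l_def)
  then have "1 \<in> S" using \<open>q \<in> B\<close> by (simp add: S_def)
  moreover have "g (l s) = 0" if "s \<in> U" for s using 0 that by (simp only: l_def)
  ultimately have "g (l 1) = 0"
    using U(1,2) by (intro analytic_continuation_open[of U S "\<lambda>s. g (l s)" "\<lambda>_. 0" 1]) auto
  then show ?thesis by (simp only: l1)
qed

text \<open>If \<open>f p\<close> and \<open>g q\<close> were both nonzero, then on the line from
  \<open>p\<close> to \<open>q\<close> the factor \<open>f\<close> would be nonzero near
  \<open>p\<close>, so \<open>g\<close> would vanish there and, by continuation, at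
  \<open>q\<close>. Freezing coordinates does no harm: the line through two points of
  \<open>A\<close> keeps them frozen.\<close>

lemma line_hol_mult_eq_0:
  assumes B: "open B" "convex B" and f: "line_hol B f" and g: "line_hol B g"
    and A: "A = {u \<in> B. \<forall>i\<in>R. u $ i = c i}" and fg: "\<And>u. u \<in> A \<Longrightarrow> f u * g u = 0"
  shows "(\<forall>u\<in>A. f u = 0) \<or> (\<forall>u\<in>A. g u = 0)"
proof (rule ccontr)
  assume "\<not> ?thesis"
  then obtain p q where p: "p \<in> A" "f p \<noteq> 0" and q: "q \<in> A" "g q \<noteq> 0" by auto
  define l where "l s = p + s *s (q - p)" for s
  define S where "S = {s. l s \<in> B}"
  have "open S" unfolding S_def l_def by (rule open_line[OF B(1)])
  have hf: "(\<lambda>s. f (l s)) holomorphic_on S"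
    using f unfolding line_hol_def S_def l_def by blast
  have lA: "l s \<in> A" if "s \<in> S" for s
    using that p(1) q(1) by (simp add: A S_def l_def)
  have l0: "l 0 = p" by (simp add: l_def)
  have "g q = 0"
  proof (rule line_hol_continuation[OF B g])
    show "p \<in> B" "q \<in> B" using p q A by auto
    show "open (S \<inter> (\<lambda>s. f (l s)) -` (- {0}))"
      by (rule continuous_open_preimage[OF holomorphic_on_imp_continuous_on[OF hf] \<open>open S\<close>]) auto
    show "0 \<in> S \<inter> (\<lambda>s. f (l s)) -` (- {0})"
      using p A by (simp add: S_def l0)
    fix s assume s: "s \<in> S \<inter> (\<lambda>s. f (l s)) -` (- {0})"
    then show "p + s *s (q - p) \<in> B" unfolding S_def l_def by blast
    show "g (p + s *s (q - p)) = 0"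
      using fg[OF lA, of s] s unfolding l_def[symmetric] by simp
  qed
  then show False using q by simp
qed

lemma line_hol_eq_0:
  assumes B: "open B" "convex B" and f: "line_hol B f" and "b \<in> B"
    and ev: "eventually (\<lambda>u. f u = 0) (nhds b)" and "u \<in> B"
  shows "f u = 0"
proof -
  obtain N where N: "open N" "b \<in> N" "\<And>x. x \<in> N \<Longrightarrow> f x = 0"
    using ev by (auto simp: eventually_nhds)
  show ?thesis
  proof (rule line_hol_continuation[OF B f \<open>b \<in> B\<close> \<open>u \<in> B\<close>])
    show "open {s. b + s *s (u - b) \<in> B \<inter> N}"
      using B N by (intro open_line open_Int)
    show "0 \<in> {s. b + s *s (u - b) \<in> B \<inter> N}" using N \<open>b \<in> B\<close> by simp
  qed (use N(3) in blast)+
qed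

text \<open>All irreducible sets constructed below come from here: slices of the graph for the
  chain, and the image of a ball, with no coordinate frozen, for the germ itself.\<close>

lemma prime_vanishing_line_hol_image:
  assumes "open B" "convex B" and "\<And>i. line_hol B (\<lambda>u. G u $ i)"
  shows "prime_vanishing (G ` {u \<in> B. \<forall>i\<in>R. u $ i = c i})"
  unfolding prime_vanishing_def
proof (intro ballI impI)
  fix f g assume fg: "f \<in> polyfun UNIV" "g \<in> polyfun UNIV"
    "\<forall>x\<in>G ` {u \<in> B. \<forall>i\<in>R. u $ i = c i}. f x * g x = 0"
  have "line_hol B (\<lambda>u. f (G u))" "line_hol B (\<lambda>u. g (G u))"
    using fg assms by (auto intro: line_hol_polyfun)
  from line_hol_mult_eq_0[OF assms(1,2) this refl, of R c] fg(3)
  show "(\<forall>x\<in>G ` {u \<in> B. \<forall>i\<in>R. u $ i = c i}. f x = 0) \<or>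
      (\<forall>x\<in>G ` {u \<in> B. \<forall>i\<in>R. u $ i = c i}. g x = 0)"
    by blast
qed

section \<open>Independent coordinates and growth\<close>

text \<open>Algebraic independence of the coordinate functions on \<open>E\<close>. When the ideal
  of a nonempty \<open>E\<close> is prime, the largest size of such a set is the transcendence
  degree of its function field. For empty \<open>E\<close> not even \<open>{}\<close> qualifies,
  since the constant 1 vanishes on it.\<close>

definition indep_coords :: "(complex ^ 'm) set \<Rightarrow> 'm set \<Rightarrow> bool"
  where "indep_coords E S \<longleftrightarrow> (\<forall>f\<in>polyfun S. (\<forall>x\<in>E. f x = 0) \<longrightarrow> (\<forall>x. f x = 0))"

lemma indep_coords_empty:
  assumes "E \<noteq> {}" shows "indep_coords E {}"
proof -
  obtain y where "y \<in> E" using assms by auto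
  have "f x = 0" if "f \<in> polyfun {}" "\<forall>x\<in>E. f x = 0" for f x
    using polyfun_cong[OF that(1), of x y] that(2) \<open>y \<in> E\<close> by simp
  then show ?thesis by (simp add: indep_coords_def)
qed

lemma card_exponents_le: "card {\<nu> :: nat ^ 'n::finite. \<forall>i. \<nu> $ i \<le> d i} = (\<Prod>i\<in>UNIV. d i + 1)"
proof -
  have "bij_betw vec_nth {\<nu> :: nat ^ 'n. \<forall>i. \<nu> $ i \<le> d i} (Pi\<^sub>E UNIV (\<lambda>i. {..d i}))"
  proof (rule bij_betw_imageI)
    show "inj_on vec_nth {\<nu> :: nat ^ 'n. \<forall>i. \<nu> $ i \<le> d i}"
      by (auto simp: inj_on_def vec_eq_iff)
    show "vec_nth ` {\<nu> :: nat ^ 'n. \<forall>i. \<nu> $ i \<le> d i} = Pi\<^sub>E UNIV (\<lambda>i. {..d i})"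
    proof (intro equalityI subsetI)
      fix f assume "f \<in> Pi\<^sub>E (UNIV :: 'n set) (\<lambda>i. {..d i})"
      then have "vec_lambda f \<in> {\<nu>. \<forall>i. \<nu> $ i \<le> d i}" by auto
      moreover have "f = vec_nth (vec_lambda f)" by (simp add: fun_eq_iff)
      ultimately show "f \<in> vec_nth ` {\<nu>. \<forall>i. \<nu> $ i \<le> d i}" by (rule rev_image_eqI)
    qed auto
  qed
  then have "card {\<nu> :: nat ^ 'n. \<forall>i. \<nu> $ i \<le> d i} = card (Pi\<^sub>E (UNIV :: 'n set) (\<lambda>i. {..d i}))"
    by (rule bij_betw_same_card)
  then show ?thesis by (simp add: card_PiE)
qed

text \<open>
  The leading monomials of the dependence relations leave only monomials with at most \<open>r\<close>
  large exponents.
\<close>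

lemma polynomial_growth:
  fixes E :: "(complex ^ 'm) set"
  assumes r: "\<And>T. indep_coords E T \<Longrightarrow> card T \<le> r"
  shows "\<exists>C K. \<forall>d. \<exists>A. finite A \<and> card A \<le> C * (K * d + 1) ^ r \<and>
    (\<forall>p\<in>polys_upto d. \<exists>q\<in>mp.span ((\<lambda>\<nu>. Poly_Mapping.single \<nu> 1) ` A).
      \<forall>x\<in>E. mp_eval q x = mp_eval p x)"
proof -
  let ?sp = "\<lambda>A. mp.span ((\<lambda>\<nu> :: nat ^ 'm. Poly_Mapping.single \<nu> (1::complex)) ` A)"
  have "\<forall>T. \<exists>p. card T > r \<longrightarrow> p \<noteq> 0 \<and>
      (\<forall>\<nu>\<in>Poly_Mapping.keys p. \<forall>i. i \<notin> T \<longrightarrow> \<nu> $ i = 0) \<and> (\<forall>x\<in>E. mp_eval p x = 0)"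
    (is "\<forall>T. \<exists>p. ?Q T p")
  proof
    fix T :: "'m set"
    show "\<exists>p. ?Q T p"
    proof (cases "card T > r")
      case True
      then have "\<not> indep_coords E T" using r[of T] by linarith
      then obtain f x where f: "f \<in> polyfun T" "\<forall>x\<in>E. f x = 0" "f x \<noteq> 0"
        unfolding indep_coords_def by blast
      from polyfun_imp_mp_eval[OF f(1)] obtain p where p: "f = mp_eval p"
        "\<forall>\<nu>\<in>Poly_Mapping.keys p. \<forall>i. i \<notin> T \<longrightarrow> \<nu> $ i = 0" by blast
      then have "p \<noteq> 0" using f(3) by auto
      then show ?thesis using p f by auto
    qed simp
  qed
  then obtain P where P: "\<And>T. card T > r \<Longrightarrow> P T \<noteq> 0 \<and>
      (\<forall>\<nu>\<in>Poly_Mapping.keys (P T). \<forall>i. i \<notin> T \<longrightarrow> \<nu> $ i = 0) \<and> (\<forall>x\<in>E. mp_eval (P T) x = 0)"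
    using choice[of ?Q] by auto
  have "\<exists>\<nu>. card T > r \<longrightarrow> \<nu> \<in> Poly_Mapping.keys (P T) \<and>
      (\<forall>\<mu>\<in>Poly_Mapping.keys (P T). prime_code \<mu> \<le> prime_code \<nu>)" for T
  proof (cases "card T > r")
    case True
    then have "Max (prime_code ` Poly_Mapping.keys (P T)) \<in> prime_code ` Poly_Mapping.keys (P T)"
      using P[OF True] by (intro Max_in) auto
    then obtain \<nu> where "\<nu> \<in> Poly_Mapping.keys (P T)" "prime_code \<nu> = Max (prime_code ` Poly_Mapping.keys (P T))"
      by auto
    then show ?thesis by (intro exI[of _ \<nu>]) auto
  qed simp
  \<comment> \<open>\<open>L T\<close> is the leading exponent of the relation \<open>P T\<close> in
    the code order.\<close>
  then obtain L where L: "\<And>T. card T > r \<Longrightarrow> L T \<in> Poly_Mapping.keys (P T) \<and>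
      (\<forall>\<mu>\<in>Poly_Mapping.keys (P T). prime_code \<mu> \<le> prime_code (L T))"
    using choice[of "\<lambda>T \<nu>. card T > r \<longrightarrow> \<nu> \<in> Poly_Mapping.keys (P T) \<and>
      (\<forall>\<mu>\<in>Poly_Mapping.keys (P T). prime_code \<mu> \<le> prime_code \<nu>)"] by auto
  \<comment> \<open>\<open>M\<close> separates small exponents from large ones: \<open>L T\<close>
    is 0 outside \<open>T\<close>, so a multi-index exceeding \<open>M\<close> throughout
    \<open>T\<close> is divisible by \<open>L T\<close>.\<close>
  define M where "M = (\<Sum>T\<in>UNIV. weight (L T))"
  have LM: "L T $ i \<le> M" for T i
  proof -
    have "weight (L T) \<le> M" unfolding M_def by (rule member_le_sum) auto
    then show ?thesis using nth_le_weight[of "L T" i] by linarith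
  qed
  \<comment> \<open>The standard exponents are those divisible by none of the leading exponents
    \<open>L T\<close>.\<close>
  define std where "std \<nu> \<longleftrightarrow> (\<forall>T. card T > r \<longrightarrow> \<not> (\<forall>i. L T $ i \<le> \<nu> $ i))" for \<nu> :: "nat ^ 'm"
  \<comment> \<open>Normal forms by strong induction on the code. As codes are multiplicative,
    replacing the factor \<open>L T\<close> of \<open>\<mu>\<close> by the lower terms of
    \<open>P T\<close> yields strictly smaller codes.\<close>
  have red: "\<exists>q\<in>?sp {\<nu>. std \<nu> \<and> prime_code \<nu> \<le> prime_code \<mu>}. \<forall>x\<in>E. mp_eval q x = monomial x \<mu>" for \<mu>
  proof (induction "prime_code \<mu>" arbitrary: \<mu> rule: less_induct)
    case less
    show ?case
    proof (cases "std \<mu>")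
      case True
      then have "Poly_Mapping.single \<mu> 1 \<in> ?sp {\<nu>. std \<nu> \<and> prime_code \<nu> \<le> prime_code \<mu>}"
        by (intro mp.span_base) auto
      then show ?thesis by (rule bexI[rotated]) simp
    next
      case False
      then obtain T where T: "card T > r" "\<forall>i. L T $ i \<le> \<mu> $ i" unfolding std_def by blast
      define \<kappa> where "\<kappa> = \<mu> - L T"
      have \<mu>: "\<mu> = L T + \<kappa>" using T(2) by (simp add: \<kappa>_def vec_eq_iff)
      let ?k = "Poly_Mapping.keys (P T) - {L T}"
      let ?c = "Poly_Mapping.lookup (P T)"
      have c: "?c (L T) \<noteq> 0" using L[OF T(1)] by (simp add: in_keys_iff)
      have lt: "prime_code (\<nu> + \<kappa>) < prime_code \<mu>" if "\<nu> \<in> ?k" for \<nu>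
      proof -
        have "prime_code \<nu> \<noteq> prime_code (L T)" using that inj_prime_code injD by fastforce
        then have "prime_code \<nu> < prime_code (L T)" using L[OF T(1)] that by (auto simp: le_less)
        then show ?thesis using prime_code_pos[of \<kappa>] by (simp add: \<mu> prime_code_add)
      qed
      have "\<forall>\<nu>\<in>?k. \<exists>q. q \<in> ?sp {\<nu>'. std \<nu>' \<and> prime_code \<nu>' \<le> prime_code \<mu>} \<and>
          (\<forall>x\<in>E. mp_eval q x = monomial x (\<nu> + \<kappa>))"
      proof
        fix \<nu> assume \<nu>: "\<nu> \<in> ?k"
        from less[OF lt[OF \<nu>]] obtain q where
          q: "q \<in> ?sp {\<nu>'. std \<nu>' \<and> prime_code \<nu>' \<le> prime_code (\<nu> + \<kappa>)}" "\<forall>x\<in>E. mp_eval q x = monomial x (\<nu> + \<kappa>)"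
          by blast
        have "?sp {\<nu>'. std \<nu>' \<and> prime_code \<nu>' \<le> prime_code (\<nu> + \<kappa>)} \<subseteq> ?sp {\<nu>'. std \<nu>' \<and> prime_code \<nu>' \<le> prime_code \<mu>}"
          using lt[OF \<nu>] by (intro mp.span_mono image_mono) auto
        with q show "\<exists>q. q \<in> ?sp {\<nu>'. std \<nu>' \<and> prime_code \<nu>' \<le> prime_code \<mu>} \<and>
          (\<forall>x\<in>E. mp_eval q x = monomial x (\<nu> + \<kappa>))" by blast
      qed
      from bchoice[OF this] obtain Q where Q: "\<And>\<nu>. \<nu> \<in> ?k \<Longrightarrow> Q \<nu> \<in> ?sp {\<nu>'. std \<nu>' \<and> prime_code \<nu>' \<le> prime_code \<mu>}"
        "\<And>\<nu> x. \<nu> \<in> ?k \<Longrightarrow> x \<in> E \<Longrightarrow> mp_eval (Q \<nu>) x = monomial x (\<nu> + \<kappa>)" by blast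
      show ?thesis
      proof (rule bexI, rule ballI)
        show "(\<Sum>\<nu>\<in>?k. mp_scale (- ?c \<nu> / ?c (L T)) (Q \<nu>)) \<in> ?sp {\<nu>'. std \<nu>' \<and> prime_code \<nu>' \<le> prime_code \<mu>}"
          by (intro mp.span_sum mp.span_scale Q)
        fix x assume x: "x \<in> E"
        have "0 = mp_eval (P T) x" using P[OF T(1)] x by simp
        also have "\<dots> = ?c (L T) * monomial x (L T) + (\<Sum>\<nu>\<in>?k. ?c \<nu> * monomial x \<nu>)"
          unfolding mp_eval_def using L[OF T(1)] by (intro sum.remove) auto
        finally have "(\<Sum>\<nu>\<in>?k. ?c \<nu> * monomial x \<nu>) = - (?c (L T) * monomial x (L T))"
          unfolding eq_commute[of 0] add_eq_0_iff .
        then have "(\<Sum>\<nu>\<in>?k. ?c \<nu> * monomial x \<nu>) * (- 1 / ?c (L T)) = monomial x (L T)"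
          using c by simp
        then have "monomial x \<mu> = (\<Sum>\<nu>\<in>?k. ?c \<nu> * monomial x \<nu>) * (- 1 / ?c (L T)) * monomial x \<kappa>"
          by (simp add: \<mu> monomial_add)
        also have "\<dots> = (\<Sum>\<nu>\<in>?k. - ?c \<nu> / ?c (L T) * monomial x (\<nu> + \<kappa>))"
          by (simp add: sum_distrib_right monomial_add mult_ac sum_distrib_left)
        also have "\<dots> = mp_eval (\<Sum>\<nu>\<in>?k. mp_scale (- ?c \<nu> / ?c (L T)) (Q \<nu>)) x"
          unfolding mp_eval_sum mp_eval_scale using Q(2) x by (intro sum.cong) auto
        finally show "mp_eval (\<Sum>\<nu>\<in>?k. mp_scale (- ?c \<nu> / ?c (L T)) (Q \<nu>)) x = monomial x \<mu>" by simp
      qed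
    qed
  qed
  obtain K where K: "\<And>\<nu> :: nat ^ 'm. prime_code \<nu> \<le> 2 ^ (K * weight \<nu>)" using prime_code_le by blast
  \<comment> \<open>Reduction never increases the code but may increase the weight: from code at
    most \<open>2 ^ (K * d)\<close> follows weight at most \<open>K * d\<close>.\<close>
  define A where "A d = {\<nu>. std \<nu> \<and> weight \<nu> \<le> K * d}" for d
  define C where "C = card (UNIV :: 'm set set) * (M + 1) ^ CARD('m)"
  have card_A: "card (A d) \<le> C * (K * d + 1) ^ r" for d
  proof -
    \<comment> \<open>One box for each possible set \<open>T\<close> of large coordinates. Being
      standard forces \<open>card T \<le> r\<close>, so each box contributes a factor
      \<open>K * d + 1\<close> at most \<open>r\<close> times; the number of boxes and the small
      sides go into \<open>C\<close>.\<close>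
    let ?B = "\<lambda>T :: 'm set. {\<nu> :: nat ^ 'm. \<forall>i. \<nu> $ i \<le> (if i \<in> T then K * d else M)}"
    have "A d \<subseteq> (\<Union>T\<in>{T. card T \<le> r}. ?B T)"
    proof
      fix \<nu> assume \<nu>: "\<nu> \<in> A d"
      define T where "T = {i. \<nu> $ i > M}"
      have "card T \<le> r"
      proof (rule ccontr)
        assume "\<not> card T \<le> r"
        then have T: "card T > r" by simp
        have "L T $ i \<le> \<nu> $ i" for i
        proof (cases "i \<in> T")
          case True
          then show ?thesis using LM[of T i] by (simp add: T_def)
        next
          case False
          then show ?thesis using P[OF T] L[OF T] by simp
        qed
        then show False using \<nu> T by (auto simp: A_def std_def)
      qed
      moreover have "\<nu> \<in> ?B T"
        using \<nu> nth_le_weight[of \<nu>] by (auto simp: A_def T_def intro: order_trans)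
      ultimately show "\<nu> \<in> (\<Union>T\<in>{T. card T \<le> r}. ?B T)" by blast
    qed
    then have "card (A d) \<le> card (\<Union>T\<in>{T. card T \<le> r}. ?B T)"
      by (intro card_mono finite_UN_I finite_exponents_le) auto
    also have "\<dots> \<le> (\<Sum>T\<in>{T. card T \<le> r}. card (?B T))"
      by (intro card_UN_le) auto
    also have "\<dots> \<le> (\<Sum>T\<in>{T :: 'm set. card T \<le> r}. (M + 1) ^ CARD('m) * (K * d + 1) ^ r)"
    proof (intro sum_mono)
      fix T :: "'m set" assume T: "T \<in> {T. card T \<le> r}"
      have "card (?B T) = (\<Prod>i\<in>UNIV. if i \<in> T then K * d + 1 else M + 1)"
        by (subst card_exponents_le) (rule prod.cong, auto)
      also have "\<dots> = (K * d + 1) ^ card T * (M + 1) ^ card (- T)"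
        by (subst prod.If_cases) (auto simp: Compl_eq)
      also have "\<dots> \<le> (K * d + 1) ^ r * (M + 1) ^ CARD('m)"
        using T by (intro mult_mono power_increasing card_mono) auto
      finally show "card (?B T) \<le> (M + 1) ^ CARD('m) * (K * d + 1) ^ r" by (simp add: mult.commute)
    qed
    also have "\<dots> = card {T :: 'm set. card T \<le> r} * ((M + 1) ^ CARD('m) * (K * d + 1) ^ r)"
      by simp
    also have "\<dots> \<le> C * (K * d + 1) ^ r"
      unfolding C_def mult.assoc by (intro mult_right_mono card_mono) auto
    finally show ?thesis .
  qed
  have "\<exists>q\<in>?sp (A d). \<forall>x\<in>E. mp_eval q x = mp_eval p x" if p: "p \<in> polys_upto d" for p d
  proof -
    have "\<forall>\<mu>. \<exists>q. \<mu> \<in> Poly_Mapping.keys p \<longrightarrow> q \<in> ?sp (A d) \<and> (\<forall>x\<in>E. mp_eval q x = monomial x \<mu>)"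
    proof
      fix \<mu>
      obtain q where q: "q \<in> ?sp {\<nu>. std \<nu> \<and> prime_code \<nu> \<le> prime_code \<mu>}" "\<forall>x\<in>E. mp_eval q x = monomial x \<mu>"
        using red by blast
      have "{\<nu>. std \<nu> \<and> prime_code \<nu> \<le> prime_code \<mu>} \<subseteq> A d" if "\<mu> \<in> Poly_Mapping.keys p"
      proof
        fix \<nu> assume \<nu>: "\<nu> \<in> {\<nu>. std \<nu> \<and> prime_code \<nu> \<le> prime_code \<mu>}"
        have "weight \<mu> \<le> d" using that p by (simp add: polys_upto_def)
        then have "K * weight \<mu> \<le> K * d" by simp
        then have "(2::nat) ^ (K * weight \<mu>) \<le> 2 ^ (K * d)" by (intro power_increasing) auto
        then have "(2::nat) ^ weight \<nu> \<le> 2 ^ (K * d)"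
          using prime_code_ge[of \<nu>] K[of \<mu>] \<nu> unfolding mem_Collect_eq by linarith
        then have "weight \<nu> \<le> K * d" by simp
        then show "\<nu> \<in> A d" using \<nu> by (simp add: A_def)
      qed
      then have "q \<in> ?sp (A d)" if "\<mu> \<in> Poly_Mapping.keys p"
        using subsetD[OF mp.span_mono[OF image_mono] q(1)] that by blast
      with q show "\<exists>q. \<mu> \<in> Poly_Mapping.keys p \<longrightarrow> q \<in> ?sp (A d) \<and> (\<forall>x\<in>E. mp_eval q x = monomial x \<mu>)"
        by blast
    qed
    from choice[OF this] obtain Q where Q: "\<And>\<mu>. \<mu> \<in> Poly_Mapping.keys p \<Longrightarrow>
        Q \<mu> \<in> ?sp (A d) \<and> (\<forall>x\<in>E. mp_eval (Q \<mu>) x = monomial x \<mu>)" by blast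
    show ?thesis
    proof (rule bexI, rule ballI)
      show "(\<Sum>\<mu>\<in>Poly_Mapping.keys p. mp_scale (Poly_Mapping.lookup p \<mu>) (Q \<mu>)) \<in> ?sp (A d)"
        using Q by (intro mp.span_sum mp.span_scale) blast
      show "mp_eval (\<Sum>\<mu>\<in>Poly_Mapping.keys p. mp_scale (Poly_Mapping.lookup p \<mu>) (Q \<mu>)) x = mp_eval p x"
        if "x \<in> E" for x
        using Q that by (simp add: mp_eval_sum mp_eval_scale mp_eval_def[of p])
    qed
  qed
  moreover have "finite (A d)" for d
    by (rule finite_subset[OF _ finite_weight_le[of "K * d"]]) (auto simp: A_def)
  ultimately show ?thesis using card_A by blast
qed

section \<open>The dimension of algebraic sets is at most that of the ambient space\<close>

lemma mp_eval_one [simp]: "mp_eval 1 x = 1"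
  by (simp flip: single_one)

lemma mp_eval_power: "mp_eval (p ^ k) x = mp_eval p x ^ k"
  by (induction k) (auto simp: mp_eval_mult)

lemma polys_upto_power: "p \<in> polys_upto d \<Longrightarrow> p ^ k \<in> polys_upto (k * d)"
proof (induction k)
  case 0
  then show ?case by (simp add: polys_upto_def)
next
  case (Suc k)
  then show ?case using polys_upto_mult[of p d "p ^ k" "k * d"] by simp
qed

text \<open>If \<open>E'\<close> had no larger independent set, polynomials of degree O(N) would
  span O(N^|S|) dimensions on it. The products of monomials in the coordinates of \<open>S\<close>
  with powers of \<open>p\<close>, all exponents at most \<open>N\<close>, number (N+1)^(|S|+1), so
  they satisfy a relation on \<open>E'\<close>. Cancelling the lowest power of \<open>p\<close>, as
  primality allows, and restricting to \<open>E\<close>, where \<open>p\<close> vanishes, leaves a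
  nontrivial relation among the coordinates of \<open>S\<close>.\<close>

lemma indep_coords_strict_mono:
  fixes E E' :: "(complex ^ 'm) set"
  assumes prime: "prime_vanishing E'" and "E \<subseteq> E'"
    and p0: "\<And>x. x \<in> E \<Longrightarrow> mp_eval p x = 0" and p: "\<not> (\<forall>x\<in>E'. mp_eval p x = 0)"
    and S: "indep_coords E S"
  shows "\<exists>T. indep_coords E' T \<and> card S < card T"
proof (rule ccontr)
  assume "\<not> ?thesis"
  then have le: "card T \<le> card S" if "indep_coords E' T" for T
    using that by force
  have "\<exists>C K. \<forall>d. \<exists>A. finite A \<and> card A \<le> C * (K * d + 1) ^ card S \<and>
      (\<forall>p\<in>polys_upto d. \<exists>q\<in>mp.span ((\<lambda>\<nu>. Poly_Mapping.single \<nu> 1) ` A). \<forall>x\<in>E'. mp_eval q x = mp_eval p x)"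
    (is "\<exists>C K. \<forall>d. ?growth C K d")
    by (rule polynomial_growth, erule le)
  then obtain C K where CK: "\<forall>d. ?growth C K d"
    by (elim exE) (erule that)
  obtain e where e: "p \<in> polys_upto e" using in_polys_upto by blast
  \<comment> \<open>The products have degree at most \<open>N * (CARD('m) + e)\<close>, and
    \<open>K * N * (CARD('m) + e) + 1 \<le> k * (N + 1)\<close>. With
    \<open>N = C * k ^ card S\<close> the dimension is therefore at most
    \<open>N * (N + 1) ^ card S\<close>, just below the number of products.\<close>
  define k where "k = K * (CARD('m) + e) + 1"
  define N where "N = C * k ^ card S"
  obtain A where A: "finite A" "card A \<le> C * (K * (N * (CARD('m) + e)) + 1) ^ card S"
    and red: "\<forall>p\<in>polys_upto (N * (CARD('m) + e)).
      \<exists>q\<in>mp.span ((\<lambda>\<nu>. Poly_Mapping.single \<nu> 1) ` A). \<forall>x\<in>E'. mp_eval q x = mp_eval p x"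
    using spec[OF CK, of "N * (CARD('m) + e)"] by (elim exE conjE) (rule that)
  define J where "J = {\<alpha> :: nat ^ 'm. \<forall>i. \<alpha> $ i \<le> (if i \<in> S then N else 0)}"
  have J: "finite J" unfolding J_def by (rule finite_exponents_le)
  have cardJ: "card J = (N + 1) ^ card S"
  proof -
    have "card J = (\<Prod>i\<in>UNIV. if i \<in> S then N + 1 else 1)"
      unfolding J_def by (subst card_exponents_le) (rule prod.cong, auto)
    then show ?thesis by (simp add: prod.If_cases)
  qed
  let ?I = "J \<times> {..N}"
  have "Poly_Mapping.single \<alpha> 1 * p ^ \<beta> \<in> polys_upto (N * (CARD('m) + e))" if "(\<alpha>, \<beta>) \<in> ?I" for \<alpha> \<beta>
  proof -
    have \<alpha>: "\<forall>i. \<alpha> $ i \<le> (if i \<in> S then N else 0)" using that by (simp add: J_def)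
    have "\<alpha> $ i \<le> N" for i using spec[OF \<alpha>, of i] by (simp split: if_splits)
    then have "weight \<alpha> \<le> (\<Sum>i\<in>(UNIV::'m set). N)"
      unfolding weight_def by (intro sum_mono)
    then have "Poly_Mapping.single \<alpha> 1 \<in> polys_upto (N * CARD('m))"
      by (simp add: polys_upto_def mult.commute)
    moreover have "p ^ \<beta> \<in> polys_upto (N * e)"
      using polys_upto_power[OF e, of \<beta>] polys_upto_mono[of "\<beta> * e" "N * e"] that by auto
    ultimately show ?thesis using polys_upto_mult by (simp add: distrib_left)
  qed
  then have ex: "\<exists>q. q \<in> mp.span ((\<lambda>\<nu>. Poly_Mapping.single \<nu> 1) ` A) \<and>
      (\<forall>x\<in>E'. mp_eval q x = monomial x \<alpha> * mp_eval p x ^ \<beta>)" if "(\<alpha>, \<beta>) \<in> ?I" for \<alpha> \<beta>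
    using bspec[OF red, of "Poly_Mapping.single \<alpha> 1 * p ^ \<beta>"] that
    by (auto simp: mp_eval_mult mp_eval_power)
  have "\<forall>i\<in>?I. \<exists>q. q \<in> mp.span ((\<lambda>\<nu>. Poly_Mapping.single \<nu> 1) ` A) \<and>
      (\<forall>x\<in>E'. mp_eval q x = monomial x (fst i) * mp_eval p x ^ snd i)"
    by (intro ballI ex) simp
  from bchoice[OF this] obtain Q where
    Q: "\<And>i. i \<in> ?I \<Longrightarrow> Q i \<in> mp.span ((\<lambda>\<nu>. Poly_Mapping.single \<nu> 1) ` A)"
      "\<And>i x. i \<in> ?I \<Longrightarrow> x \<in> E' \<Longrightarrow> mp_eval (Q i) x = monomial x (fst i) * mp_eval p x ^ snd i"
    by (elim exE) (rule that; drule(1) bspec, elim conjE; (assumption | drule(1) bspec))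
  have "card ((\<lambda>\<nu>. Poly_Mapping.single \<nu> (1::complex)) ` A) < card ?I"
  proof -
    have "card ((\<lambda>\<nu>. Poly_Mapping.single \<nu> (1::complex)) ` A) \<le> card A"
      using A(1) by (rule card_image_le)
    also have "\<dots> \<le> C * (K * (N * (CARD('m) + e)) + 1) ^ card S" by (rule A)
    also have "\<dots> \<le> C * (k * (N + 1)) ^ card S"
      unfolding k_def by (intro mult_left_mono power_mono) (auto simp: algebra_simps)
    also have "\<dots> = N * (N + 1) ^ card S" unfolding power_mult_distrib by (simp only: N_def mult.assoc)
    also have "\<dots> < (N + 1) * (N + 1) ^ card S" by simp
    also have "\<dots> = card ?I" using cardJ by (simp add: card_cartesian_product)
    finally show ?thesis .
  qed
  then have "\<not> (\<forall>c. (\<Sum>i\<in>?I. mp_scale (c i) (Q i)) = 0 \<longrightarrow> (\<forall>i\<in>?I. c i = 0))"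
    using mp.card_independent_family_le[of ?I "(\<lambda>\<nu>. Poly_Mapping.single \<nu> 1) ` A" Q,
        OF finite_cartesian_product[OF J finite_atMost] finite_imageI[OF A(1)] Q(1)]
    unfolding not_le[symmetric] by blast
  then obtain c where c: "(\<Sum>i\<in>?I. mp_scale (c i) (Q i)) = 0" "\<exists>i\<in>?I. c i \<noteq> 0" by blast
  define h where "h \<beta> x = (\<Sum>\<alpha>\<in>J. c (\<alpha>, \<beta>) * monomial x \<alpha>)" for \<beta> x
  have h_poly: "h \<beta> \<in> polyfun S" for \<beta>
  proof -
    have "(\<lambda>x. monomial x \<alpha>) \<in> polyfun S" if "\<alpha> \<in> J" for \<alpha>
    proof -
      have "(\<lambda>x. x $ i ^ (\<alpha> $ i)) \<in> polyfun S" for i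
      proof (cases "i \<in> S")
        case False
        moreover have "\<alpha> $ i \<le> (if i \<in> S then N else 0)" using that by (simp add: J_def)
        ultimately have "\<alpha> $ i = 0" by simp
        then show ?thesis by (simp add: polyfun_const)
      qed (intro polyfun_power polyfun_var)
      then show ?thesis unfolding monomial_def by (intro polyfun_prod)
    qed
    then show ?thesis unfolding h_def by (intro polyfun_sum polyfun_mult polyfun_const)
  qed
  have sum0: "(\<Sum>\<beta>\<le>N. h \<beta> x * mp_eval p x ^ \<beta>) = 0" if "x \<in> E'" for x
  proof -
    have "0 = mp_eval (\<Sum>i\<in>?I. mp_scale (c i) (Q i)) x" using c(1) by simp
    also have "\<dots> = (\<Sum>i\<in>?I. c i * (monomial x (fst i) * mp_eval p x ^ snd i))"
      using Q(2) that by (simp add: mp_eval_sum mp_eval_scale)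
    also have "\<dots> = (\<Sum>\<alpha>\<in>J. \<Sum>\<beta>\<le>N. c (\<alpha>, \<beta>) * (monomial x \<alpha> * mp_eval p x ^ \<beta>))"
      by (simp add: sum.cartesian_product case_prod_unfold)
    also have "\<dots> = (\<Sum>\<beta>\<le>N. \<Sum>\<alpha>\<in>J. c (\<alpha>, \<beta>) * (monomial x \<alpha> * mp_eval p x ^ \<beta>))"
      by (rule sum.swap)
    also have "\<dots> = (\<Sum>\<beta>\<le>N. h \<beta> x * mp_eval p x ^ \<beta>)"
      by (simp add: h_def sum_distrib_right mult.assoc)
    finally show ?thesis by simp
  qed
  \<comment> \<open>The lowest power of \<open>p\<close> whose coefficient polynomial is nontrivial;
    \<open>g\<close> below is the relation divided by \<open>p ^ b\<close>.\<close>
  define b where "b = (LEAST \<beta>. \<beta> \<le> N \<and> (\<exists>\<alpha>\<in>J. c (\<alpha>, \<beta>) \<noteq> 0))"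
  have b: "b \<le> N" "\<exists>\<alpha>\<in>J. c (\<alpha>, b) \<noteq> 0"
    using LeastI_ex[of "\<lambda>\<beta>. \<beta> \<le> N \<and> (\<exists>\<alpha>\<in>J. c (\<alpha>, \<beta>) \<noteq> 0)"] c(2) unfolding b_def by auto
  have hb: "h \<beta> x = 0" if "\<beta> < b" for \<beta> x
    using not_less_Least[OF that[unfolded b_def]] b(1) that by (auto simp: h_def intro!: sum.neutral)
  define g where "g x = (\<Sum>\<beta>\<in>{b..N}. h \<beta> x * mp_eval p x ^ (\<beta> - b))" for x
  have "g \<in> polyfun UNIV"
    unfolding g_def[abs_def]
    by (intro polyfun_sum polyfun_mult polyfun_power polyfun_mp_eval polyfun_mono[OF h_poly]) auto
  moreover have "\<forall>x\<in>E'. mp_eval p x ^ b * g x = 0"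
  proof
    fix x assume x: "x \<in> E'"
    have "mp_eval p x ^ b * g x = (\<Sum>\<beta>\<in>{b..N}. h \<beta> x * mp_eval p x ^ \<beta>)"
      unfolding g_def sum_distrib_left
      by (intro sum.cong refl) (simp add: power_add[symmetric] mult.left_commute)
    also have "\<dots> = (\<Sum>\<beta>\<le>N. h \<beta> x * mp_eval p x ^ \<beta>)"
      using hb by (intro sum.mono_neutral_left) auto
    finally show "mp_eval p x ^ b * g x = 0" using sum0[OF x] by simp
  qed
  ultimately have g0: "\<forall>x\<in>E'. g x = 0"
    using prime_vanishing_power[OF prime polyfun_mp_eval] p by blast
  \<comment> \<open>On \<open>E\<close> only the term \<open>\<beta> = b\<close> survives, with the
    power \<open>0 ^ 0 = 1\<close>.\<close>
  have "h b x = 0" if "x \<in> E" for x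
  proof -
    have "g x = (\<Sum>\<beta>\<in>{b..N}. if \<beta> = b then h b x else 0)"
      unfolding g_def using p0[OF that] by (intro sum.cong) auto
    also have "\<dots> = h b x" using b(1) by simp
    finally show ?thesis using g0 that \<open>E \<subseteq> E'\<close> by auto
  qed
  then have h0: "h b x = 0" for x
    using S h_poly unfolding indep_coords_def by blast
  define H where "H = (\<Sum>\<alpha>\<in>J. Poly_Mapping.single \<alpha> (c (\<alpha>, b)))"
  have "mp_eval H x = 0" for x
    using h0[of x] by (simp add: H_def h_def mp_eval_sum)
  then have "H = 0" by (rule mp_eval_eq_0_imp)
  have "Poly_Mapping.lookup H \<alpha> = c (\<alpha>, b)" if "\<alpha> \<in> J" for \<alpha>
    using that J by (simp add: H_def lookup_sum lookup_single when_def)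
  then have "c (\<alpha>, b) = 0" if "\<alpha> \<in> J" for \<alpha>
    using that \<open>H = 0\<close> by simp
  then show False using b(2) by blast
qed

lemma algebraic_dim_le: "algebraic_dim (Z :: (complex ^ 'm) set) \<le> enat CARD('m)"
  unfolding algebraic_dim_def
proof (rule Sup_least, clarify)
  fix k and D :: "nat \<Rightarrow> (complex ^ 'm) set"
  assume D: "\<forall>i\<le>k. irreducible_algebraic_set (D i) \<and> D i \<subseteq> Z" "\<forall>i<k. D i \<subset> D (Suc i)"
  have "\<exists>T. indep_coords (D i) T \<and> i \<le> card T" if "i \<le> k" for i
    using that
  proof (induction i)
    case 0
    have "D 0 \<noteq> {}" using D(1) by (auto simp: irreducible_algebraic_set_def)
    then show ?case using indep_coords_empty by blast
  next
    case (Suc i)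
    then obtain S where S: "indep_coords (D i) S" "i \<le> card S" by auto
    have sub: "D i \<subset> D (Suc i)" using D(2) Suc.prems by simp
    then obtain x where x: "x \<in> D (Suc i)" "x \<notin> D i" by blast
    have "algebraic_set (D i)" using D(1) Suc.prems by (auto simp: irreducible_algebraic_set_def)
    then obtain p where p: "\<And>y. y \<in> D i \<Longrightarrow> mp_eval p y = 0" "mp_eval p x \<noteq> 0"
      using x(2) unfolding algebraic_set_def by blast
    have "prime_vanishing (D (Suc i))"
      using D(1) Suc.prems irreducible_imp_prime_vanishing by blast
    from indep_coords_strict_mono[OF this _ p(1) _ S(1)] obtain T where
      "indep_coords (D (Suc i)) T" "card S < card T"
      using sub x p(2) by blast
    then show ?case using S(2) by (intro exI[of _ T]) auto
  qed
  then obtain T :: "'m set" where "k \<le> card T" by blast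
  then show "enat k \<le> enat CARD('m)" using card_mono[of UNIV T] by simp
qed

section \<open>Simple roots depending holomorphically on parameters\<close>

text \<open>
  The root is the limit of the iteration \<open>z \<mapsto> z - H u z / c\<close>, where \<open>c\<close> is the derivative of
  the polynomial at the given simple root; the iterates are holomorphic along lines and
  converge uniformly.
\<close>

lemma simple_root_line_hol:
  fixes b :: "nat \<Rightarrow> complex ^ 'm \<Rightarrow> complex"
  assumes B: "open B" "\<xi> \<in> B" and b: "\<And>k. line_hol B (b k)"
    and root: "(\<Sum>k\<le>e. b k \<xi> * z0 ^ k) = 0"
    and simple: "(\<Sum>k\<le>e. b k \<xi> * (of_nat k * z0 ^ (k - 1))) \<noteq> 0"
  shows "\<exists>\<delta>>0. \<exists>g. ball \<xi> \<delta> \<subseteq> B \<and> line_hol (ball \<xi> \<delta>) g \<and> g \<xi> = z0 \<and>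
    (\<forall>u\<in>ball \<xi> \<delta>. (\<Sum>k\<le>e. b k u * g u ^ k) = 0)"
proof -
  define c where "c = (\<Sum>k\<le>e. b k \<xi> * (of_nat k * z0 ^ (k - 1)))"
  have c: "c \<noteq> 0" using simple by (simp add: c_def)
  define H where "H u z = (\<Sum>k\<le>e. b k u * z ^ k)" for u z
  \<comment> \<open>The difference quotient of \<open>H u\<close>, written as a polynomial so that
    it makes sense on the diagonal, where it is the derivative. Joint continuity keeps it within
    half of \<open>cmod c\<close> from \<open>c\<close>, which makes the iteration a
    contraction.\<close>
  define K where "K u z w = (\<Sum>k\<le>e. b k u * (\<Sum>i<k. w ^ (k - Suc i) * z ^ i))" for u z w
  have HK: "H u z - H u w = (z - w) * K u z w" for u z w
    unfolding H_def K_def sum_subtractf[symmetric] sum_distrib_left right_diff_distrib[symmetric]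
    by (intro sum.cong refl) (simp only: power_diff_sumr2 mult.left_commute sum_distrib_left)
  have K\<xi>: "K \<xi> z0 z0 = c"
    unfolding K_def c_def
  proof (intro sum.cong refl arg_cong2[where f = times])
    fix k
    have "(\<Sum>i<k. z0 ^ (k - Suc i) * z0 ^ i) = (\<Sum>i<k. z0 ^ (k - 1))"
      by (intro sum.cong refl) (simp add: power_add[symmetric])
    then show "(\<Sum>i<k. z0 ^ (k - Suc i) * z0 ^ i) = of_nat k * z0 ^ (k - 1)" by simp
  qed
  have b_cont: "continuous_on B (b k)" for k using b by (simp add: line_hol_def)
  let ?V = "B \<times> (UNIV :: (complex \<times> complex) set)"
  have fst_cont: "continuous_on ?V (\<lambda>x. b k (fst x))" for k
    by (rule continuous_on_compose2[OF b_cont continuous_on_fst]) (auto intro: continuous_intros)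
  have "continuous_on ?V (\<lambda>x. K (fst x) (fst (snd x)) (snd (snd x)))"
    unfolding K_def by (intro continuous_intros fst_cont)
  moreover have "open ?V" using B(1) by (intro open_Times) auto
  ultimately have "open (?V \<inter> (\<lambda>x. K (fst x) (fst (snd x)) (snd (snd x))) -` ball c (cmod c / 2))"
    by (rule continuous_open_preimage) simp
  moreover have "(\<xi>, z0, z0) \<in> ?V \<inter> (\<lambda>x. K (fst x) (fst (snd x)) (snd (snd x))) -` ball c (cmod c / 2)"
    using B(2) c by (simp add: K\<xi>)
  ultimately obtain U W where U: "open U" "\<xi> \<in> U" and W: "open W" "(z0, z0) \<in> W"
    and UW: "U \<times> W \<subseteq> ?V \<inter> (\<lambda>x. K (fst x) (fst (snd x)) (snd (snd x))) -` ball c (cmod c / 2)"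
    by (rule open_prod_elim) blast
  obtain W1 W2 where W12: "open W1" "open W2" "(z0, z0) \<in> W1 \<times> W2" "W1 \<times> W2 \<subseteq> W"
    by (rule open_prod_elim[OF W])
  have "open (W1 \<inter> W2)" "z0 \<in> W1 \<inter> W2" using W12 by auto
  then obtain \<epsilon> where \<epsilon>: "\<epsilon> > 0" "cball z0 \<epsilon> \<subseteq> W1 \<inter> W2"
    unfolding open_contains_cball by blast
  have KU: "cmod (K u z w - c) \<le> cmod c / 2" if "u \<in> U" "cmod (z - z0) \<le> \<epsilon>" "cmod (w - z0) \<le> \<epsilon>" for u z w
  proof -
    have "z \<in> cball z0 \<epsilon>" "w \<in> cball z0 \<epsilon>" using that by (simp_all add: dist_norm norm_minus_commute)
    then have "(u, z, w) \<in> U \<times> W" using \<epsilon>(2) W12(4) that(1) by blast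
    then have "K u z w \<in> ball c (cmod c / 2)" using UW by auto
    then show ?thesis by (simp add: dist_norm norm_minus_commute)
  qed
  have UB: "U \<subseteq> B" using UW W(2) by blast
  have H_cont: "continuous_on U (\<lambda>u. H u z0)"
    unfolding H_def by (intro continuous_intros continuous_on_subset[OF b_cont UB])
  \<comment> \<open>This bound makes the first step at most \<open>\<epsilon> / 2\<close>. Since
    steps halve, the iterates never leave the disc of radius \<open>\<epsilon>\<close> on which the
    contraction estimate holds.\<close>
  have "open (U \<inter> (\<lambda>u. H u z0) -` ball 0 (cmod c * \<epsilon> / 2))"
    using continuous_open_preimage[OF H_cont U(1)] by simp
  moreover have "\<xi> \<in> U \<inter> (\<lambda>u. H u z0) -` ball 0 (cmod c * \<epsilon> / 2)"
    using U(2) root c \<epsilon>(1) by (simp add: H_def)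
  ultimately obtain \<delta> where \<delta>: "\<delta> > 0" "ball \<xi> \<delta> \<subseteq> U \<inter> (\<lambda>u. H u z0) -` ball 0 (cmod c * \<epsilon> / 2)"
    using open_contains_ball[THEN iffD1, rule_format] by blast
  let ?B = "ball \<xi> \<delta>"
  have Hz0: "cmod (H u z0 / c) \<le> \<epsilon> / 2" if "u \<in> ?B" for u
  proof -
    have "cmod (H u z0) < cmod c * \<epsilon> / 2" using \<delta>(2) that by auto
    then show ?thesis using c by (simp add: norm_divide field_simps)
  qed
  have contr: "cmod ((z - H u z / c) - (w - H u w / c)) \<le> cmod (z - w) / 2"
    if "u \<in> ?B" "cmod (z - z0) \<le> \<epsilon>" "cmod (w - z0) \<le> \<epsilon>" for u z w
  proof -
    have "(z - H u z / c) - (w - H u w / c) = (z - w) - (H u z - H u w) / c"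
      by (simp add: diff_divide_distrib)
    also have "\<dots> = (z - w) * ((c - K u z w) / c)"
      unfolding HK using c by (simp add: field_simps)
    finally have "cmod ((z - H u z / c) - (w - H u w / c)) = cmod (z - w) * (cmod (K u z w - c) / cmod c)"
      by (simp add: norm_mult norm_divide norm_minus_commute)
    also have "cmod (K u z w - c) / cmod c \<le> 1 / 2"
      using KU[of u z w] that \<delta>(2) c by (auto simp: field_simps)
    then have "cmod (z - w) * (cmod (K u z w - c) / cmod c) \<le> cmod (z - w) * (1 / 2)"
      by (rule mult_left_mono) simp
    finally show ?thesis by simp
  qed
  define g where "g n u = ((\<lambda>z. z - H u z / c) ^^ n) z0" for n u
  have g0: "g 0 u = z0" and gS: "g (Suc n) u = g n u - H u (g n u) / c" for n u
    by (simp_all add: g_def)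
  have step: "cmod (g n u - z0) \<le> \<epsilon> * (1 - (1/2) ^ n) \<and> cmod (g (Suc n) u - g n u) \<le> \<epsilon> / 2 * (1/2) ^ n"
    if u: "u \<in> ?B" for n u
  proof (induction n)
    case 0
    then show ?case using Hz0[OF u] by (simp add: gS g0)
  next
    case (Suc n)
    have "cmod (g (Suc n) u - z0) \<le> cmod (g (Suc n) u - g n u) + cmod (g n u - z0)"
      using norm_triangle_ineq[of "g (Suc n) u - g n u" "g n u - z0"] by simp
    also have "\<dots> \<le> \<epsilon> / 2 * (1/2) ^ n + \<epsilon> * (1 - (1/2) ^ n)" using Suc by (intro add_mono) auto
    also have "\<dots> = \<epsilon> * (1 - (1/2) ^ Suc n)" by (simp add: algebra_simps)
    finally have 1: "cmod (g (Suc n) u - z0) \<le> \<epsilon> * (1 - (1/2) ^ Suc n)" .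
    have le\<epsilon>: "\<epsilon> * (1 - (1/2) ^ k) \<le> \<epsilon>" for k using \<epsilon>(1) by (simp add: mult_le_cancel_left1)
    have "cmod (g (Suc (Suc n)) u - g (Suc n) u) \<le> cmod (g (Suc n) u - g n u) / 2"
      unfolding gS[of "Suc n"] gS[of n]
      by (rule contr[OF u, unfolded gS[symmetric]], unfold gS[symmetric])
        (use order_trans[OF 1 le\<epsilon>] order_trans[OF conjunct1[OF Suc] le\<epsilon>] in auto)
    also have "\<dots> \<le> \<epsilon> / 2 * (1/2) ^ Suc n" using Suc by simp
    finally show ?case using 1 by blast
  qed
  have g_hol: "line_hol ?B (g n)" for n
  proof (induction n)
    case 0
    then show ?case using line_hol_const[of ?B z0] by (simp add: g0[abs_def])
  next
    case (Suc n)
    have "line_hol ?B (\<lambda>u. g n u + (- 1 / c) * (\<Sum>k\<le>e. b k u * g n u ^ k))"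
      using \<delta>(2) UB
      by (intro line_hol_add line_hol_mult line_hol_sum line_hol_power line_hol_const Suc
          line_hol_subset[OF b]) auto
    then show ?case by (rule line_hol_cong) (simp add: gS H_def)
  qed
  \<comment> \<open>Written as a telescoping series, the limit exists uniformly in \<open>u\<close>
    by comparison with a geometric series.\<close>
  define l where "l u = z0 + suminf (\<lambda>k. g (Suc k) u - g k u)" for u
  have "uniform_limit ?B (\<lambda>n u. \<Sum>k<n. g (Suc k) u - g k u) (\<lambda>u. suminf (\<lambda>k. g (Suc k) u - g k u)) sequentially"
  proof (rule Weierstrass_m_test)
    show "norm (g (Suc k) u - g k u) \<le> \<epsilon> / 2 * (1/2) ^ k" if "u \<in> ?B" for k u
      using step[OF that] by blast
    show "summable (\<lambda>k. \<epsilon> / 2 * (1/2) ^ k)"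
      by (intro summable_mult summable_geometric) simp
  qed
  then have "uniform_limit ?B (\<lambda>n u. z0 + (\<Sum>k<n. g (Suc k) u - g k u)) l sequentially"
    unfolding l_def[abs_def] by (intro uniform_limit_add uniform_limit_const)
  moreover have "z0 + (\<Sum>k<n. g (Suc k) u - g k u) = g n u" for n u
    using sum_lessThan_telescope[of "\<lambda>k. g k u" n] by (simp add: g0)
  ultimately have lim: "uniform_limit ?B g l sequentially" by simp
  have "line_hol ?B l"
    by (rule line_hol_uniform_limit[OF open_ball g_hol lim])
  moreover have "l \<xi> = z0"
  proof -
    have "g n \<xi> = z0" for n
      by (induction n) (use root in \<open>simp_all add: g0 gS H_def\<close>)
    then show ?thesis by (simp add: l_def)
  qed
  moreover have "(\<Sum>k\<le>e. b k u * l u ^ k) = 0" if "u \<in> ?B" for u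
  proof -
    have gl: "(\<lambda>n. g n u) \<longlonglongrightarrow> l u" using tendsto_uniform_limitI[OF lim that] .
    have "(\<lambda>n. g n u - H u (g n u) / c) \<longlonglongrightarrow> l u - H u (l u) / c"
      unfolding H_def using c by (intro tendsto_intros gl)
    moreover have "(\<lambda>n. g n u - H u (g n u) / c) \<longlonglongrightarrow> l u"
      unfolding gS[symmetric] using gl by (rule LIMSEQ_Suc)
    ultimately have "l u - H u (l u) / c = l u" by (rule LIMSEQ_unique)
    then show ?thesis using c by (simp add: H_def)
  qed
  moreover have "?B \<subseteq> B" using \<delta>(2) UB by blast
  ultimately show ?thesis using \<delta>(1) by blast
qed

section \<open>Chains of irreducible algebraic sets\<close>

text \<open>Expansion in powers of \<open>x $ j\<close>. The induction carries the extra clause that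
  coefficients beyond \<open>N\<close> vanish, so that two expansions can be brought to a common
  length and multiplied.\<close>

lemma polyfun_insertD:
  assumes "f \<in> polyfun (insert j T)"
  shows "\<exists>N a. (\<forall>k. a k \<in> polyfun T) \<and> (\<forall>x. f x = (\<Sum>k\<le>N. a k x * x $ j ^ k))"
proof -
  have "\<exists>N a. (\<forall>k. a k \<in> polyfun T) \<and> (\<forall>k x. k > N \<longrightarrow> a k x = 0) \<and>
      (\<forall>x. f x = (\<Sum>k\<le>N. a k x * x $ j ^ k))"
    using assms
  proof (induction rule: polyfun.induct)
    case (polyfun_const c)
    show ?case
      by (intro exI[of _ 0] exI[of _ "\<lambda>k x. if k = 0 then c else 0"])
        (auto intro: polyfun.polyfun_const split: if_splits)
  next
    case (polyfun_var i)
    show ?case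
    proof (cases "i = j")
      case True
      have "(\<lambda>x. if k = 1 then 1 else 0) \<in> polyfun T" for k :: nat
        by (rule polyfun_const)
      then show ?thesis using True
        by (intro exI[of _ 1] exI[of _ "\<lambda>k x. if k = 1 then 1 else 0"]) auto
    next
      case False
      then have "i \<in> T" using polyfun_var by simp
      then have "(\<lambda>x. if k = 0 then x $ i else 0) \<in> polyfun T" for k :: nat
        by (cases "k = 0") (auto intro: polyfun.intros)
      then show ?thesis
        by (intro exI[of _ 0] exI[of _ "\<lambda>k x. if k = 0 then x $ i else 0"]) auto
    qed
  next
    case (polyfun_add f g)
    then obtain N a M a' where
      a: "\<forall>k. a k \<in> polyfun T" "\<forall>k x. k > N \<longrightarrow> a k x = 0" "\<forall>x. f x = (\<Sum>k\<le>N. a k x * x $ j ^ k)" and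
      a': "\<forall>k. a' k \<in> polyfun T" "\<forall>k x. k > M \<longrightarrow> a' k x = 0" "\<forall>x. g x = (\<Sum>k\<le>M. a' k x * x $ j ^ k)"
      by (elim exE conjE) (rule that)
    have "f x = (\<Sum>k\<le>max N M. a k x * x $ j ^ k)" for x
      unfolding a(3)[rule_format] using a(2) by (intro sum.mono_neutral_left) auto
    moreover have "g x = (\<Sum>k\<le>max N M. a' k x * x $ j ^ k)" for x
      unfolding a'(3)[rule_format] using a'(2) by (intro sum.mono_neutral_left) auto
    ultimately show ?case
      using a a' by (intro exI[of _ "max N M"] exI[of _ "\<lambda>k x. a k x + a' k x"])
        (auto simp: distrib_right sum.distrib intro: polyfun.polyfun_add)
  next
    case (polyfun_mult f g)
    then obtain N a M a' where
      a: "\<forall>k. a k \<in> polyfun T" "\<forall>k x. k > N \<longrightarrow> a k x = 0" "\<forall>x. f x = (\<Sum>k\<le>N. a k x * x $ j ^ k)" and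
      a': "\<forall>k. a' k \<in> polyfun T" "\<forall>k x. k > M \<longrightarrow> a' k x = 0" "\<forall>x. g x = (\<Sum>k\<le>M. a' k x * x $ j ^ k)"
      by (elim exE conjE) (rule that)
    have "(\<lambda>x. \<Sum>i\<le>k. a i x * a' (k - i) x) \<in> polyfun T" for k
      using a a' by (intro polyfun_sum polyfun.polyfun_mult) auto
    moreover have "(\<Sum>i\<le>k. a i x * a' (k - i) x) = 0" if "k > N + M" for k x
    proof (intro sum.neutral ballI)
      fix i
      show "a i x * a' (k - i) x = 0"
        using a(2) a'(2) that by (cases "i > N") auto
    qed
    moreover have "f x * g x = (\<Sum>k\<le>N + M. (\<Sum>i\<le>k. a i x * a' (k - i) x) * x $ j ^ k)" for x
      unfolding a(3)[rule_format] a'(3)[rule_format]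
      by (rule polynomial_product) (use a(2) a'(2) in auto)
    ultimately show ?case
      by (intro exI[of _ "N + M"] exI[of _ "\<lambda>k x. \<Sum>i\<le>k. a i x * a' (k - i) x"]) auto
  qed
  then show ?thesis by (elim exE conjE) (intro exI conjI)
qed

text \<open>An equation for \<open>x $ j\<close> over the polynomials in the coordinates of
  \<open>T\<close>. With \<open>e\<close> minimal it plays the part of the minimal polynomial with
  denominators cleared; as it need not be monic, its leading coefficient is required not to vanish
  identically on \<open>E\<close>.\<close>

definition coord_relation ::
  "(complex ^ 'm) set \<Rightarrow> 'm set \<Rightarrow> 'm \<Rightarrow> nat \<Rightarrow> (nat \<Rightarrow> complex ^ 'm \<Rightarrow> complex) \<Rightarrow> bool"
  where "coord_relation E T j e a \<longleftrightarrow> (\<forall>k. a k \<in> polyfun T) \<and> e \<ge> 1 \<and>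
    (\<exists>x\<in>E. a e x \<noteq> 0) \<and> (\<forall>x\<in>E. (\<Sum>k\<le>e. a k x * x $ j ^ k) = 0)"

text \<open>The dependence of \<open>insert j S\<close> is expanded in \<open>x $ j\<close> and cut
  at its highest nonzero coefficient. Independence of \<open>S\<close> keeps that coefficient
  nonzero somewhere on \<open>E\<close>, and also rules out degree 0. A relation over
  \<open>S\<close> is one over every larger \<open>T\<close>.\<close>

lemma coord_relation_exists:
  assumes S: "indep_coords E S" "\<not> indep_coords E (insert j S)" and "S \<subseteq> T"
  shows "\<exists>e a. coord_relation E T j e a"
proof -
  obtain f x0 where f: "f \<in> polyfun (insert j S)" "\<forall>x\<in>E. f x = 0" "f x0 \<noteq> 0"
    using S(2) unfolding indep_coords_def by blast
  obtain N a where "\<forall>k. a k \<in> polyfun S" "\<forall>x. f x = (\<Sum>k\<le>N. a k x * x $ j ^ k)"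
    using polyfun_insertD[OF f(1)] by (elim exE conjE) (rule that)
  then have a: "a k \<in> polyfun S" "f x = (\<Sum>k\<le>N. a k x * x $ j ^ k)" for k x by simp_all
  have "\<exists>k\<le>N. \<exists>x. a k x \<noteq> 0"
  proof (rule ccontr)
    assume "\<not> ?thesis"
    then have "f x0 = 0" unfolding a(2) by (intro sum.neutral) simp
    then show False using f(3) by simp
  qed
  define e where "e = Max {k. k \<le> N \<and> (\<exists>x. a k x \<noteq> 0)}"
  have "e \<in> {k. k \<le> N \<and> (\<exists>x. a k x \<noteq> 0)}"
    unfolding e_def using \<open>\<exists>k\<le>N. \<exists>x. a k x \<noteq> 0\<close> by (intro Max_in) auto
  then have e: "e \<le> N" "\<exists>x. a e x \<noteq> 0" by auto
  have e_max: "a k x = 0" if "e < k" "k \<le> N" for k x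
  proof (rule ccontr)
    assume "a k x \<noteq> 0"
    then have "k \<le> e" unfolding e_def using that by (intro Max_ge) auto
    then show False using that by simp
  qed
  have fe: "f x = (\<Sum>k\<le>e. a k x * x $ j ^ k)" for x
    unfolding a(2) using e e_max by (intro sum.mono_neutral_right) auto
  have ae: "\<exists>x\<in>E. a e x \<noteq> 0"
    using S(1) a(1)[of e] e(2) unfolding indep_coords_def by blast
  moreover have "e \<noteq> 0"
  proof
    assume "e = 0"
    then have "a e x = f x" for x by (simp add: fe)
    then show False using ae f(2) by simp
  qed
  ultimately have "coord_relation E T j e a"
    using polyfun_mono[OF a(1) \<open>S \<subseteq> T\<close>] fe f(2) by (auto simp: coord_relation_def)
  then show ?thesis by blast
qed

lemma minimal_coord_relation:
  assumes "indep_coords E S" "\<not> indep_coords E (insert j S)" and "S \<subseteq> T"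
  obtains e a where "coord_relation E T j e a"
    "\<And>e' a'. coord_relation E T j e' a' \<Longrightarrow> e \<le> e'"
proof -
  define e where "e = (LEAST e. \<exists>a. coord_relation E T j e a)"
  have "\<exists>a. coord_relation E T j e a"
    unfolding e_def by (rule LeastI_ex) (rule coord_relation_exists[OF assms])
  then obtain a where "coord_relation E T j e a" by blast
  moreover have "e \<le> e'" if "coord_relation E T j e' a'" for e' a'
    unfolding e_def by (rule Least_le) (use that in blast)
  ultimately show ?thesis by (rule that)
qed

text \<open>Separability in characteristic 0: a derivative vanishing on \<open>E\<close> would be a
  relation of degree \<open>e - 1\<close> with leading coefficient \<open>e\<close> times the old
  one. For \<open>e = 1\<close> it would be the leading coefficient itself.\<close>

lemma coord_relation_deriv:
  assumes a: "coord_relation E T j e a"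
    and min: "\<And>e' a'. coord_relation E T j e' a' \<Longrightarrow> e \<le> e'"
  shows "\<exists>x\<in>E. (\<Sum>k\<le>e. a k x * (of_nat k * x $ j ^ (k - 1))) \<noteq> 0"
proof (rule ccontr)
  assume *: "\<not> ?thesis"
  obtain n where n: "e = Suc n" using a by (cases e) (auto simp: coord_relation_def)
  have "(\<Sum>k\<le>n. (of_nat (Suc k) * a (Suc k) x) * x $ j ^ k) = 0" if "x \<in> E" for x
  proof -
    have "(\<Sum>k\<le>e. a k x * (of_nat k * x $ j ^ (k - 1))) = 0" using * that by auto
    then show ?thesis unfolding n sum.atMost_Suc_shift by (simp add: mult_ac)
  qed
  moreover have "(\<lambda>x. of_nat (Suc k) * a (Suc k) x) \<in> polyfun T" for k
    using a by (intro polyfun_mult polyfun_const) (auto simp: coord_relation_def)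
  moreover obtain x where x: "x \<in> E" "a e x \<noteq> 0" using a by (auto simp: coord_relation_def)
  moreover from x have "of_nat (Suc n) * a (Suc n) x \<noteq> 0"
    unfolding n[symmetric] using n by (simp del: of_nat_Suc)
  ultimately have "n = 0 \<or> coord_relation E T j n (\<lambda>k x. of_nat (Suc k) * a (Suc k) x)"
    unfolding coord_relation_def by (auto simp del: of_nat_Suc)
  then have "n = 0" using min n by fastforce
  then show False using * x n by auto
qed

text \<open>
  Pseudo-division by a minimal relation reduces the vanishing of a polynomial on the lifted
  germ to that of its coefficients.
\<close>

lemma vanish_insert_coord:
  assumes a: "coord_relation E T j e a"
    and min: "\<And>e' a'. coord_relation E T j e' a' \<Longrightarrow> e \<le> e'"
    and y: "\<And>f. f \<in> polyfun T \<Longrightarrow> (\<forall>x\<in>E. f x = 0) \<Longrightarrow> f y = 0"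
    and root: "(\<Sum>k\<le>e. a k y * y $ j ^ k) = 0" and lead: "a e y \<noteq> 0"
    and f: "f \<in> polyfun (insert j T)" "\<forall>x\<in>E. f x = 0"
  shows "f y = 0"
proof -
  have a_poly: "a k \<in> polyfun T" and "e \<ge> 1" for k using a by (auto simp: coord_relation_def)
  \<comment> \<open>Minimality of \<open>e\<close>: an equation of smaller degree on
    \<open>E\<close> has all its coefficients zero on \<open>E\<close>, from the top down.\<close>
  have small: "\<forall>k\<le>N. \<forall>x\<in>E. b k x = 0"
    if "N < e" "\<forall>k. b k \<in> polyfun T" "\<forall>x\<in>E. (\<Sum>k\<le>N. b k x * x $ j ^ k) = 0" for N b
    using that
  proof (induction N)
    case 0
    then show ?case by simp
  next
    case (Suc N)
    have top: "\<forall>x\<in>E. b (Suc N) x = 0"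
    proof (rule ccontr)
      assume "\<not> ?thesis"
      then have "coord_relation E T j (Suc N) b"
        using Suc.prems by (auto simp: coord_relation_def)
      from min[OF this] Suc.prems show False by simp
    qed
    have "\<forall>k\<le>N. \<forall>x\<in>E. b k x = 0"
    proof (rule Suc.IH)
      show "\<forall>x\<in>E. (\<Sum>k\<le>N. b k x * x $ j ^ k) = 0"
        using Suc.prems(3) top by simp
    qed (use Suc.prems in auto)
    with top show ?case by (auto simp: le_Suc_eq)
  qed
  have "(\<Sum>k\<le>N. b k y * y $ j ^ k) = 0"
    if "\<forall>k. b k \<in> polyfun T" "\<forall>x\<in>E. (\<Sum>k\<le>N. b k x * x $ j ^ k) = 0" for N b
    using that
  proof (induction N arbitrary: b rule: less_induct)
    case (less N)
    show ?case
    proof (cases "N < e")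
      case True
      have "b k y = 0" if "k \<le> N" for k
        using small[OF True less.prems] that less.prems(1) by (intro y) auto
      then show ?thesis by simp
    next
      case False
      define d where "d = N - e"
      obtain M where M: "N = Suc M" using False \<open>e \<ge> 1\<close> by (cases N) auto
      \<comment> \<open>One step of pseudo-division: the combination cancels the coefficient of
        degree \<open>N\<close>. Multiplying by the leading coefficient loses nothing at
        \<open>y\<close>, where it is nonzero.\<close>
      define b' where "b' k x = a e x * b k x - (if k < d then 0 else b N x * a (k - d) x)" for k x
      have id: "(\<Sum>k\<le>M. b' k x * x $ j ^ k)
          = a e x * (\<Sum>k\<le>N. b k x * x $ j ^ k) - b N x * x $ j ^ d * (\<Sum>k\<le>e. a k x * x $ j ^ k)" for x
      proof -
        have "b' N x = 0" using False by (simp add: b'_def d_def)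
        then have "(\<Sum>k\<le>M. b' k x * x $ j ^ k) = (\<Sum>k\<le>N. b' k x * x $ j ^ k)" by (simp add: M)
        also have "\<dots> = a e x * (\<Sum>k\<le>N. b k x * x $ j ^ k)
            - (\<Sum>k\<le>N. (if k < d then 0 else b N x * a (k - d) x) * x $ j ^ k)"
          by (simp add: b'_def left_diff_distrib sum_subtractf sum_distrib_left mult.assoc)
        also have "(\<Sum>k\<le>N. (if k < d then 0 else b N x * a (k - d) x) * x $ j ^ k)
            = (\<Sum>k\<in>{d..N}. b N x * a (k - d) x * x $ j ^ k)"
          by (rule sum.mono_neutral_cong_right) auto
        also have "\<dots> = (\<Sum>k\<le>e. b N x * a k x * x $ j ^ (k + d))"
          using False
          by (intro sum.reindex_bij_witness[of _ "\<lambda>k. k + d" "\<lambda>k. k - d"]) (auto simp: d_def)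
        also have "\<dots> = b N x * x $ j ^ d * (\<Sum>k\<le>e. a k x * x $ j ^ k)"
          by (simp add: sum_distrib_left power_add mult_ac)
        finally show ?thesis .
      qed
      have "b' k \<in> polyfun T" for k
        unfolding b'_def using less.prems(1) a_poly
        by (cases "k < d") (auto intro!: polyfun_diff polyfun_mult polyfun_const)
      moreover have "\<forall>x\<in>E. (\<Sum>k\<le>M. b' k x * x $ j ^ k) = 0"
        using less.prems(2) a unfolding id by (simp add: coord_relation_def)
      ultimately have "(\<Sum>k\<le>M. b' k y * y $ j ^ k) = 0"
        using less.IH[of M b'] M by blast
      then show ?thesis unfolding id using root lead by simp
    qed
  qed
  moreover obtain N b where "\<forall>k. b k \<in> polyfun T" "\<forall>x. f x = (\<Sum>k\<le>N. b k x * x $ j ^ k)"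
    using polyfun_insertD[OF f(1)] by (elim exE conjE) (rule that)
  ultimately show ?thesis using f(2) by simp
qed

text \<open>
  Starting from a generic point \<open>\<xi>\<close> of \<open>E\<close>, the coordinates outside \<open>S\<close> are expressed one after
  the other as holomorphic functions of those in \<open>S\<close>, so that all polynomials vanishing on
  \<open>E\<close> vanish on the resulting graph \<open>G\<close>.
\<close>

lemma generic_graph:
  fixes E :: "(complex ^ 'm) set"
  assumes prime: "prime_vanishing E" "E \<noteq> {}"
    and S: "indep_coords E S" "\<forall>j. j \<notin> S \<longrightarrow> \<not> indep_coords E (insert j S)"
  shows "\<exists>\<xi> B G. open B \<and> convex B \<and> \<xi> \<in> B \<and> (\<forall>i. line_hol B (\<lambda>u. G u $ i)) \<and>
    (\<forall>u\<in>B. \<forall>i\<in>S. G u $ i = u $ i) \<and>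
    (\<forall>f\<in>polyfun UNIV. (\<forall>x\<in>E. f x = 0) \<longrightarrow> (\<forall>u\<in>B. f (G u) = 0))"
proof -
  \<comment> \<open>Minimal relations are fixed for all possible extension steps in advance, so that
    one point \<open>\<xi>\<close> can be chosen at which every leading coefficient and every
    derivative is nonzero.\<close>
  let ?I = "{(T, j). S \<subseteq> T \<and> j \<notin> T}"
  have "\<forall>i\<in>?I. \<exists>r. coord_relation E (fst i) (snd i) (fst r) (snd r) \<and>
      (\<forall>e' a'. coord_relation E (fst i) (snd i) e' a' \<longrightarrow> fst r \<le> e')"
  proof
    fix i assume "i \<in> ?I"
    then have "S \<subseteq> fst i" "snd i \<notin> S" by auto
    from minimal_coord_relation[OF S(1) S(2)[rule_format, OF this(2)] this(1)] obtain e a where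
      "coord_relation E (fst i) (snd i) e a" "\<And>e' a'. coord_relation E (fst i) (snd i) e' a' \<Longrightarrow> e \<le> e'"
      by blast
    then show "\<exists>r. coord_relation E (fst i) (snd i) (fst r) (snd r) \<and>
      (\<forall>e' a'. coord_relation E (fst i) (snd i) e' a' \<longrightarrow> fst r \<le> e')"
      by (intro exI[of _ "(e, a)"]) simp
  qed
  from bchoice[OF this] obtain r where r: "\<And>i. i \<in> ?I \<Longrightarrow> coord_relation E (fst i) (snd i) (fst (r i)) (snd (r i))"
    "\<And>i e' a'. i \<in> ?I \<Longrightarrow> coord_relation E (fst i) (snd i) e' a' \<Longrightarrow> fst (r i) \<le> e'"
    by blast
  define lead where "lead i = snd (r i) (fst (r i))" for i
  define der where "der i x = (\<Sum>k\<le>fst (r i). snd (r i) k x * (of_nat k * x $ snd i ^ (k - 1)))" for i x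
  have lead: "lead i \<in> polyfun UNIV \<and> (\<exists>x\<in>E. lead i x \<noteq> 0)" if "i \<in> ?I" for i
    using r(1)[OF that] polyfun_mono[of "lead i" "fst i" UNIV] by (simp add: coord_relation_def lead_def)
  have der: "der i \<in> polyfun UNIV \<and> (\<exists>x\<in>E. der i x \<noteq> 0)" if "i \<in> ?I" for i
  proof
    have "snd (r i) k \<in> polyfun UNIV" for k
      using r(1)[OF that] polyfun_mono[of "snd (r i) k" "fst i" UNIV] by (simp add: coord_relation_def)
    then show "der i \<in> polyfun UNIV"
      unfolding der_def[abs_def]
      by (intro polyfun_sum polyfun_mult polyfun_const polyfun_power polyfun_var UNIV_I)
    show "\<exists>x\<in>E. der i x \<noteq> 0"
      unfolding der_def by (rule coord_relation_deriv[OF r(1)[OF that] r(2)[OF that]])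
  qed
  have "\<exists>x\<in>E. \<forall>i\<in>?I. lead i x * der i x \<noteq> 0"
  proof (rule prime_vanishing_prod[OF prime(1) _ prime(2)])
    fix i assume i: "i \<in> ?I"
    show "(\<lambda>x. lead i x * der i x) \<in> polyfun UNIV \<and> (\<exists>x\<in>E. lead i x * der i x \<noteq> 0)"
      using lead[OF i] der[OF i] prime_vanishingD[OF prime(1), of "lead i" "der i"]
      by (blast intro: polyfun_mult)
  qed simp
  then obtain \<xi> where \<xi>: "\<xi> \<in> E" "\<And>i. i \<in> ?I \<Longrightarrow> lead i \<xi> \<noteq> 0 \<and> der i \<xi> \<noteq> 0" by auto
  \<comment> \<open>The clause \<open>G \<xi> = \<xi>\<close> is carried along because the next
    relation has \<open>\<xi> $ j\<close> as a simple root at \<open>\<xi>\<close> itself, a point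
    of \<open>E\<close>.\<close>
  have "\<exists>B G. open B \<and> convex B \<and> \<xi> \<in> B \<and> (\<forall>i. line_hol B (\<lambda>u. G u $ i)) \<and> G \<xi> = \<xi> \<and>
      (\<forall>u\<in>B. \<forall>i\<in>S. G u $ i = u $ i) \<and>
      (\<forall>f\<in>polyfun (S \<union> R). (\<forall>x\<in>E. f x = 0) \<longrightarrow> (\<forall>u\<in>B. f (G u) = 0))" if "R \<subseteq> - S" for R
    using finite[of R] that
  proof (induction R rule: finite_induct)
    case empty
    \<comment> \<open>The starting graph is the identity: by independence a polynomial in the
      coordinates of \<open>S\<close> that vanishes on \<open>E\<close> vanishes everywhere.
      Coordinates outside \<open>S\<close> are replaced later.\<close>
    have "\<forall>f\<in>polyfun (S \<union> {}). (\<forall>x\<in>E. f x = 0) \<longrightarrow> (\<forall>u\<in>UNIV. f u = 0)"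
      using S(1) by (simp add: indep_coords_def)
    then show ?case
      by (intro exI[of _ UNIV] exI[of _ "\<lambda>u. u"]) (auto simp: line_hol_coord)
  next
    case (insert j R)
    then have "R \<subseteq> - S" by simp
    from insert.IH[OF this] obtain B G where B: "open B" "convex B" "\<xi> \<in> B"
      and G': "\<forall>i. line_hol B (\<lambda>u. G u $ i)" "G \<xi> = \<xi>" "\<forall>u\<in>B. \<forall>i\<in>S. G u $ i = u $ i"
      and van': "\<forall>f\<in>polyfun (S \<union> R). (\<forall>x\<in>E. f x = 0) \<longrightarrow> (\<forall>u\<in>B. f (G u) = 0)"
      by (elim exE conjE) (rule that)
    from G' have G: "line_hol B (\<lambda>u. G u $ i)" "G \<xi> = \<xi>" for i by simp_all
    have GS: "G u $ i = u $ i" if "u \<in> B" "i \<in> S" for u i using G'(3) that by simp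
    have van: "f (G u) = 0" if "f \<in> polyfun (S \<union> R)" "\<forall>x\<in>E. f x = 0" "u \<in> B" for f u
      using van' that by simp
    define T where "T = S \<union> R"
    have j: "j \<notin> T" "j \<notin> S" using insert by (auto simp: T_def)
    have I: "(T, j) \<in> ?I" using j by (auto simp: T_def)
    define e where "e = fst (r (T, j))"
    define a where "a = snd (r (T, j))"
    have rel: "coord_relation E T j e a" using r(1)[OF I] by (simp add: e_def a_def)
    have min: "e \<le> e'" if "coord_relation E T j e' a'" for e' a'
      using r(2)[OF I] that by (simp add: e_def)
    have a_poly: "a k \<in> polyfun T" for k using rel by (simp add: coord_relation_def)
    have b: "line_hol B (\<lambda>u. a k (G u))" for k
      by (rule line_hol_polyfun[OF a_poly G(1)])
    have rt: "(\<Sum>k\<le>e. a k (G \<xi>) * \<xi> $ j ^ k) = 0"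
      using rel \<xi>(1) by (simp add: G(2) coord_relation_def)
    have sm: "(\<Sum>k\<le>e. a k (G \<xi>) * (of_nat k * \<xi> $ j ^ (k - 1))) \<noteq> 0"
      using \<xi>(2)[OF I] by (simp add: G(2) der_def e_def a_def)
    from simple_root_line_hol[where B = B and \<xi> = \<xi> and b = "\<lambda>k u. a k (G u)" and e = e and ?z0.0 = "\<xi> $ j", OF B(1) B(3) b rt sm]
    obtain \<delta> g where g: "\<delta> > 0" "ball \<xi> \<delta> \<subseteq> B" "line_hol (ball \<xi> \<delta>) g" "g \<xi> = \<xi> $ j"
      "\<forall>u\<in>ball \<xi> \<delta>. (\<Sum>k\<le>e. a k (G u) * g u ^ k) = 0"
      by (elim exE conjE) (rule that)
    have "continuous_on B (\<lambda>u. a e (G u))" using b by (simp add: line_hol_def)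
    from continuous_open_preimage[OF this B(1), of "- {0}"]
    have "open (B \<inter> (\<lambda>u. a e (G u)) -` (- {0}))" by (simp add: open_Compl)
    then have "open (B \<inter> (\<lambda>u. a e (G u)) -` (- {0}) \<inter> ball \<xi> \<delta>)" by (rule open_Int) simp
    moreover have "\<xi> \<in> B \<inter> (\<lambda>u. a e (G u)) -` (- {0}) \<inter> ball \<xi> \<delta>"
      using B(3) g(1) \<xi>(2)[OF I] by (simp add: G(2) lead_def e_def a_def)
    ultimately obtain \<epsilon> where \<epsilon>: "\<epsilon> > 0" "ball \<xi> \<epsilon> \<subseteq> B \<inter> (\<lambda>u. a e (G u)) -` (- {0}) \<inter> ball \<xi> \<delta>"
      unfolding open_contains_ball by blast
    \<comment> \<open>Only coordinate \<open>j\<close> changes. Polynomials in the coordinates of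
      \<open>T\<close> keep their values, so earlier vanishing statements survive.\<close>
    define G' where "G' u = (\<chi> i. if i = j then g u else G u $ i)" for u
    have G'T: "f (G' u) = f (G u)" if "f \<in> polyfun T" for f u
      using that by (rule polyfun_cong) (use j in \<open>auto simp: G'_def\<close>)
    have "line_hol (ball \<xi> \<epsilon>) (\<lambda>u. G' u $ i)" for i
    proof (cases "i = j")
      case True
      then show ?thesis using line_hol_subset[OF g(3), of "ball \<xi> \<epsilon>"] \<epsilon>(2) by (simp add: G'_def)
    next
      case False
      then show ?thesis using line_hol_subset[OF G(1), of "ball \<xi> \<epsilon>"] \<epsilon>(2) by (simp add: G'_def)
    qed
    moreover have "G' \<xi> = \<xi>" by (simp add: G'_def vec_eq_iff g(4) G(2))
    moreover have "G' u $ i = u $ i" if "u \<in> ball \<xi> \<epsilon>" "i \<in> S" for u i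
    proof -
      have "u \<in> B" "i \<noteq> j" using that \<epsilon>(2) j by auto
      then show ?thesis using GS that by (simp add: G'_def)
    qed
    moreover have "f (G' u) = 0" if f: "f \<in> polyfun (S \<union> insert j R)" "\<forall>x\<in>E. f x = 0"
      and u: "u \<in> ball \<xi> \<epsilon>" for f u
    proof (rule vanish_insert_coord[OF rel min])
      have uB: "u \<in> B" "u \<in> ball \<xi> \<delta>" "a e (G u) \<noteq> 0" using u \<epsilon>(2) by auto
      show "h (G' u) = 0" if "h \<in> polyfun T" "\<forall>x\<in>E. h x = 0" for h
        unfolding G'T[OF that(1)] using van[of h u] that uB by (simp add: T_def)
      show "(\<Sum>k\<le>e. a k (G' u) * G' u $ j ^ k) = 0"
        using bspec[OF g(5) uB(2)] by (simp add: G'T[OF a_poly]) (simp add: G'_def)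
      show "a e (G' u) \<noteq> 0" using uB(3) by (simp add: G'T[OF a_poly])
      show "f \<in> polyfun (insert j T)" using f(1) by (simp add: T_def)
    qed (use f in auto)
    ultimately show ?case
      using \<epsilon>(1) by (intro exI[of _ "ball \<xi> \<epsilon>"] exI[of _ G']) (auto simp del: mem_ball)
  qed
  from this[of "- S", OF order_refl] show ?thesis
    unfolding Compl_partition by (elim exE conjE) (intro exI conjI)
qed

text \<open>All coordinates of \<open>S\<close> are frozen at \<open>i = 0\<close> and none at
  \<open>i = card S\<close>. Releasing coordinate \<open>h i\<close> enlarges the closure strictly:
  that coordinate is constant on \<open>D i\<close>, hence on all of its closure, but takes another
  value on \<open>D (Suc i)\<close>.\<close>

theorem card_indep_coords_le_algebraic_dim:
  fixes E :: "(complex ^ 'm) set"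
  assumes prime: "prime_vanishing E" "E \<noteq> {}"
    and S: "indep_coords E S" "\<forall>j. j \<notin> S \<longrightarrow> \<not> indep_coords E (insert j S)"
  shows "enat (card S) \<le> algebraic_dim (zariski_hull E)"
proof -
  obtain \<xi> B G where B: "open B" "convex B" "\<xi> \<in> B"
    and G': "\<forall>i. line_hol B (\<lambda>u. G u $ i)" "\<forall>u\<in>B. \<forall>i\<in>S. G u $ i = u $ i"
    and van': "\<forall>f\<in>polyfun UNIV. (\<forall>x\<in>E. f x = 0) \<longrightarrow> (\<forall>u\<in>B. f (G u) = 0)"
    using generic_graph[OF assms] by (elim exE conjE) (rule that)
  have G: "line_hol B (\<lambda>u. G u $ i)" for i using G'(1) by simp
  have GS: "G u $ i = u $ i" if "u \<in> B" "i \<in> S" for u i using G'(2) that by simp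
  have van: "f (G u) = 0" if "f \<in> polyfun UNIV" "\<forall>x\<in>E. f x = 0" "u \<in> B" for f u
    using van' that by simp
  obtain h where h: "bij_betw h {0..<card S} S" using ex_bij_betw_nat_finite[OF finite[of S]] by blast
  define A where "A i = {u \<in> B. \<forall>s\<in>h ` {i..<card S}. u $ s = \<xi> $ s}" for i
  define D where "D i = zariski_hull (G ` A i)" for i
  have \<xi>A: "\<xi> \<in> A i" for i using B by (simp add: A_def)
  have irr: "irreducible_algebraic_set (D i)" for i
    unfolding D_def
  proof (rule irreducible_zariski_hull)
    show "prime_vanishing (G ` A i)"
      unfolding A_def by (rule prime_vanishing_line_hol_image[OF B(1,2) G])
    show "G ` A i \<noteq> {}" using \<xi>A by blast
  qed
  have DE: "D i \<subseteq> zariski_hull E" for i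
    unfolding D_def
  proof (rule zariski_hull_minimal[OF algebraic_set_zariski_hull])
    show "G ` A i \<subseteq> zariski_hull E"
      using van polyfun_mp_eval by (auto simp: A_def zariski_hull_def)
  qed
  have strict: "D i \<subset> D (Suc i)" if i: "i < card S" for i
  proof
    have "A i \<subseteq> A (Suc i)" by (auto simp: A_def)
    then show "D i \<subseteq> D (Suc i)"
      unfolding D_def
      by (intro zariski_hull_minimal algebraic_set_zariski_hull
          order_trans[OF image_mono subset_zariski_hull])
    have hi: "h i \<in> S" using h i by (auto simp: bij_betw_def)
    obtain \<epsilon> where \<epsilon>: "\<epsilon> > 0" "cball \<xi> \<epsilon> \<subseteq> B" using B open_contains_cball by blast
    \<comment> \<open>Moving \<open>\<xi>\<close> along the released coordinate alone; as
      \<open>G\<close> reproduces the coordinates in \<open>S\<close>, the displacement is visible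
      in the image.\<close>
    define u where "u = \<xi> + axis (h i) (of_real \<epsilon>)"
    have "norm (axis (h i) (complex_of_real \<epsilon>)) \<le> (\<Sum>k\<in>UNIV. norm (axis (h i) (complex_of_real \<epsilon>) $ k))"
      unfolding norm_vec_def by (rule L2_set_le_sum) simp
    also have "\<dots> = (\<Sum>k\<in>UNIV. if k = h i then \<epsilon> else 0)"
      using \<epsilon>(1) by (intro sum.cong) (auto simp: axis_def)
    finally have "u \<in> cball \<xi> \<epsilon>" by (simp add: u_def dist_norm)
    then have uB: "u \<in> B" using \<epsilon> by blast
    have "u $ h k = \<xi> $ h k" if "Suc i \<le> k" "k < card S" for k
    proof -
      have "inj_on h {0..<card S}" using h by (simp add: bij_betw_def)
      then have "h k \<noteq> h i" using that i by (simp add: inj_on_eq_iff)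
      then show ?thesis by (simp add: u_def axis_def)
    qed
    then have "u \<in> A (Suc i)" using uB by (auto simp: A_def)
    then have Gu: "G u \<in> D (Suc i)"
      unfolding D_def by (intro subsetD[OF subset_zariski_hull] imageI)
    have "G u $ h i - \<xi> $ h i \<noteq> 0"
      using GS[OF uB hi] \<epsilon>(1) by (simp add: u_def)
    moreover have "x $ h i - \<xi> $ h i = 0" if "x \<in> D i" for x
    proof (rule polyfun_zero_zariski_hull[of "\<lambda>x. x $ h i - \<xi> $ h i" UNIV "G ` A i"])
      show "(\<lambda>x. x $ h i - \<xi> $ h i) \<in> polyfun UNIV"
        by (intro polyfun_diff polyfun_var polyfun_const) simp
      show "y $ h i - \<xi> $ h i = 0" if "y \<in> G ` A i" for y
        using that i GS hi by (auto simp: A_def)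
      show "x \<in> zariski_hull (G ` A i)" using that by (simp add: D_def)
    qed
    ultimately show "D i \<noteq> D (Suc i)" using Gu by metis
  qed
  show ?thesis
    unfolding algebraic_dim_def
    by (intro Sup_upper CollectI exI[of _ "card S"] conjI refl exI[of _ D]) (simp_all add: irr DE strict)
qed

section \<open>Power series expansions\<close>

lemma has_expansion_const: "has_expansion (\<lambda>_. k) b (\<lambda>\<nu>. if \<nu> = 0 then k else 0)"
  unfolding has_expansion_def
proof (intro exI[of _ 1] conjI allI impI)
  fix t
  show "((\<lambda>\<nu>. (if \<nu> = 0 then k else 0) * monomial (t - b) \<nu>) has_sum k) UNIV"
    by (rule has_sum_finite_neutralI[of "{0}"]) auto
qed simp

lemma has_expansion_add:
  assumes "has_expansion f b c" "has_expansion g b d"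
  shows "has_expansion (\<lambda>t. f t + g t) b (\<lambda>\<nu>. c \<nu> + d \<nu>)"
proof -
  obtain r where r: "r > 0" "\<And>t. (\<forall>i. cmod (t $ i - b $ i) < r) \<Longrightarrow>
      ((\<lambda>\<nu>. c \<nu> * monomial (t - b) \<nu>) has_sum f t) UNIV"
    using assms(1) unfolding has_expansion_def by auto
  obtain q where q: "q > 0" "\<And>t. (\<forall>i. cmod (t $ i - b $ i) < q) \<Longrightarrow>
      ((\<lambda>\<nu>. d \<nu> * monomial (t - b) \<nu>) has_sum g t) UNIV"
    using assms(2) unfolding has_expansion_def by auto
  show ?thesis
    unfolding has_expansion_def
  proof (intro exI[of _ "min r q"] conjI allI impI)
    fix t assume t: "\<forall>i. cmod (t $ i - b $ i) < min r q"
    then show "((\<lambda>\<nu>. (c \<nu> + d \<nu>) * monomial (t - b) \<nu>) has_sum (f t + g t)) UNIV"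
      unfolding distrib_right by (intro has_sum_add r q) auto
  qed (use r q in auto)
qed

lemma has_expansion_mult_left:
  assumes "has_expansion f b c"
  shows "has_expansion (\<lambda>t. k * f t) b (\<lambda>\<nu>. k * c \<nu>)"
  using assms unfolding has_expansion_def
  by (auto simp: mult.assoc intro!: has_sum_cmult_right)

lemma has_expansion_zero: "has_expansion (\<lambda>_. 0) b (\<lambda>_. 0)"
  using has_expansion_const[of 0 b] by (simp cong: if_cong)

lemma has_expansion_sum:
  assumes "\<And>i. i \<in> I \<Longrightarrow> has_expansion (f i) b (c i)"
  shows "has_expansion (\<lambda>t. \<Sum>i\<in>I. f i t) b (\<lambda>\<nu>. \<Sum>i\<in>I. c i \<nu>)"
  using assms
  by (induction I rule: infinite_finite_induct) (auto intro: has_expansion_zero has_expansion_add)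

definition cauchy_prod :: "(nat ^ 'n \<Rightarrow> complex) \<Rightarrow> (nat ^ 'n \<Rightarrow> complex) \<Rightarrow> nat ^ 'n \<Rightarrow> complex"
  where "cauchy_prod c d \<kappa> = (\<Sum>p | fst p + snd p = \<kappa>. c (fst p) * d (snd p))"

lemma finite_exponent_pairs: "finite {p :: (nat ^ 'n::finite) \<times> (nat ^ 'n). fst p + snd p = \<kappa>}"
proof (rule finite_subset)
  let ?S = "{\<nu> :: nat ^ 'n. weight \<nu> \<le> weight \<kappa>}"
  show "{p. fst p + snd p = \<kappa>} \<subseteq> ?S \<times> ?S" by (auto simp: weight_add)
qed simp

text \<open>Unconditional summability of complex families is absolute, so the norms of the double
  family are summable and its iterated sum is its sum.\<close>

lemma has_sum_mult_Times:
  fixes f :: "'a \<Rightarrow> complex"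
  assumes f: "(f has_sum a) UNIV" and g: "(g has_sum b) UNIV"
  shows "((\<lambda>p. f (fst p) * g (snd p)) has_sum a * b) (UNIV \<times> UNIV)"
proof (rule has_sum_SigmaI)
  show "((\<lambda>y. f (fst (x, y)) * g (snd (x, y))) has_sum f x * b) UNIV" for x
    using has_sum_cmult_right[OF g] by simp
  show "((\<lambda>x. f x * b) has_sum a * b) UNIV"
    by (rule has_sum_cmult_left[OF f])
  have f': "(\<lambda>x. norm (f x)) summable_on UNIV" and g': "(\<lambda>x. norm (g x)) summable_on UNIV"
    by (rule summable_on_iff_abs_summable_on_complex[THEN iffD1], rule has_sum_imp_summable, rule f g)+
  have "(\<lambda>p. norm (f (fst p) * g (snd p))) summable_on (UNIV \<times> UNIV)"
    unfolding Infinite_Sum.abs_summable_on_Sigma_iff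
  proof (intro conjI ballI)
    show "(\<lambda>y. norm (f (fst (x, y)) * g (snd (x, y)))) summable_on UNIV" for x
      unfolding norm_mult fst_conv snd_conv by (rule summable_on_cmult_right[OF g'])
    have "(\<Sum>\<^sub>\<infinity>y\<in>UNIV. norm (f (fst (x, y)) * g (snd (x, y)))) = norm (f x) * (\<Sum>\<^sub>\<infinity>y\<in>UNIV. norm (g y))" for x
      unfolding norm_mult fst_conv snd_conv using g' by (intro infsum_cmult_right)
    moreover have "(\<Sum>\<^sub>\<infinity>y\<in>UNIV. norm (g y)) \<ge> 0" by (rule infsum_nonneg) simp
    ultimately show "(\<lambda>x. norm (\<Sum>\<^sub>\<infinity>y\<in>UNIV. norm (f (fst (x, y)) * g (snd (x, y))))) summable_on UNIV"
      using summable_on_cmult_left[OF f', of "\<Sum>\<^sub>\<infinity>y\<in>UNIV. norm (g y)"]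
      by (simp add: norm_mult)
  qed
  then show "(\<lambda>p. f (fst p) * g (snd p)) summable_on UNIV \<times> UNIV"
    by (rule abs_summable_summable)
qed

text \<open>The double family is regrouped along the fibres of \<open>fst p + snd p\<close>, which
  are finite.\<close>

lemma has_expansion_mult:
  assumes "has_expansion f b c" "has_expansion g b d"
  shows "has_expansion (\<lambda>t. f t * g t) b (cauchy_prod c d)"
proof -
  obtain r where r: "r > 0" "\<And>t. (\<forall>i. cmod (t $ i - b $ i) < r) \<Longrightarrow>
      ((\<lambda>\<nu>. c \<nu> * monomial (t - b) \<nu>) has_sum f t) UNIV"
    using assms(1) unfolding has_expansion_def by auto
  obtain q where q: "q > 0" "\<And>t. (\<forall>i. cmod (t $ i - b $ i) < q) \<Longrightarrow>
      ((\<lambda>\<nu>. d \<nu> * monomial (t - b) \<nu>) has_sum g t) UNIV"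
    using assms(2) unfolding has_expansion_def by auto
  show ?thesis
    unfolding has_expansion_def
  proof (intro exI[of _ "min r q"] conjI allI impI)
    fix t assume t: "\<forall>i. cmod (t $ i - b $ i) < min r q"
    define h where "h p = c (fst p) * monomial (t - b) (fst p) * (d (snd p) * monomial (t - b) (snd p))" for p
    have "(h has_sum f t * g t) (UNIV \<times> UNIV)"
      unfolding h_def by (rule has_sum_mult_Times; intro r q) (use t in auto)
    moreover have "(h has_sum f t * g t) (UNIV \<times> UNIV) =
      ((\<lambda>p. h (snd p)) has_sum f t * g t) (Sigma UNIV (\<lambda>\<kappa>. {p. fst p + snd p = \<kappa>}))"
      by (rule has_sum_reindex_bij_witness[where i = snd and j = "\<lambda>p. (fst p + snd p, p)"]) auto
    ultimately have "((\<lambda>p. h (snd p)) has_sum f t * g t) (Sigma UNIV (\<lambda>\<kappa>. {p. fst p + snd p = \<kappa>}))"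
      by simp
    then have "((\<lambda>\<kappa>. \<Sum>p | fst p + snd p = \<kappa>. h p) has_sum f t * g t) UNIV"
    proof (rule has_sum_SigmaD)
      show "((\<lambda>y. h (snd (x, y))) has_sum (\<Sum>p | fst p + snd p = x. h p)) {p. fst p + snd p = x}" for x
        by (simp add: has_sum_finite finite_exponent_pairs)
    qed
    moreover have "(\<Sum>p | fst p + snd p = \<kappa>. h p) = cauchy_prod c d \<kappa> * monomial (t - b) \<kappa>" for \<kappa>
      unfolding cauchy_prod_def sum_distrib_right
      by (intro sum.cong refl) (auto simp: h_def monomial_add)
    ultimately show "((\<lambda>\<nu>. cauchy_prod c d \<nu> * monomial (t - b) \<nu>) has_sum f t * g t) UNIV" by simp
  qed (use r q in auto)
qed

text \<open>Grouping terms by total degree turns the expansion into a one-variable power series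
  along the line, with the homogeneous parts at \<open>v\<close> as coefficients. The denominator
  \<open>norm v + 1\<close> in the radius allows \<open>v = 0\<close>.\<close>

lemma has_expansion_line_sums:
  assumes "has_expansion f b c"
  shows "\<exists>\<rho>>0. \<forall>s. cmod s < \<rho> \<longrightarrow>
    (\<lambda>k. (\<Sum>\<nu> | weight \<nu> = k. c \<nu> * monomial v \<nu>) * s ^ k) sums f (b + s *s v)"
proof -
  obtain r where r: "r > 0" "\<And>t. (\<forall>i. cmod (t $ i - b $ i) < r) \<Longrightarrow>
      ((\<lambda>\<nu>. c \<nu> * monomial (t - b) \<nu>) has_sum f t) UNIV"
    using assms unfolding has_expansion_def by auto
  define \<rho> where "\<rho> = r / (norm v + 1)"
  have nv: "norm v + 1 > 0" by (simp add: add_nonneg_pos)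
  have \<rho>: "\<rho> > 0" using r(1) nv by (simp add: \<rho>_def)
  have "(\<lambda>k. (\<Sum>\<nu> | weight \<nu> = k. c \<nu> * monomial v \<nu>) * s ^ k) sums f (b + s *s v)" if s: "cmod s < \<rho>" for s
  proof -
    have "cmod ((b + s *s v) $ i - b $ i) < r" for i
    proof -
      have "cmod ((b + s *s v) $ i - b $ i) = cmod s * cmod (v $ i)" by (simp add: norm_mult)
      also have "\<dots> \<le> cmod s * (norm v + 1)"
        using Finite_Cartesian_Product.norm_nth_le[of v i] by (intro mult_left_mono) auto
      also have "\<dots> < r" using s nv by (simp add: \<rho>_def pos_less_divide_eq)
      finally show ?thesis .
    qed
    then have "((\<lambda>\<nu>. c \<nu> * monomial (b + s *s v - b) \<nu>) has_sum f (b + s *s v)) UNIV"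
      by (intro r) blast
    then have "((\<lambda>\<nu>. c \<nu> * monomial v \<nu> * s ^ weight \<nu>) has_sum f (b + s *s v)) UNIV"
      by (simp add: monomial_scale mult_ac)
    moreover have "((\<lambda>\<nu>. c \<nu> * monomial v \<nu> * s ^ weight \<nu>) has_sum f (b + s *s v)) UNIV =
      ((\<lambda>p. c (snd p) * monomial v (snd p) * s ^ weight (snd p)) has_sum f (b + s *s v))
        (Sigma UNIV (\<lambda>k. {\<nu>. weight \<nu> = k}))"
      by (rule has_sum_reindex_bij_witness[where i = snd and j = "\<lambda>\<nu>. (weight \<nu>, \<nu>)"]) auto
    ultimately have "((\<lambda>p. c (snd p) * monomial v (snd p) * s ^ weight (snd p)) has_sum f (b + s *s v))
        (Sigma UNIV (\<lambda>k. {\<nu>. weight \<nu> = k}))" by simp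
    then have "((\<lambda>k. (\<Sum>\<nu> | weight \<nu> = k. c \<nu> * monomial v \<nu>) * s ^ k) has_sum f (b + s *s v)) UNIV"
    proof (rule has_sum_SigmaD)
      fix k
      have "(\<Sum>\<nu> | weight \<nu> = k. c \<nu> * monomial v \<nu>) * s ^ k
          = (\<Sum>\<nu> | weight \<nu> = k. c \<nu> * monomial v \<nu> * s ^ weight \<nu>)"
        by (simp add: sum_distrib_right)
      then show "((\<lambda>\<nu>. c (snd (k, \<nu>)) * monomial v (snd (k, \<nu>)) * s ^ weight (snd (k, \<nu>)))
          has_sum (\<Sum>\<nu> | weight \<nu> = k. c \<nu> * monomial v \<nu>) * s ^ k) {\<nu>. weight \<nu> = k}"
        unfolding snd_conv by (rule has_sum_finiteI[OF finite_weight_eq])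
    qed
    then show ?thesis by (rule has_sum_imp_sums)
  qed
  then show ?thesis using \<rho> by blast
qed

lemma eventually_nhds_line:
  fixes b :: "complex ^ 'n"
  assumes "eventually P (nhds b)"
  shows "\<exists>\<rho>>0. \<forall>s. cmod s < \<rho> \<longrightarrow> P (b + s *s v)"
proof -
  obtain N where N: "open N" "b \<in> N" "\<forall>x\<in>N. P x" using assms by (auto simp: eventually_nhds)
  have "0 \<in> {s. b + s *s v \<in> N}" using N by simp
  then obtain \<rho> where "\<rho> > 0" "ball 0 \<rho> \<subseteq> {s. b + s *s v \<in> N}"
    using open_line[OF N(1), of b v] open_contains_ball by blast
  then show ?thesis using N(3) by (intro exI[of _ \<rho>]) auto
qed

text \<open>On every line the power series is zero, since a nonzero one has isolated zeros. Each
  homogeneous part thus vanishes as a function of the direction, hence as a polynomial.\<close>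

lemma has_expansion_zero_unique:
  assumes f: "has_expansion f b c" and 0: "eventually (\<lambda>t. f t = 0) (nhds b)"
  shows "c \<nu> = 0"
proof -
  have hom: "(\<Sum>\<nu> | weight \<nu> = k. c \<nu> * monomial v \<nu>) = 0" for k v
  proof -
    define P where "P k = (\<Sum>\<nu> | weight \<nu> = k. c \<nu> * monomial v \<nu>)" for k
    obtain \<rho>1 where \<rho>1: "\<rho>1 > 0" "\<And>s. cmod s < \<rho>1 \<Longrightarrow> (\<lambda>k. P k * s ^ k) sums f (b + s *s v)"
      using has_expansion_line_sums[OF f, of v] unfolding P_def by blast
    obtain \<rho>2 where \<rho>2: "\<rho>2 > 0" "\<And>s. cmod s < \<rho>2 \<Longrightarrow> f (b + s *s v) = 0"
      using eventually_nhds_line[OF 0, of v] by blast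
    define \<rho> where "\<rho> = min \<rho>1 \<rho>2"
    have \<rho>: "\<rho> > 0" "\<And>s. cmod s < \<rho> \<Longrightarrow> (\<lambda>k. P k * s ^ k) sums 0"
      using \<rho>1 \<rho>2 unfolding \<rho>_def by (auto, metis)
    have P0: "P 0 = 0" using \<rho>(2)[of 0] \<rho>(1) by simp
    have "P k = 0"
    proof (rule ccontr)
      assume k: "P k \<noteq> 0"
      then have "k > 0" using P0 by (cases k) auto
      have *: "(\<lambda>n. P n * (x - 0) ^ n) sums 0" if "norm (x - 0) < \<rho>" for x
        using \<rho>(2) that by simp
      show False
      proof (rule powser_0_nonzero[where f = "\<lambda>_. 0" and a = P and \<xi> = 0 and m = k, OF \<rho>(1) *])
        fix s :: real
        assume s: "0 < s" "\<And>z. z \<in> cball (0::complex) s - {0} \<Longrightarrow> (0::complex) \<noteq> 0"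
        have "complex_of_real s \<in> cball 0 s - {0}" using \<open>s > 0\<close> by simp
        then show False using s(2) by blast
      qed (use k \<open>k > 0\<close> in auto)
    qed
    then show ?thesis by (simp add: P_def)
  qed
  define H where "H = (\<Sum>\<mu> | weight \<mu> = weight \<nu>. Poly_Mapping.single \<mu> (c \<mu>))"
  have "mp_eval H v = 0" for v
    using hom[where k = "weight \<nu>"] by (simp add: H_def mp_eval_sum)
  then have "H = 0" by (rule mp_eval_eq_0_imp)
  moreover have "Poly_Mapping.lookup H \<nu> = c \<nu>"
    by (simp add: H_def lookup_sum lookup_single when_def)
  ultimately show ?thesis by simp
qed

lemma has_expansion_unique:
  assumes f: "has_expansion f b c" and g: "has_expansion g b d"
    and fg: "eventually (\<lambda>t. f t = g t) (nhds b)"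
  shows "c = d"
proof
  fix \<nu>
  have "has_expansion (\<lambda>t. f t + (- 1) * g t) b (\<lambda>\<nu>. c \<nu> + (- 1) * d \<nu>)"
    by (intro has_expansion_add has_expansion_mult_left f g)
  moreover have "eventually (\<lambda>t. f t + (- 1) * g t = 0) (nhds b)"
    using fg by eventually_elim simp
  ultimately have "c \<nu> + (- 1) * d \<nu> = 0" by (rule has_expansion_zero_unique)
  then show "c \<nu> = d \<nu>" by simp
qed

lemma has_expansion_eventually_0:
  assumes "has_expansion f b (\<lambda>_. 0)"
  shows "eventually (\<lambda>t. f t = 0) (nhds b)"
proof -
  obtain r where r: "r > 0" "\<And>t. (\<forall>i. cmod (t $ i - b $ i) < r) \<Longrightarrow>
      ((\<lambda>\<nu>. 0 * monomial (t - b) \<nu>) has_sum f t) UNIV"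
    using assms unfolding has_expansion_def by auto
  have "f t = 0" if "t \<in> ball b r" for t
  proof -
    have "cmod (t $ i - b $ i) < r" for i
      using Finite_Cartesian_Product.norm_nth_le[of "t - b" i] that by (simp add: dist_norm norm_minus_commute)
    then have "((\<lambda>\<nu> :: nat ^ 'a. 0) has_sum f t) UNIV" using r(2)[of t] by simp
    then show ?thesis using has_sum_unique[OF _ has_sum_0_simp] by blast
  qed
  then show ?thesis
    unfolding eventually_nhds using r(1) by (intro exI[of _ "ball b r"]) auto
qed

lemma has_expansion_line_deriv:
  assumes "has_expansion f b c"
  shows "((\<lambda>s. f (b + s *s v)) has_field_derivative (\<Sum>\<nu> | weight \<nu> = 1. c \<nu> * monomial v \<nu>)) (at 0)"
proof -
  define P where "P k = (\<Sum>\<nu> | weight \<nu> = k. c \<nu> * monomial v \<nu>)" for k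
  obtain \<rho> where \<rho>: "\<rho> > 0" "\<And>s. cmod s < \<rho> \<Longrightarrow> (\<lambda>k. P k * s ^ k) sums f (b + s *s v)"
    using has_expansion_line_sums[OF assms, of v] unfolding P_def by blast
  have "((\<lambda>s. suminf (\<lambda>k. P k * s ^ k)) has_field_derivative (suminf (\<lambda>k. diffs P k * 0 ^ k))) (at 0)"
    using \<rho> by (intro termdiffs_strong'[where K = \<rho>]) (auto dest: sums_summable)
  then have "((\<lambda>s. suminf (\<lambda>k. P k * s ^ k)) has_field_derivative P 1) (at 0)"
    by (simp add: diffs_def)
  then have "((\<lambda>s. f (b + s *s v)) has_field_derivative P 1) (at 0)"
  proof (rule has_field_derivative_transform_within_open[where S = "ball 0 \<rho>"])
    show "suminf (\<lambda>k. P k * s ^ k) = f (b + s *s v)" if "s \<in> ball 0 \<rho>" for s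
      using sums_unique[OF \<rho>(2), of s] that by simp
  qed (use \<rho> in auto)
  then show ?thesis by (simp only: P_def)
qed

text \<open>Bridge from power series to holomorphy on lines: the line is rebased at each of its
  points, where an expansion gives the complex derivative.\<close>

lemma line_hol_hol_at:
  assumes "continuous_on B f" "\<And>p. p \<in> B \<Longrightarrow> hol_at f p"
  shows "line_hol B f"
  unfolding line_hol_def
proof (intro conjI allI)
  fix p v
  show "(\<lambda>s. f (p + s *s v)) holomorphic_on {s. p + s *s v \<in> B}"
    unfolding holomorphic_on_def
  proof
    fix s0 assume "s0 \<in> {s. p + s *s v \<in> B}"
    then obtain c where "has_expansion f (p + s0 *s v) c"
      using assms(2) unfolding hol_at_def by blast
    from has_expansion_line_deriv[OF this, of v] obtain D where
      "((\<lambda>s. f (p + s0 *s v + s *s v)) has_field_derivative D) (at 0)" by blast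
    then have "((\<lambda>s. f (p + s *s v)) has_field_derivative D) (at s0)"
      using DERIV_shift[of "\<lambda>s. f (p + s *s v)" D 0 s0]
      by (simp add: vec.scale_left_distrib add_ac)
    then show "(\<lambda>s. f (p + s *s v)) field_differentiable (at s0 within {s. p + s *s v \<in> B})"
      unfolding field_differentiable_def using has_field_derivative_at_within by blast
  qed
qed (rule assms)

lemma has_expansion_at_base:
  assumes "has_expansion f b c" shows "f b = c 0"
proof -
  obtain r where r: "r > 0" "\<And>t. (\<forall>i. cmod (t $ i - b $ i) < r) \<Longrightarrow>
      ((\<lambda>\<nu>. c \<nu> * monomial (t - b) \<nu>) has_sum f t) UNIV"
    using assms unfolding has_expansion_def by auto
  have "monomial (0 :: complex ^ 'a) \<nu> = 0" if "\<nu> \<noteq> 0" for \<nu> :: "nat ^ 'a"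
    using monomial_scale[of 0 0 \<nu>] that by (simp add: power_0_left)
  then have "((\<lambda>\<nu>. c \<nu> * monomial (b - b) \<nu>) has_sum c 0) UNIV"
    by (intro has_sum_finite_neutralI[of "{0}"]) auto
  then show ?thesis using r by (intro has_sum_unique[OF r(2)]) auto
qed

text \<open>Every nonconstant monomial contains a factor of size at most
  \<open>norm (t - b)\<close>; trading it for \<open>\<rho>\<close> bounds the difference by the
  absolutely convergent series at polyradius \<open>\<rho>\<close>.\<close>

lemma has_expansion_lipschitz:
  assumes "has_expansion f b c"
  shows "\<exists>C \<delta>. \<delta> > 0 \<and> (\<forall>t. norm (t - b) < \<delta> \<longrightarrow> cmod (f t - f b) \<le> C * norm (t - b))"
proof -
  obtain r where r: "r > 0" "\<And>t. (\<forall>i. cmod (t $ i - b $ i) < r) \<Longrightarrow>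
      ((\<lambda>\<nu>. c \<nu> * monomial (t - b) \<nu>) has_sum f t) UNIV"
    using assms unfolding has_expansion_def by auto
  define \<rho> where "\<rho> = r / 2"
  have \<rho>: "\<rho> > 0" "\<rho> < r" using r(1) by (auto simp: \<rho>_def)
  \<comment> \<open>At this point each monomial has modulus exactly
    \<open>\<rho> ^ weight \<nu>\<close>, so summability there gives the majorant.\<close>
  define t1 where "t1 = b + (\<chi> i. complex_of_real \<rho>)"
  have mon1: "cmod (monomial (t1 - b) \<nu>) = \<rho> ^ weight \<nu>" for \<nu>
    using \<rho> by (simp add: t1_def monomial_def weight_def power_sum prod_norm[symmetric] norm_power)
  have "((\<lambda>\<nu>. c \<nu> * monomial (t1 - b) \<nu>) has_sum f t1) UNIV"
    using \<rho> by (intro r) (auto simp: t1_def)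
  then have "(\<lambda>\<nu>. cmod (c \<nu> * monomial (t1 - b) \<nu>)) summable_on UNIV"
    by (rule summable_on_iff_abs_summable_on_complex[THEN iffD1, OF has_sum_imp_summable])
  then have abs: "(\<lambda>\<nu>. cmod (c \<nu>) * \<rho> ^ weight \<nu>) summable_on UNIV"
    by (simp add: norm_mult mon1)
  define M where "M = (\<Sum>\<^sub>\<infinity>\<nu>. cmod (c \<nu>) * \<rho> ^ weight \<nu>)"
  have M: "((\<lambda>\<nu>. cmod (c \<nu>) * \<rho> ^ weight \<nu>) has_sum M) UNIV"
    unfolding M_def by (rule has_sum_infsum[OF abs])
  have "cmod (f t - f b) \<le> M / \<rho> * norm (t - b)" if t: "norm (t - b) < \<rho>" for t
  proof -
    have comp: "cmod ((t - b) $ i) \<le> norm (t - b)" for i by (rule Finite_Cartesian_Product.norm_nth_le)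
    have "((\<lambda>\<nu>. c \<nu> * monomial (t - b) \<nu>) has_sum f t) UNIV"
    proof (rule r(2), rule allI)
      show "cmod (t $ i - b $ i) < r" for i using comp[of i] t \<rho> by simp
    qed
    moreover have "((\<lambda>\<nu> :: nat ^ 'a. if \<nu> = 0 then - f b else 0) has_sum - f b) UNIV"
      by (rule has_sum_finite_neutralI[of "{0}"]) auto
    ultimately have sum: "((\<lambda>\<nu>. c \<nu> * monomial (t - b) \<nu> + (if \<nu> = 0 then - f b else 0)) has_sum f t + - f b) UNIV"
      by (rule has_sum_add)
    have bound: "cmod (c \<nu> * monomial (t - b) \<nu> + (if \<nu> = 0 then - f b else 0))
        \<le> cmod (c \<nu>) * \<rho> ^ weight \<nu> * (norm (t - b) / \<rho>)" for \<nu>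
    proof (cases "\<nu> = 0")
      case True
      then show ?thesis using has_expansion_at_base[OF assms] \<rho> by simp
    next
      case False
      then obtain k where k: "weight \<nu> = Suc k" by (cases "weight \<nu>") auto
      have "cmod (monomial (t - b) \<nu>) \<le> norm (t - b) ^ weight \<nu>"
        by (rule norm_monomial_le[OF comp])
      also have "\<dots> = norm (t - b) * norm (t - b) ^ k" by (simp add: k)
      also have "\<dots> \<le> norm (t - b) * \<rho> ^ k"
        using t by (intro mult_left_mono power_mono) auto
      also have "\<dots> = \<rho> ^ weight \<nu> * (norm (t - b) / \<rho>)" using \<rho> by (simp add: k)
      finally have "cmod (c \<nu>) * cmod (monomial (t - b) \<nu>) \<le> cmod (c \<nu>) * (\<rho> ^ weight \<nu> * (norm (t - b) / \<rho>))"
        by (rule mult_left_mono) simp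
      then show ?thesis using False by (simp add: norm_mult mult.assoc)
    qed
    have sumM: "((\<lambda>\<nu>. cmod (c \<nu>) * \<rho> ^ weight \<nu> * (norm (t - b) / \<rho>)) has_sum M * (norm (t - b) / \<rho>)) UNIV"
      by (rule has_sum_cmult_left[OF M])
    have "(\<lambda>\<nu>. cmod (c \<nu> * monomial (t - b) \<nu> + (if \<nu> = 0 then - f b else 0))) summable_on UNIV"
      by (rule summable_on_iff_abs_summable_on_complex[THEN iffD1, OF has_sum_imp_summable[OF sum]])
    from has_sum_infsum[OF this] have "cmod (f t + - f b) \<le> (\<Sum>\<^sub>\<infinity>\<nu>. cmod (c \<nu> * monomial (t - b) \<nu> + (if \<nu> = 0 then - f b else 0)))"
      by (rule norm_has_sum_bound[OF _ sum])
    also have "\<dots> \<le> M * (norm (t - b) / \<rho>)"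
      by (rule has_sum_mono[OF \<open>(_ has_sum (\<Sum>\<^sub>\<infinity>\<nu>. cmod (c \<nu> * monomial (t - b) \<nu> + (if \<nu> = 0 then - f b else 0)))) UNIV\<close> sumM bound])
    finally show ?thesis by simp
  qed
  then show ?thesis using \<rho> by blast
qed

section \<open>Germs\<close>

lemma nhds_eq_filtermap_plus: "nhds (b :: 'a::real_normed_vector) = filtermap (\<lambda>t. b + t) (nhds 0)"
  using filtermap_nhds_shift[of "- b" 0] by (simp add: add.commute)

lemma germ_at_eq_iff: "germ_at b f = germ_at b g \<longleftrightarrow> eventually (\<lambda>t. f t = g t) (nhds b)"
  unfolding nhds_eq_filtermap_plus[of b] eventually_filtermap
  by transfer (simp add: germ_eq_def)

lemma germ_at_zero: "germ_at b (\<lambda>_. 0) = 0"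
  by transfer (simp add: germ_eq_def)

lemma germ_at_eq_0_iff: "germ_at b f = 0 \<longleftrightarrow> eventually (\<lambda>t. f t = 0) (nhds b)"
  unfolding germ_at_zero[of b, symmetric] germ_at_eq_iff ..

lemma germ_at_add: "germ_at b (\<lambda>t. f t + g t) = germ_at b f + germ_at b g"
  by transfer (simp add: germ_eq_def)

lemma germ_at_scale: "germ_at b (\<lambda>t. k * f t) = germ_scale k (germ_at b f)"
  by transfer (simp add: germ_eq_def)

lemma germ_at_sum: "germ_at b (\<lambda>t. \<Sum>i\<in>I. f i t) = (\<Sum>i\<in>I. germ_at b (f i))"
  by (induction I rule: infinite_finite_induct) (auto simp: germ_at_zero germ_at_add)

lemma taylor_germ_at:
  assumes "has_expansion f b c" shows "taylor b (germ_at b f) = c"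
  unfolding taylor_def
proof (rule the_equality)
  show "\<exists>g. germ_at b f = germ_at b g \<and> has_expansion g b c" using assms by blast
  fix d assume "\<exists>g. germ_at b f = germ_at b g \<and> has_expansion g b d"
  then obtain g where "eventually (\<lambda>t. f t = g t) (nhds b)" "has_expansion g b d"
    by (auto simp: germ_at_eq_iff)
  then show "d = c" using has_expansion_unique[OF assms] by blast
qed

lemma hol_at_const: "hol_at (\<lambda>_. k) b"
  unfolding hol_at_def by (rule exI, rule has_expansion_const)

lemma hol_at_add: "hol_at f b \<Longrightarrow> hol_at g b \<Longrightarrow> hol_at (\<lambda>t. f t + g t) b"
  unfolding hol_at_def by (elim exE, rule exI, rule has_expansion_add)

lemma hol_at_mult: "hol_at f b \<Longrightarrow> hol_at g b \<Longrightarrow> hol_at (\<lambda>t. f t * g t) b"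
  unfolding hol_at_def by (elim exE, rule exI, rule has_expansion_mult)

lemma hol_at_polyfun:
  assumes "f \<in> polyfun T" "\<And>j. hol_at (\<lambda>t. \<Phi> t $ j) b"
  shows "hol_at (\<lambda>t. f (\<Phi> t)) b"
  using assms by (induction) (auto intro: hol_at_const hol_at_add hol_at_mult)

section \<open>Least spaces\<close>

text \<open>The germs for which \<open>taylor\<close> is meaningful: the type of germs also contains
  those of functions without an expansion.\<close>

definition hol_germ :: "complex ^ 'n \<Rightarrow> (complex ^ 'n) germ \<Rightarrow> bool"
  where "hol_germ b g \<longleftrightarrow> (\<exists>f c. g = germ_at b f \<and> has_expansion f b c)"

lemma hol_germE:
  assumes "hol_germ b g"
  obtains f where "g = germ_at b f" "has_expansion f b (taylor b g)"
proof -
  obtain f c where "g = germ_at b f" "has_expansion f b c"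
    using assms unfolding hol_germ_def by blast
  then show ?thesis using that taylor_germ_at by metis
qed

lemma taylor_lincomb:
  assumes "\<And>i. i \<in> I \<Longrightarrow> hol_germ b (g i)"
  shows "taylor b (\<Sum>i\<in>I. germ_scale (k i) (g i)) \<nu> = (\<Sum>i\<in>I. k i * taylor b (g i) \<nu>)"
proof -
  have "\<exists>f. i \<in> I \<longrightarrow> g i = germ_at b f \<and> has_expansion f b (taylor b (g i))" for i
    using hol_germE[OF assms] by blast
  then obtain f where f: "\<And>i. i \<in> I \<Longrightarrow> g i = germ_at b (f i) \<and> has_expansion (f i) b (taylor b (g i))"
    by metis
  have eq: "(\<Sum>i\<in>I. germ_scale (k i) (g i)) = germ_at b (\<lambda>t. \<Sum>i\<in>I. k i * f i t)"
    using f by (simp add: germ_at_sum germ_at_scale)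
  have ex: "has_expansion (\<lambda>t. \<Sum>i\<in>I. k i * f i t) b (\<lambda>\<nu>. \<Sum>i\<in>I. k i * taylor b (g i) \<nu>)"
    using f by (intro has_expansion_sum has_expansion_mult_left) blast
  show ?thesis unfolding eq taylor_germ_at[OF ex] ..
qed

lemma taylor_zero: "taylor b 0 \<nu> = 0"
  using taylor_germ_at[OF has_expansion_zero[of b]] by (simp add: germ_at_zero)

lemma taylor_eq_0_imp:
  assumes "hol_germ b g" "\<And>\<nu>. taylor b g \<nu> = 0" shows "g = 0"
proof -
  obtain f where f: "g = germ_at b f" "has_expansion f b (taylor b g)" by (rule hol_germE[OF assms(1)])
  have "taylor b g = (\<lambda>_. 0)" using assms(2) by (simp add: fun_eq_iff)
  then show ?thesis
    using f has_expansion_eventually_0[of f b] by (simp add: germ_at_eq_0_iff)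
qed

lemma lookup_sum_single_weight:
  fixes c :: "nat ^ 'n::finite \<Rightarrow> complex"
  shows "Poly_Mapping.lookup (\<Sum>\<nu> | weight \<nu> = k. Poly_Mapping.single \<nu> (c \<nu>)) \<mu> = (if weight \<mu> = k then c \<mu> else 0)"
  by (simp add: lookup_sum lookup_single when_def)

lemma least_form_order:
  assumes "hol_germ b g" "g \<noteq> 0"
  shows "\<exists>k. (\<forall>\<nu>. weight \<nu> < k \<longrightarrow> taylor b g \<nu> = 0) \<and>
    (\<forall>\<nu>. Poly_Mapping.lookup (least_form b g) \<nu> = (if weight \<nu> = k then taylor b g \<nu> else 0)) \<and>
    (\<exists>\<nu>. weight \<nu> = k \<and> taylor b g \<nu> \<noteq> 0)"
proof -
  define k where "k = (LEAST k. \<exists>\<nu>. weight \<nu> = k \<and> taylor b g \<nu> \<noteq> 0)"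
  have "\<exists>k \<nu>. weight \<nu> = k \<and> taylor b g \<nu> \<noteq> 0"
    using taylor_eq_0_imp[OF assms(1)] assms(2) by blast
  then have "\<exists>\<nu>. weight \<nu> = k \<and> taylor b g \<nu> \<noteq> 0" unfolding k_def by (rule LeastI_ex)
  moreover have "taylor b g \<nu> = 0" if "weight \<nu> < k" for \<nu>
    using not_less_Least[OF that[unfolded k_def]] by blast
  moreover have "least_form b g = (\<Sum>\<nu> | weight \<nu> = k. Poly_Mapping.single \<nu> (taylor b g \<nu>))"
    using assms(2) by (simp add: least_form_def Let_def k_def)
  then have "Poly_Mapping.lookup (least_form b g) \<nu> = (if weight \<nu> = k then taylor b g \<nu> else 0)" for \<nu>
    using lookup_sum_single_weight[of "taylor b g" k \<nu>] by simp
  ultimately show ?thesis by blast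
qed

text \<open>In a vanishing linear combination of germs the least forms of smallest order cancel.\<close>

lemma independent_least_forms:
  assumes B: "finite B" "mp.independent B"
    and g: "\<And>\<beta>. \<beta> \<in> B \<Longrightarrow> hol_germ b (g \<beta>) \<and> least_form b (g \<beta>) = \<beta>"
    and 0: "(\<Sum>\<beta>\<in>B. germ_scale (k \<beta>) (g \<beta>)) = 0"
  shows "\<forall>\<beta>\<in>B. k \<beta> = 0"
proof (rule ccontr)
  assume "\<not> ?thesis"
  then have ne: "{\<beta> \<in> B. k \<beta> \<noteq> 0} \<noteq> {}" by blast
  have "\<exists>m. \<beta> \<in> B \<longrightarrow> (\<forall>\<nu>. weight \<nu> < m \<longrightarrow> taylor b (g \<beta>) \<nu> = 0) \<and>
    (\<forall>\<nu>. Poly_Mapping.lookup \<beta> \<nu> = (if weight \<nu> = m then taylor b (g \<beta>) \<nu> else 0))" for \<beta>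
  proof (cases "\<beta> \<in> B")
    case True
    have "\<beta> \<noteq> 0" using B(2) True mp.dependent_zero by blast
    then have "g \<beta> \<noteq> 0" using g[OF True] by (auto simp: least_form_def)
    then show ?thesis using least_form_order[of b "g \<beta>"] g[OF True] by auto
  qed simp
  then obtain ord where ord: "\<And>\<beta> \<nu>. \<beta> \<in> B \<Longrightarrow> weight \<nu> < ord \<beta> \<Longrightarrow> taylor b (g \<beta>) \<nu> = 0"
    "\<And>\<beta> \<nu>. \<beta> \<in> B \<Longrightarrow> Poly_Mapping.lookup \<beta> \<nu> = (if weight \<nu> = ord \<beta> then taylor b (g \<beta>) \<nu> else 0)"
    by metis
  define l where "l = Min (ord ` {\<beta> \<in> B. k \<beta> \<noteq> 0})"
  have "l \<in> ord ` {\<beta> \<in> B. k \<beta> \<noteq> 0}" unfolding l_def using B(1) ne by (intro Min_in) auto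
  then obtain \<beta>0 where \<beta>0: "\<beta>0 \<in> B" "k \<beta>0 \<noteq> 0" "ord \<beta>0 = l" by blast
  have l: "l \<le> ord \<beta>" if "\<beta> \<in> B" "k \<beta> \<noteq> 0" for \<beta>
    unfolding l_def using B(1) that by (intro Min_le) auto
  \<comment> \<open>In weight \<open>l\<close> the germs of higher order contribute nothing, so the
    given relation becomes one among the least forms of order \<open>l\<close>.\<close>
  define u where "u \<beta> = (if ord \<beta> = l then k \<beta> else 0)" for \<beta>
  have "(\<Sum>\<beta>\<in>B. mp_scale (u \<beta>) \<beta>) = 0"
  proof (rule poly_mapping_eqI)
    fix \<nu>
    have "(\<Sum>\<beta>\<in>B. u \<beta> * Poly_Mapping.lookup \<beta> \<nu>) = 0"
    proof (cases "weight \<nu> = l")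
      case True
      have "(\<Sum>\<beta>\<in>B. u \<beta> * Poly_Mapping.lookup \<beta> \<nu>) = (\<Sum>\<beta>\<in>B. k \<beta> * taylor b (g \<beta>) \<nu>)"
      proof (rule sum.cong[OF refl])
        fix \<beta> assume \<beta>: "\<beta> \<in> B"
        show "u \<beta> * Poly_Mapping.lookup \<beta> \<nu> = k \<beta> * taylor b (g \<beta>) \<nu>"
          using ord[OF \<beta>, of \<nu>] l[OF \<beta>] True by (cases "k \<beta> = 0"; cases "ord \<beta> = l") (auto simp: u_def)
      qed
      also have "\<dots> = taylor b (\<Sum>\<beta>\<in>B. germ_scale (k \<beta>) (g \<beta>)) \<nu>"
        using taylor_lincomb[of B b g k \<nu>] g by simp
      finally show ?thesis using 0 by (simp add: taylor_zero)
    next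
      case False
      have "u \<beta> * Poly_Mapping.lookup \<beta> \<nu> = 0" if "\<beta> \<in> B" for \<beta>
        using ord(2)[OF that, of \<nu>] False by (simp add: u_def)
      then show ?thesis by (intro sum.neutral) blast
    qed
    then show "Poly_Mapping.lookup (\<Sum>\<beta>\<in>B. mp_scale (u \<beta>) \<beta>) \<nu> = Poly_Mapping.lookup 0 \<nu>"
      by (simp add: lookup_sum lookup_mp_scale)
  qed
  then have "u \<beta>0 = 0"
    using mp.independentD[OF B(2) B(1) order_refl, of u \<beta>0] \<beta>0(1) by blast
  then show False using \<beta>0 by (simp add: u_def)
qed

section \<open>Spaces of germs as linear images of polynomial spaces, and their dimensions\<close>

definition pullback_germ :: "(complex ^ 'n \<Rightarrow> complex ^ 'm) \<Rightarrow> complex ^ 'n \<Rightarrow> 'm mpoly \<Rightarrow> (complex ^ 'n) germ"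
  where "pullback_germ \<Phi> b p = germ_at b (\<lambda>t. mp_eval p (\<Phi> t))"

lemma pullback_polys_eq: "pullback_polys \<Phi> b d = pullback_germ \<Phi> b ` polys_upto d"
  by (simp add: pullback_polys_def pullback_germ_def)

lemma linear_pullback_germ: "Vector_Spaces.linear mp_scale germ_scale (pullback_germ \<Phi> b)"
  by unfold_locales
    (simp_all add: pullback_germ_def mp_eval_add mp_eval_scale germ_at_add germ_at_scale)

lemma linear_image_polys_upto_span:
  assumes "Vector_Spaces.linear mp_scale germ_scale f"
  shows "f ` polys_upto d = germ.span ((\<lambda>\<nu>. f (Poly_Mapping.single \<nu> 1)) ` {\<nu>. weight \<nu> \<le> d})"
proof -
  interpret f: Vector_Spaces.linear mp_scale germ_scale f by (rule assms)
  show ?thesis unfolding polys_upto_eq_span f.span_image[symmetric] image_image ..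
qed

text \<open>On these polynomials \<open>f\<close> factors through \<open>g\<close>: preimages of a
  basis of the image of \<open>f\<close> are sent by \<open>g\<close> to an independent
  family.\<close>

lemma dim_linear_image_le:
  assumes f: "Vector_Spaces.linear mp_scale germ_scale f" and g: "Vector_Spaces.linear mp_scale germ_scale g"
    and ker: "\<And>p. p \<in> polys_upto d \<Longrightarrow> g p = 0 \<Longrightarrow> f p = 0"
  shows "germ.dim (f ` polys_upto d) \<le> germ.dim (g ` polys_upto d)"
proof -
  interpret f: Vector_Spaces.linear mp_scale germ_scale f by (rule f)
  interpret g: Vector_Spaces.linear mp_scale germ_scale g by (rule g)
  obtain B where B: "B \<subseteq> f ` polys_upto d" "germ.independent B" "card B = germ.dim (f ` polys_upto d)"
    using germ.basis_exists by metis
  have finB: "finite B"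
    using germ.independent_span_bound[OF _ B(2), of "(\<lambda>\<nu>. f (Poly_Mapping.single \<nu> 1)) ` {\<nu>. weight \<nu> \<le> d}"]
      B(1) linear_image_polys_upto_span[OF f, of d] by simp
  have "\<exists>p. \<beta> \<in> B \<longrightarrow> p \<in> polys_upto d \<and> f p = \<beta>" for \<beta> using B(1) by blast
  then obtain u where u: "\<And>\<beta>. \<beta> \<in> B \<Longrightarrow> u \<beta> \<in> polys_upto d \<and> f (u \<beta>) = \<beta>" by metis
  have "card B \<le> germ.dim (g ` polys_upto d)"
  proof (rule germ.card_independent_family_le_dim[where f = "\<lambda>\<beta>. g (u \<beta>)", OF finB])
    show "finite ((\<lambda>\<nu>. g (Poly_Mapping.single \<nu> 1)) ` {\<nu>. weight \<nu> \<le> d})" by simp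
    show "g ` polys_upto d \<subseteq> germ.span ((\<lambda>\<nu>. g (Poly_Mapping.single \<nu> 1)) ` {\<nu>. weight \<nu> \<le> d})"
      by (simp only: linear_image_polys_upto_span[OF g] order_refl)
    show "g (u \<beta>) \<in> g ` polys_upto d" if "\<beta> \<in> B" for \<beta> using u that by blast
    fix k assume k: "(\<Sum>\<beta>\<in>B. germ_scale (k \<beta>) (g (u \<beta>))) = 0"
    have "(\<Sum>\<beta>\<in>B. mp_scale (k \<beta>) (u \<beta>)) \<in> polys_upto d"
      using u by (intro mp.subspace_sum[OF subspace_polys_upto] mp.subspace_scale[OF subspace_polys_upto]) blast
    moreover have "g (\<Sum>\<beta>\<in>B. mp_scale (k \<beta>) (u \<beta>)) = 0"
      using k by (simp add: g.sum g.scale)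
    ultimately have "f (\<Sum>\<beta>\<in>B. mp_scale (k \<beta>) (u \<beta>)) = 0" by (rule ker)
    then have "(\<Sum>\<beta>\<in>B. germ_scale (k \<beta>) \<beta>) = 0"
      using u by (simp add: f.sum f.scale)
    then show "\<forall>\<beta>\<in>B. k \<beta> = 0"
      using germ.independentD[OF B(2) finB order_refl] by blast
  qed
  then show ?thesis using B(3) by simp
qed

lemma dim_linear_image_polys_upto_le:
  fixes f :: "'m::finite mpoly \<Rightarrow> 'a::real_normed_vector germ"
  assumes f: "Vector_Spaces.linear mp_scale germ_scale f"
  shows "germ.dim (f ` polys_upto d) \<le> (CARD('m) + d) choose CARD('m)"
proof -
  have "germ.dim (f ` polys_upto d) \<le> card ((\<lambda>\<nu>. f (Poly_Mapping.single \<nu> 1)) ` {\<nu>. weight \<nu> \<le> d})"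
    by (rule germ.dim_le_card) (simp_all add: linear_image_polys_upto_span[OF f])
  also have "\<dots> \<le> card {\<nu> :: nat ^ 'm. weight \<nu> \<le> d}" by (rule card_image_le) simp
  finally show ?thesis by (simp add: card_weight_le)
qed

lemma hol_germ_pullback_germ:
  assumes "\<And>j. hol_at (\<lambda>t. \<Phi> t $ j) b"
  shows "hol_germ b (pullback_germ \<Phi> b p)"
  using hol_at_polyfun[OF polyfun_mp_eval assms] unfolding hol_germ_def pullback_germ_def hol_at_def
  by blast

text \<open>Taking least forms is not linear, so the least space is no linear image of the
  pullbacks. A basis is chosen among the least forms themselves; germs realising it are independent,
  which bounds every finite independent set of least forms and so makes the basis finite.\<close>

lemma least_space_basis:
  assumes hol: "\<And>j. hol_at (\<lambda>t. \<Phi> t $ j) b"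
  shows "\<exists>B. finite B \<and> card B \<le> germ.dim (pullback_polys \<Phi> b d) \<and> least_space \<Phi> b d = mp.span B"
proof -
  let ?P = "pullback_polys \<Phi> b d"
  have card: "card B \<le> germ.dim ?P" if B: "finite B" "mp.independent B" "B \<subseteq> least_form b ` ?P" for B
  proof -
    have "\<exists>g. \<beta> \<in> B \<longrightarrow> g \<in> ?P \<and> least_form b g = \<beta>" for \<beta> using B(3) by blast
    then obtain g where g: "\<And>\<beta>. \<beta> \<in> B \<Longrightarrow> g \<beta> \<in> ?P \<and> least_form b (g \<beta>) = \<beta>" by metis
    show ?thesis
    proof (rule germ.card_independent_family_le_dim[where f = g, OF B(1)])
      show "finite ((\<lambda>\<nu>. pullback_germ \<Phi> b (Poly_Mapping.single \<nu> 1)) ` {\<nu>. weight \<nu> \<le> d})" by simp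
      show "?P \<subseteq> germ.span ((\<lambda>\<nu>. pullback_germ \<Phi> b (Poly_Mapping.single \<nu> 1)) ` {\<nu>. weight \<nu> \<le> d})"
        unfolding pullback_polys_eq
        by (simp only: linear_image_polys_upto_span[OF linear_pullback_germ] order_refl)
      show "g \<beta> \<in> ?P" if "\<beta> \<in> B" for \<beta> using g that by blast
      fix k assume k: "(\<Sum>\<beta>\<in>B. germ_scale (k \<beta>) (g \<beta>)) = 0"
      show "\<forall>\<beta>\<in>B. k \<beta> = 0"
      proof (rule independent_least_forms[OF B(1,2) _ k])
        show "hol_germ b (g \<beta>) \<and> least_form b (g \<beta>) = \<beta>" if "\<beta> \<in> B" for \<beta>
          using g[OF that] hol_germ_pullback_germ[of \<Phi> b, OF hol] by (auto simp: pullback_polys_eq)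
      qed
    qed
  qed
  obtain B where B: "B \<subseteq> least_form b ` ?P" "mp.independent B" "least_form b ` ?P \<subseteq> mp.span B"
    using mp.maximal_independent_subset by metis
  have "finite B"
  proof (rule ccontr)
    assume "infinite B"
    then obtain B' where B': "finite B'" "card B' = Suc (germ.dim ?P)" "B' \<subseteq> B"
      using infinite_arbitrarily_large by metis
    then have "card B' \<le> germ.dim ?P"
      using B by (intro card mp.independent_mono[OF B(2)]) auto
    then show False using B' by simp
  qed
  moreover have "least_space \<Phi> b d = mp.span B"
    unfolding least_space_def
  proof (rule antisym)
    show "mp.span (least_form b ` ?P) \<subseteq> mp.span B"
      using mp.span_minimal[OF B(3)] by simp
    show "mp.span B \<subseteq> mp.span (least_form b ` ?P)" by (rule mp.span_mono[OF B(1)])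
  qed
  ultimately show ?thesis using card[OF _ B(2,1)] by blast
qed

text \<open>Expresses that the least form is the monomial with exponent \<open>\<nu>\<close> and
  coefficient 1, as a condition on coefficients that passes to Cauchy products.\<close>

definition leading_exponent :: "(nat ^ 'n \<Rightarrow> complex) \<Rightarrow> nat ^ 'n \<Rightarrow> bool"
  where "leading_exponent c \<nu> \<longleftrightarrow> (\<forall>\<kappa>. weight \<kappa> \<le> weight \<nu> \<longrightarrow> c \<kappa> = (if \<kappa> = \<nu> then 1 else 0))"

lemma leading_exponent_cauchy_prod:
  fixes c d :: "nat ^ 'n \<Rightarrow> complex"
  assumes c: "leading_exponent c \<nu>" and d: "leading_exponent d \<mu>"
  shows "leading_exponent (cauchy_prod c d) (\<nu> + \<mu>)"
  unfolding leading_exponent_def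
proof (intro allI impI)
  fix \<kappa> :: "nat ^ 'n" assume \<kappa>: "weight \<kappa> \<le> weight (\<nu> + \<mu>)"
  have "c (fst p) * d (snd p) = (if p = (\<nu>, \<mu>) then 1 else 0)" if p: "fst p + snd p = \<kappa>" for p
  proof -
    have w: "weight (fst p) + weight (snd p) \<le> weight \<nu> + weight \<mu>"
      using \<kappa> unfolding p[symmetric] weight_add by simp
    consider "weight (fst p) < weight \<nu>" | "weight (snd p) < weight \<mu>"
      | "weight (fst p) = weight \<nu>" "weight (snd p) = weight \<mu>" using w by linarith
    then show ?thesis
    proof cases
      case 1
      then have "c (fst p) = 0" using c by (auto simp: leading_exponent_def)
      then show ?thesis using 1 by auto
    next
      case 2
      then have "d (snd p) = 0" using d by (auto simp: leading_exponent_def)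
      then show ?thesis using 2 by auto
    next
      case 3
      then have "c (fst p) = (if fst p = \<nu> then 1 else 0)" "d (snd p) = (if snd p = \<mu> then 1 else 0)"
        using c d by (auto simp: leading_exponent_def)
      then show ?thesis by (auto simp: prod_eq_iff)
    qed
  qed
  then have "cauchy_prod c d \<kappa> = (\<Sum>p | fst p + snd p = \<kappa>. if p = (\<nu>, \<mu>) then 1 else 0)"
    unfolding cauchy_prod_def by (intro sum.cong) auto
  also have "\<dots> = (if \<kappa> = \<nu> + \<mu> then 1 else 0)"
    by (simp add: finite_exponent_pairs)
  finally show "cauchy_prod c d \<kappa> = (if \<kappa> = \<nu> + \<mu> then 1 else 0)" .
qed

lemma least_form_leading_exponent:
  assumes "has_expansion f b c" "leading_exponent c \<nu>"
  shows "least_form b (germ_at b f) = Poly_Mapping.single \<nu> 1"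
proof -
  have c: "c \<kappa> = (if \<kappa> = \<nu> then 1 else 0)" if "weight \<kappa> \<le> weight \<nu>" for \<kappa>
    using assms(2) that by (simp add: leading_exponent_def)
  have "germ_at b f \<noteq> 0"
  proof
    assume "germ_at b f = 0"
    then have "c \<nu> = 0" using has_expansion_zero_unique[OF assms(1)] by (simp add: germ_at_eq_0_iff)
    then show False using c[of \<nu>] by simp
  qed
  moreover have "(LEAST k. \<exists>\<nu>. weight \<nu> = k \<and> c \<nu> \<noteq> 0) = weight \<nu>"
  proof (rule Least_equality)
    show "\<exists>\<nu>'. weight \<nu>' = weight \<nu> \<and> c \<nu>' \<noteq> 0" using c[of \<nu>] by (intro exI[of _ \<nu>]) simp
    fix k assume "\<exists>\<nu>. weight \<nu> = k \<and> c \<nu> \<noteq> 0"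
    then obtain \<kappa> where \<kappa>: "weight \<kappa> = k" "c \<kappa> \<noteq> 0" by blast
    show "weight \<nu> \<le> k"
    proof (rule ccontr)
      assume "\<not> weight \<nu> \<le> k"
      then show False using c[of \<kappa>] \<kappa> by (auto split: if_splits)
    qed
  qed
  ultimately have "least_form b (germ_at b f) = (\<Sum>\<kappa> | weight \<kappa> = weight \<nu>. Poly_Mapping.single \<kappa> (c \<kappa>))"
    by (simp add: least_form_def taylor_germ_at[OF assms(1)] Let_def)
  also have "\<dots> = Poly_Mapping.single \<nu> 1"
  proof (rule poly_mapping_eqI)
    fix \<kappa>
    show "Poly_Mapping.lookup (\<Sum>\<kappa> | weight \<kappa> = weight \<nu>. Poly_Mapping.single \<kappa> (c \<kappa>)) \<kappa>
        = Poly_Mapping.lookup (Poly_Mapping.single \<nu> 1) \<kappa>"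
      unfolding lookup_sum_single_weight using c[of \<kappa>] by (auto simp: lookup_single when_def)
  qed
  finally show ?thesis .
qed

text \<open>By \<open>imm\<close>, each parameter is to first order an affine function of the
  coordinates of \<open>\<Phi>\<close>. A product of \<open>weight \<nu>\<close> of these functions
  has degree at most \<open>weight \<nu>\<close> and least form exactly the monomial
  \<open>\<nu>\<close>.\<close>

lemma single_in_least_space:
  fixes \<Phi> :: "complex ^ 'n \<Rightarrow> complex ^ 'm"
  assumes imm: "\<And>i. \<exists>p\<in>polys_upto 1. \<exists>c. has_expansion (\<lambda>t. mp_eval p (\<Phi> t)) b c \<and> leading_exponent c (axis i 1)"
    and "weight \<nu> \<le> d"
  shows "Poly_Mapping.single \<nu> 1 \<in> least_space \<Phi> b d"
proof -
  have "\<exists>p\<in>polys_upto (weight \<nu>). \<exists>c. has_expansion (\<lambda>t. mp_eval p (\<Phi> t)) b c \<and> leading_exponent c \<nu>" for \<nu>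
  proof (induction "weight \<nu>" arbitrary: \<nu>)
    case 0
    then have \<nu>: "\<nu> = 0" by simp
    have "has_expansion (\<lambda>t. mp_eval 1 (\<Phi> t)) b (\<lambda>\<nu>. if \<nu> = 0 then 1 else 0)"
      using has_expansion_const[of 1 b] by (simp flip: single_one)
    moreover have "1 \<in> polys_upto (weight \<nu>)" by (simp add: polys_upto_def)
    ultimately show ?case by (fastforce simp: \<nu> leading_exponent_def)
  next
    case (Suc k)
    then have "\<nu> \<noteq> 0" by auto
    then obtain i where i: "\<nu> $ i \<noteq> 0" by (auto simp: vec_eq_iff)
    define \<kappa> where "\<kappa> = \<nu> - axis i 1"
    have \<nu>: "\<nu> = axis i 1 + \<kappa>" using i by (auto simp: \<kappa>_def vec_eq_iff axis_def)
    then have "k = weight \<kappa>" using Suc(2) by (simp add: weight_add)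
    from Suc(1)[OF this] obtain p c where p: "p \<in> polys_upto (weight \<kappa>)"
      "has_expansion (\<lambda>t. mp_eval p (\<Phi> t)) b c" "leading_exponent c \<kappa>" by blast
    from imm[of i] obtain q d where q: "q \<in> polys_upto 1"
      "has_expansion (\<lambda>t. mp_eval q (\<Phi> t)) b d" "leading_exponent d (axis i 1)" by blast
    have "q * p \<in> polys_upto (weight \<nu>)"
      using polys_upto_mult[OF q(1) p(1)] by (simp add: \<nu> weight_add)
    moreover have "has_expansion (\<lambda>t. mp_eval (q * p) (\<Phi> t)) b (cauchy_prod d c)"
      unfolding mp_eval_mult by (rule has_expansion_mult[OF q(2) p(2)])
    moreover have "leading_exponent (cauchy_prod d c) \<nu>"
      unfolding \<nu> by (rule leading_exponent_cauchy_prod[OF q(3) p(3)])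
    ultimately show ?case by blast
  qed
  from this[of \<nu>] obtain p c where p: "p \<in> polys_upto (weight \<nu>)"
    "has_expansion (\<lambda>t. mp_eval p (\<Phi> t)) b c" "leading_exponent c \<nu>" by blast
  have "pullback_germ \<Phi> b p \<in> pullback_polys \<Phi> b d"
    using p(1) polys_upto_mono[OF assms(2)] by (auto simp: pullback_polys_eq)
  then have "least_form b (pullback_germ \<Phi> b p) \<in> least_space \<Phi> b d"
    unfolding least_space_def by (intro mp.span_base imageI)
  then show ?thesis
    unfolding pullback_germ_def least_form_leading_exponent[OF p(2,3)] .
qed

section \<open>Derivatives, degrees and the dimension bound\<close>

lemma lookup_mp_deriv:
  "Poly_Mapping.lookup (mp_deriv i p) \<kappa> = of_nat (\<kappa> $ i + 1) * Poly_Mapping.lookup p (\<kappa> + axis i 1)"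
proof -
  have iff: "\<nu> - axis i 1 = \<kappa> \<longleftrightarrow> \<nu> = \<kappa> + axis i 1" if "\<nu> $ i \<noteq> 0" for \<nu> :: "nat ^ 'a"
    using that by (auto simp: vec_eq_iff axis_def)
  have "Poly_Mapping.lookup (mp_deriv i p) \<kappa> = (\<Sum>\<nu>\<in>Poly_Mapping.keys p.
      if \<nu> = \<kappa> + axis i 1 then of_nat (\<nu> $ i) * Poly_Mapping.lookup p \<nu> else 0)"
    unfolding mp_deriv_def lookup_sum
  proof (rule sum.cong[OF refl])
    fix \<nu>
    show "Poly_Mapping.lookup (Poly_Mapping.single (\<nu> - axis i 1) (of_nat (\<nu> $ i) * Poly_Mapping.lookup p \<nu>)) \<kappa>
        = (if \<nu> = \<kappa> + axis i 1 then of_nat (\<nu> $ i) * Poly_Mapping.lookup p \<nu> else 0)"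
      using iff[of \<nu>] by (cases "\<nu> $ i = 0") (auto simp: lookup_single when_def)
  qed
  then show ?thesis by (simp add: in_keys_iff axis_def)
qed

lemma mp_degree_iff:
  assumes "p \<noteq> 0"
  shows "mp_degree p = k \<longleftrightarrow> p \<in> polys_upto k \<and> (\<exists>\<nu>\<in>Poly_Mapping.keys p. weight \<nu> = k)"
proof -
  have ne: "weight ` Poly_Mapping.keys p \<noteq> {}" using assms by auto
  show ?thesis
    unfolding mp_degree_def polys_upto_def using Max_eq_iff[OF finite_imageI[OF finite_keys] ne, of k]
    by auto
qed

text \<open>Differentiating by a variable that occurs in a monomial of top degree lowers the degree
  by exactly one: that monomial is only multiplied by a positive integer, and no other monomial has
  the same derivative exponent.\<close>

lemma D_invariant_degree_below:
  assumes D: "D_invariant \<Phi> b d" and p: "p \<in> least_space \<Phi> b d" "p \<noteq> 0" "mp_degree p = Suc k"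
  shows "\<exists>q\<in>least_space \<Phi> b d. q \<noteq> 0 \<and> mp_degree q = k"
proof -
  have "p \<in> polys_upto (Suc k)" using p mp_degree_iff by blast
  obtain \<nu> where \<nu>: "\<nu> \<in> Poly_Mapping.keys p" "weight \<nu> = Suc k" using p mp_degree_iff by blast
  then have "\<nu> \<noteq> 0" by auto
  then obtain i where i: "\<nu> $ i \<noteq> 0" by (auto simp: vec_eq_iff)
  define \<kappa> where "\<kappa> = \<nu> - axis i 1"
  have \<nu>\<kappa>: "\<nu> = \<kappa> + axis i 1" using i by (auto simp: \<kappa>_def vec_eq_iff axis_def)
  define q where "q = mp_deriv i p"
  have "(of_nat (\<kappa> $ i + 1) :: complex) \<noteq> 0" unfolding of_nat_eq_0_iff by simp
  then have "Poly_Mapping.lookup q \<kappa> \<noteq> 0"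
    using \<nu>(1) unfolding q_def lookup_mp_deriv \<nu>\<kappa>[symmetric] in_keys_iff mult_eq_0_iff by blast
  then have \<kappa>: "\<kappa> \<in> Poly_Mapping.keys q" by (simp add: in_keys_iff)
  then have "q \<noteq> 0" by auto
  moreover have "q \<in> polys_upto k"
    unfolding polys_upto_def
  proof (intro CollectI ballI)
    fix \<mu> assume "\<mu> \<in> Poly_Mapping.keys q"
    then have "\<mu> + axis i 1 \<in> Poly_Mapping.keys p"
      unfolding q_def in_keys_iff lookup_mp_deriv by simp
    then have "weight (\<mu> + axis i 1) \<le> Suc k" using \<open>p \<in> polys_upto (Suc k)\<close> by (auto simp: polys_upto_def)
    then show "weight \<mu> \<le> k" by (simp add: weight_add)
  qed
  moreover have "weight \<kappa> = k" using \<nu>(2) by (simp add: \<nu>\<kappa> weight_add)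
  ultimately have "mp_degree q = k" using \<kappa> mp_degree_iff by blast
  moreover have "q \<in> least_space \<Phi> b d" using D p(1) by (simp add: D_invariant_def q_def)
  ultimately show ?thesis using \<open>q \<noteq> 0\<close> by blast
qed

text \<open>Makes the \<open>Max\<close> in \<open>zero_estimate\<close> a genuine maximum:
  polynomials spanned by a finite set have bounded degree.\<close>

lemma finite_degrees_least_space:
  assumes hol: "\<And>j. hol_at (\<lambda>t. \<Phi> t $ j) b"
  shows "finite (mp_degree ` (least_space \<Phi> b d - {0}))"
proof -
  obtain B where B: "finite B" "least_space \<Phi> b d = mp.span B"
    using least_space_basis[of \<Phi> b d, OF hol] by blast
  obtain e where e: "\<And>p. p \<in> B \<Longrightarrow> p \<in> polys_upto (e p)" using in_polys_upto by metis
  have "p \<in> polys_upto (\<Sum>q\<in>B. e q)" if "p \<in> B" for p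
    using e[OF that] polys_upto_mono[OF member_le_sum[OF that _ B(1), of e]] by blast
  then have sub: "least_space \<Phi> b d \<subseteq> polys_upto (\<Sum>q\<in>B. e q)"
    unfolding B(2) by (intro mp.span_minimal[OF _ subspace_polys_upto]) blast
  have "mp_degree p \<le> (\<Sum>q\<in>B. e q)" if "p \<in> least_space \<Phi> b d - {0}" for p
  proof -
    have "p \<noteq> 0" using that by simp
    from mp_degree_iff[OF this, of "mp_degree p"] obtain \<nu> where
      "\<nu> \<in> Poly_Mapping.keys p" "weight \<nu> = mp_degree p" by blast
    moreover have "p \<in> polys_upto (\<Sum>q\<in>B. e q)" using that sub by blast
    ultimately show ?thesis by (auto simp: polys_upto_def)
  qed
  then have "mp_degree ` (least_space \<Phi> b d - {0}) \<subseteq> {..\<Sum>q\<in>B. e q}"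
    by (intro image_subsetI atMost_iff[THEN iffD2])
  then show ?thesis by (rule finite_subset) simp
qed

lemma independent_single: "mp.independent ((\<lambda>\<nu>. Poly_Mapping.single \<nu> 1) ` A)"
  unfolding mp.dependent_def
proof clarify
  fix \<nu> assume "\<nu> \<in> A" and
    *: "Poly_Mapping.single \<nu> 1 \<in> mp.span ((\<lambda>\<nu>. Poly_Mapping.single \<nu> 1) ` A - {Poly_Mapping.single \<nu> 1})"
  have "mp.span ((\<lambda>\<nu>. Poly_Mapping.single \<nu> 1) ` A - {Poly_Mapping.single \<nu> 1})
      \<subseteq> mp.span ((\<lambda>\<nu>. Poly_Mapping.single \<nu> 1) ` (A - {\<nu>}))"
    by (intro mp.span_mono) auto
  with * have "Poly_Mapping.single \<nu> (1::complex) \<in> {p. Poly_Mapping.keys p \<subseteq> A - {\<nu>}}"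
    unfolding mp_span_single by blast
  then show False by simp
qed

text \<open>The first conclusion turns the truncated subtraction in the second into a true
  difference. Independence is preserved when a polynomial of each next degree is added, as it
  exceeds the degrees spanned so far.\<close>

theorem D_invariant_dimension_bound:
  fixes \<Phi> :: "complex ^ 'n \<Rightarrow> complex ^ 'm"
  assumes hol: "\<And>j. hol_at (\<lambda>t. \<Phi> t $ j) b"
    and imm: "\<And>i. \<exists>p\<in>polys_upto 1. \<exists>c. has_expansion (\<lambda>t. mp_eval p (\<Phi> t)) b c \<and> leading_exponent c (axis i 1)"
    and D: "D_invariant \<Phi> b d"
  shows "d \<le> zero_estimate \<Phi> b d"
    "((CARD('n) + d) choose CARD('n)) + (zero_estimate \<Phi> b d - d) \<le> germ.dim (pullback_polys \<Phi> b d)"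
proof -
  let ?L = "least_space \<Phi> b d" and ?\<theta> = "zero_estimate \<Phi> b d"
  have fin: "finite (mp_degree ` (?L - {0}))" by (rule finite_degrees_least_space[OF hol])
  \<comment> \<open>A pure power of an arbitrary variable: the type of variables is nonempty, so the
    least space contains a polynomial of degree exactly \<open>d\<close>.\<close>
  define \<nu>0 :: "nat ^ 'n" where "\<nu>0 = axis (SOME i. True) d"
  have \<nu>0: "Poly_Mapping.single \<nu>0 1 \<in> ?L"
    by (rule single_in_least_space[OF imm]) (simp add: \<nu>0_def)
  have s0: "Poly_Mapping.single \<nu>0 (1::complex) \<noteq> 0"
    by (metis keys_single keys_zero insert_not_empty zero_neq_one)
  then have deg0: "mp_degree (Poly_Mapping.single \<nu>0 1) = d"
    by (subst mp_degree_iff) (auto simp: \<nu>0_def polys_upto_def)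
  have "d \<in> mp_degree ` (?L - {0})" using \<nu>0 s0 deg0 by (intro image_eqI[of _ _ "Poly_Mapping.single \<nu>0 1"]) auto
  then show d\<theta>: "d \<le> ?\<theta>"
    unfolding zero_estimate_def by (rule Max_ge[OF fin])
  have \<theta>: "?\<theta> \<in> mp_degree ` (?L - {0})"
    unfolding zero_estimate_def using \<open>d \<in> _\<close> by (intro Max_in[OF fin]) blast
  have below: "\<exists>q\<in>?L. q \<noteq> 0 \<and> mp_degree q = ?\<theta> - j" if "j \<le> ?\<theta>" for j
    using that
  proof (induction j)
    case 0
    then show ?case using \<theta> by auto
  next
    case (Suc j)
    then obtain q where q: "q \<in> ?L" "q \<noteq> 0" "mp_degree q = Suc (?\<theta> - Suc j)" by fastforce
    show ?case by (rule D_invariant_degree_below[OF D q])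
  qed
  have step: "\<exists>B. finite B \<and> mp.independent B \<and> B \<subseteq> ?L \<and> B \<subseteq> polys_upto (d + j) \<and>
      card B = ((CARD('n) + d) choose CARD('n)) + j" if "d + j \<le> ?\<theta>" for j
    using that
  proof (induction j)
    case 0
    let ?B = "(\<lambda>\<nu>. Poly_Mapping.single \<nu> 1) ` {\<nu> :: nat ^ 'n. weight \<nu> \<le> d} :: 'n mpoly set"
    have "inj_on (\<lambda>\<nu>. Poly_Mapping.single \<nu> (1::complex)) {\<nu> :: nat ^ 'n. weight \<nu> \<le> d}"
      by (rule inj_onI) (metis keys_single singleton_inject zero_neq_one)
    then have "card ?B = (CARD('n) + d) choose CARD('n)"
      by (simp add: card_image card_weight_le)
    moreover have "?B \<subseteq> ?L" using single_in_least_space[OF imm] by blast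
    moreover have "?B \<subseteq> polys_upto (d + 0)" by (auto simp: polys_upto_def)
    moreover have "mp.independent ?B" by (rule independent_single)
    ultimately show ?case by (intro exI[of _ ?B]) simp
  next
    case (Suc j)
    then obtain B where B: "finite B" "mp.independent B" "B \<subseteq> ?L" "B \<subseteq> polys_upto (d + j)"
      "card B = ((CARD('n) + d) choose CARD('n)) + j" by auto
    obtain q where q: "q \<in> ?L" "q \<noteq> 0" "mp_degree q = d + Suc j"
      using below[of "?\<theta> - (d + Suc j)"] Suc.prems by auto
    then have q': "q \<in> polys_upto (d + Suc j)" "\<exists>\<nu>\<in>Poly_Mapping.keys q. weight \<nu> = d + Suc j"
      using mp_degree_iff by blast+
    have "q \<notin> polys_upto (d + j)"
    proof
      assume "q \<in> polys_upto (d + j)"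
      then have "weight \<nu> \<le> d + j" if "\<nu> \<in> Poly_Mapping.keys q" for \<nu>
        using that by (simp add: polys_upto_def)
      then show False using q'(2) by fastforce
    qed
    moreover have "mp.span B \<subseteq> polys_upto (d + j)" by (rule mp.span_minimal[OF B(4) subspace_polys_upto])
    ultimately have q_span: "q \<notin> mp.span B" by blast
    then have "mp.independent (insert q B)" by (rule mp.independent_insertI[OF _ B(2)])
    moreover have "q \<notin> B" using q_span mp.span_base[of q B] by blast
    moreover have "insert q B \<subseteq> polys_upto (d + Suc j)"
      using q'(1) B(4) polys_upto_mono[of "d + j" "d + Suc j"] by auto
    ultimately show ?case
      using B q(1) by (intro exI[of _ "insert q B"]) auto
  qed
  obtain B where B: "mp.independent B" "B \<subseteq> ?L" "card B = ((CARD('n) + d) choose CARD('n)) + (?\<theta> - d)"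
    using step[of "?\<theta> - d"] d\<theta> by auto
  obtain B' where B': "finite B'" "card B' \<le> germ.dim (pullback_polys \<Phi> b d)" "?L = mp.span B'"
    using least_space_basis[of \<Phi> b d, OF hol] by blast
  have "card B \<le> card B'"
    using mp.independent_span_bound[OF B'(1) B(1)] B(2) B'(3) by simp
  then show "((CARD('n) + d) choose CARD('n)) + (?\<theta> - d) \<le> germ.dim (pullback_polys \<Phi> b d)"
    using B(3) B'(2) by simp
qed

section \<open>Local parametrisations\<close>

lemma local_parametrisation_hol_at:
  assumes "local_parametrisation X a \<Phi> b"
  shows "hol_at (\<lambda>t. \<Phi> t $ j) b"
  using assms unfolding local_parametrisation_def hol_map_on_def by blast

lemma sum_weight_1:
  fixes f :: "nat ^ 'n::finite \<Rightarrow> complex"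
  shows "(\<Sum>\<nu> | weight \<nu> = 1. f \<nu>) = (\<Sum>i\<in>UNIV. f (axis i 1))"
proof -
  have eq: "{\<nu> :: nat ^ 'n. weight \<nu> = 1} = range (\<lambda>i. axis i 1)"
  proof (intro equalityI subsetI)
    fix \<nu> :: "nat ^ 'n" assume "\<nu> \<in> {\<nu>. weight \<nu> = 1}"
    then show "\<nu> \<in> range (\<lambda>i. axis i 1)" by (elim CollectE weight_eq_1E) simp
  qed auto
  have "inj (\<lambda>i :: 'n. axis i (1::nat))" by (rule injI) (simp add: axis_eq_axis)
  then show ?thesis unfolding eq by (simp add: sum.reindex)
qed

text \<open>
  The inverse is Lipschitz at \<open>\<Phi> b\<close>, so \<open>\<Phi>\<close> cannot be stationary along a line through \<open>b\<close>.
\<close>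

lemma left_inverse_imp_injective_derivative:
  fixes \<Phi> :: "complex ^ 'n \<Rightarrow> complex ^ 'm"
  assumes W: "open W" "b \<in> W" "continuous_on W \<Phi>"
    and \<Phi>: "\<And>j. has_expansion (\<lambda>t. \<Phi> t $ j) b (c j)"
    and \<Psi>: "\<And>i. hol_at (\<lambda>x. \<Psi> x $ i) (\<Phi> b)" and inv: "\<And>t. t \<in> W \<Longrightarrow> \<Psi> (\<Phi> t) = t"
    and v: "\<And>j. (\<Sum>\<nu> | weight \<nu> = 1. c j \<nu> * monomial v \<nu>) = 0"
  shows "v = 0"
proof -
  have "v $ i = 0" for i
  proof -
    obtain e where "has_expansion (\<lambda>x. \<Psi> x $ i) (\<Phi> b) e" using \<Psi> unfolding hol_at_def by blast
    from has_expansion_lipschitz[OF this] obtain C \<delta> where C: "\<delta> > 0"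
      "\<And>x. norm (x - \<Phi> b) < \<delta> \<Longrightarrow> cmod (\<Psi> x $ i - \<Psi> (\<Phi> b) $ i) \<le> C * norm (x - \<Phi> b)"
      by blast
    \<comment> \<open>\<open>F s\<close> bounds the norm of the difference quotient of
      \<open>\<Phi>\<close> along \<open>v\<close>. The Lipschitz bound for the inverse gives
      \<open>cmod (v $ i) \<le> \<bar>C\<bar> * F s\<close>, and \<open>F\<close> tends to
      0.\<close>
    define F where "F s = (\<Sum>j\<in>UNIV. cmod ((\<Phi> (b + s *s v) $ j - \<Phi> b $ j) / s))" for s
    have "(F \<longlongrightarrow> 0) (at 0)"
      unfolding F_def
    proof (rule tendsto_null_sum)
      fix j
      have "((\<lambda>s. \<Phi> (b + s *s v) $ j) has_field_derivative 0) (at 0)"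
        using has_expansion_line_deriv[OF \<Phi>[of j], of v] by (simp only: v)
      then have "((\<lambda>s. (\<Phi> (b + s *s v) $ j - \<Phi> b $ j) / s) \<longlongrightarrow> 0) (at 0)"
        by (simp add: DERIV_def)
      then show "((\<lambda>s. cmod ((\<Phi> (b + s *s v) $ j - \<Phi> b $ j) / s)) \<longlongrightarrow> 0) (at 0)"
        by (rule tendsto_norm_zero)
    qed
    then have lim: "((\<lambda>s. \<bar>C\<bar> * F s) \<longlongrightarrow> \<bar>C\<bar> * 0) (at 0)" by (intro tendsto_intros)
    have "(\<Phi> \<longlongrightarrow> \<Phi> b) (nhds b)"
      using W continuous_on_eq_continuous_at[OF W(1), of \<Phi>]
      unfolding tendsto_at_iff_tendsto_nhds[symmetric] isCont_def[symmetric] by blast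
    then have "eventually (\<lambda>t. dist (\<Phi> t) (\<Phi> b) < \<delta>) (nhds b)" using C(1) by (rule tendstoD)
    moreover have "eventually (\<lambda>t. t \<in> W) (nhds b)" using W(1,2) by (rule eventually_nhds_in_open)
    ultimately have "eventually (\<lambda>t. t \<in> W \<and> norm (\<Phi> t - \<Phi> b) < \<delta>) (nhds b)"
      by eventually_elim (simp add: dist_norm)
    from eventually_nhds_line[OF this, of v] obtain \<rho> where \<rho>: "\<rho> > 0"
      "\<And>s. cmod s < \<rho> \<Longrightarrow> b + s *s v \<in> W \<and> norm (\<Phi> (b + s *s v) - \<Phi> b) < \<delta>" by blast
    have "cmod (v $ i) \<le> \<bar>C\<bar> * F s" if s: "s \<noteq> 0" "cmod s < \<rho>" for s
    proof -
      have "cmod s * cmod (v $ i) = cmod (\<Psi> (\<Phi> (b + s *s v)) $ i - \<Psi> (\<Phi> b) $ i)"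
        using inv \<rho>(2)[OF s(2)] W(2) by (simp add: norm_mult)
      also have "\<dots> \<le> C * norm (\<Phi> (b + s *s v) - \<Phi> b)" using C(2) \<rho>(2)[OF s(2)] by blast
      also have "\<dots> \<le> \<bar>C\<bar> * norm (\<Phi> (b + s *s v) - \<Phi> b)" by (rule mult_right_mono) auto
      also have "norm (\<Phi> (b + s *s v) - \<Phi> b) \<le> (\<Sum>j\<in>UNIV. cmod ((\<Phi> (b + s *s v) - \<Phi> b) $ j))"
        unfolding norm_vec_def by (rule L2_set_le_sum) simp
      also have "\<dots> = cmod s * F s"
        using s(1) by (simp add: F_def sum_distrib_left norm_divide)
      finally have "cmod s * cmod (v $ i) \<le> cmod s * (\<bar>C\<bar> * F s)" by (simp add: mult_left_mono mult.left_commute)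
      then show ?thesis using s(1) by simp
    qed
    then have "eventually (\<lambda>s. cmod (v $ i) \<le> \<bar>C\<bar> * F s) (at 0)"
      unfolding eventually_at using \<rho>(1) by (intro exI[of _ \<rho>]) (simp add: dist_norm)
    then have "cmod (v $ i) \<le> \<bar>C\<bar> * 0"
      by (intro tendsto_lowerbound[OF lim]) auto
    then show ?thesis by simp
  qed
  then show ?thesis by (simp add: vec_eq_iff)
qed

text \<open>The Jacobian matrix at \<open>b\<close> has trivial kernel and hence a left inverse
  \<open>M\<close>; row \<open>i\<close> of \<open>M\<close> combines the components of
  \<open>\<Phi>\<close> into a function with linear part the \<open>i\<close>-th parameter.\<close>

lemma local_parametrisation_coordinates:
  fixes \<Phi> :: "complex ^ 'n \<Rightarrow> complex ^ 'm"
  assumes "local_parametrisation X a \<Phi> b"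
  shows "\<exists>p\<in>polys_upto 1. \<exists>c. has_expansion (\<lambda>t. mp_eval p (\<Phi> t)) b c \<and> leading_exponent c (axis i 1)"
proof -
  obtain W U \<Psi> where W: "\<Phi> b = a" "open W" "b \<in> W" "open U" "a \<in> U" "hol_map_on W \<Phi>" "hol_map_on U \<Psi>"
    "homeomorphism W (X \<inter> U) \<Phi> \<Psi>"
    using assms unfolding local_parametrisation_def by (elim exE conjE) (rule that)
  have "\<exists>c. has_expansion (\<lambda>t. \<Phi> t $ j) b c" for j
    using local_parametrisation_hol_at[OF assms] unfolding hol_at_def .
  then obtain c where c: "\<And>j. has_expansion (\<lambda>t. \<Phi> t $ j) b (c j)" by metis
  define A :: "complex ^ 'n ^ 'm" where "A = (\<chi> j i. c j (axis i 1))"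
  have "v = 0" if v: "A *v v = 0" for v
  proof (rule left_inverse_imp_injective_derivative[OF W(2,3) _ c])
    show "continuous_on W \<Phi>" using W(8) by (simp add: homeomorphism_def)
    show "hol_at (\<lambda>x. \<Psi> x $ i) (\<Phi> b)" for i using W by (simp add: hol_map_on_def)
    show "\<Psi> (\<Phi> t) = t" if "t \<in> W" for t using W(8) that by (simp add: homeomorphism_def)
    show "(\<Sum>\<nu> | weight \<nu> = 1. c j \<nu> * monomial v \<nu>) = 0" for j
    proof -
      have "(\<Sum>\<nu> | weight \<nu> = 1. c j \<nu> * monomial v \<nu>) = (A *v v) $ j"
        unfolding sum_weight_1 by (simp add: A_def matrix_vector_mult_def monomial_axis)
      then show ?thesis using v by simp
    qed
  qed
  then obtain M where M: "M ** A = mat 1" using matrix_left_invertible_ker[of A] by blast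
  have MA: "(\<Sum>j\<in>UNIV. M $ i $ j * c j (axis k 1)) = (if i = k then 1 else 0)" for k
  proof -
    have "(M ** A) $ i $ k = (if i = k then 1 else 0)" unfolding M by (simp add: mat_def)
    then show ?thesis by (simp add: matrix_matrix_mult_def A_def)
  qed
  \<comment> \<open>The constants \<open>- a $ j\<close> cancel the value at \<open>b\<close>, so
    that the expansion starts in weight 1.\<close>
  define p :: "'m mpoly" where "p = (\<Sum>j\<in>UNIV. mp_scale (M $ i $ j)
    (Poly_Mapping.single (axis j 1) 1 + Poly_Mapping.single 0 (- a $ j)))"
  have "p \<in> polys_upto 1"
    unfolding p_def
    by (intro mp.subspace_sum[OF subspace_polys_upto] mp.subspace_scale[OF subspace_polys_upto]
        mp.subspace_add[OF subspace_polys_upto]) (auto simp: polys_upto_def)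
  moreover have ev: "mp_eval p (\<Phi> t) = (\<Sum>j\<in>UNIV. M $ i $ j * (\<Phi> t $ j + - a $ j))" for t
    by (simp add: p_def mp_eval_sum mp_eval_scale mp_eval_add monomial_axis)
  moreover define e where "e \<nu> = (\<Sum>j\<in>UNIV. M $ i $ j * (c j \<nu> + (if \<nu> = 0 then - a $ j else 0)))" for \<nu>
  have "has_expansion (\<lambda>t. mp_eval p (\<Phi> t)) b e"
    unfolding ev e_def[abs_def]
    by (intro has_expansion_sum has_expansion_mult_left has_expansion_add c has_expansion_const)
  moreover have "leading_exponent e (axis i 1)"
    unfolding leading_exponent_def
  proof (intro allI impI)
    fix \<kappa> :: "nat ^ 'n" assume "weight \<kappa> \<le> weight (axis i 1 :: nat ^ 'n)"
    then consider "\<kappa> = 0" | "weight \<kappa> = 1" by (auto simp: le_Suc_eq)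
    then show "e \<kappa> = (if \<kappa> = axis i 1 then 1 else 0)"
    proof cases
      case 1
      have "c j 0 = a $ j" for j using has_expansion_at_base[OF c[of j]] W(1) by simp
      moreover have "(0 :: nat ^ 'n) \<noteq> axis i 1" using weight_axis[of i 1] by fastforce
      ultimately show ?thesis by (simp add: 1 e_def)
    next
      case 2
      then obtain k where k: "\<kappa> = axis k 1" by (rule weight_eq_1E)
      have "axis k 1 \<noteq> (0 :: nat ^ 'n)" using weight_axis[of k 1] by fastforce
      then have "e \<kappa> = (\<Sum>j\<in>UNIV. M $ i $ j * c j (axis k 1))" by (simp add: k e_def)
      then show ?thesis unfolding MA k by (simp add: axis_eq_axis eq_commute)
    qed
  qed
  ultimately show ?thesis by blast
qed

text \<open>Continuity of the inverse for the subspace topology of \<open>X\<close> turns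
  neighbourhoods of \<open>b\<close> into traces on \<open>X\<close> of neighbourhoods of
  \<open>a\<close>.\<close>

lemma local_parametrisation_open_image:
  assumes "open N" "b \<in> N" "N \<subseteq> W" and h: "homeomorphism W (X \<inter> U) \<Phi> \<Psi>" "open U" "\<Phi> b \<in> U"
  obtains V where "open V" "\<Phi> b \<in> V" "X \<inter> V = \<Phi> ` N"
proof -
  have "openin (top_of_set W) N" by (rule open_subset[OF \<open>N \<subseteq> W\<close> \<open>open N\<close>])
  then have "openin (top_of_set (X \<inter> U)) (\<Phi> ` N)" by (rule homeomorphism_imp_open_map[OF h(1)])
  then obtain T where T: "open T" "\<Phi> ` N = (X \<inter> U) \<inter> T" by (auto simp: openin_open)
  then show ?thesis using assms by (intro that[of "U \<inter> T"]) auto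
qed

section \<open>Pullbacks compared with restrictions to the manifold\<close>

definition restriction_germ :: "(complex ^ 'm) set \<Rightarrow> complex ^ 'm \<Rightarrow> 'm mpoly \<Rightarrow> (complex ^ 'm) germ"
  where "restriction_germ X a p = germ_at a (\<lambda>x. if x \<in> X then mp_eval p x else 0)"

lemma restricted_polys_eq: "restricted_polys X a d = restriction_germ X a ` polys_upto d"
  by (simp add: restricted_polys_def restriction_germ_def)

lemma linear_restriction_germ: "Vector_Spaces.linear mp_scale germ_scale (restriction_germ X a)"
proof unfold_locales
  show "restriction_germ X a (p + q) = restriction_germ X a p + restriction_germ X a q" for p q
    unfolding restriction_germ_def germ_at_add[symmetric]
    by (rule arg_cong[where f = "germ_at a"]) (auto simp: mp_eval_add)
  show "restriction_germ X a (mp_scale k p) = germ_scale k (restriction_germ X a p)" for k p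
    unfolding restriction_germ_def germ_at_scale[symmetric]
    by (rule arg_cong[where f = "germ_at a"]) (auto simp: mp_eval_scale)
qed

lemma restriction_germ_eq_0_iff:
  assumes "local_parametrisation X a \<Phi> b"
  shows "restriction_germ X a p = 0 \<longleftrightarrow> pullback_germ \<Phi> b p = 0"
proof -
  obtain W U \<Psi> where W: "\<Phi> b = a" "open W" "b \<in> W" "open U" "a \<in> U" "hol_map_on W \<Phi>" "hol_map_on U \<Psi>"
    "homeomorphism W (X \<inter> U) \<Phi> \<Psi>"
    using assms unfolding local_parametrisation_def by (elim exE conjE) (rule that)
  have cont: "continuous_on W \<Phi>" and im: "\<Phi> ` W = X \<inter> U" using W(8) by (auto simp: homeomorphism_def)
  show ?thesis
    unfolding restriction_germ_def pullback_germ_def germ_at_eq_0_iff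
  proof
    assume "\<forall>\<^sub>F x in nhds a. (if x \<in> X then mp_eval p x else 0) = 0"
    then obtain N where N: "open N" "a \<in> N" "\<And>x. x \<in> N \<Longrightarrow> (if x \<in> X then mp_eval p x else 0) = 0"
      by (auto simp: eventually_nhds)
    have "open (W \<inter> \<Phi> -` N)" by (rule continuous_open_preimage[OF cont W(2) N(1)])
    moreover have "mp_eval p (\<Phi> t) = 0" if "t \<in> W \<inter> \<Phi> -` N" for t
    proof -
      have "\<Phi> t \<in> X" using that im by blast
      then show ?thesis using N(3)[of "\<Phi> t"] that by simp
    qed
    ultimately show "\<forall>\<^sub>F t in nhds b. mp_eval p (\<Phi> t) = 0"
      unfolding eventually_nhds using W N(2) by (intro exI[of _ "W \<inter> \<Phi> -` N"]) auto
  next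
    assume "\<forall>\<^sub>F t in nhds b. mp_eval p (\<Phi> t) = 0"
    then obtain N where N: "open N" "b \<in> N" "\<And>t. t \<in> N \<Longrightarrow> mp_eval p (\<Phi> t) = 0"
      by (auto simp: eventually_nhds)
    obtain V where V: "open V" "\<Phi> b \<in> V" "X \<inter> V = \<Phi> ` (W \<inter> N)"
      by (rule local_parametrisation_open_image[of "W \<inter> N" b W X U \<Phi> \<Psi>])
        (use W N in \<open>auto intro: open_Int\<close>)
    have "(if x \<in> X then mp_eval p x else 0) = 0" if "x \<in> V" for x
    proof (cases "x \<in> X")
      case True
      then have "x \<in> \<Phi> ` (W \<inter> N)" using that unfolding V(3)[symmetric] by simp
      then obtain t where "x = \<Phi> t" "t \<in> W \<inter> N" by (rule imageE)
      then show ?thesis using N(3)[of t] by simp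
    qed simp
    then show "\<forall>\<^sub>F x in nhds a. (if x \<in> X then mp_eval p x else 0) = 0"
      unfolding eventually_nhds using V(1,2) W(1) by (intro exI[of _ V]) simp
  qed
qed

text \<open>Both spaces are images of the same polynomials under linear maps with the same kernel,
  so their dimensions bound each other.\<close>

lemma dim_pullback_polys_eq:
  assumes "local_parametrisation X a \<Phi> b"
  shows "germ.dim (pullback_polys \<Phi> b d) = germ.dim (restricted_polys X a d)"
  unfolding pullback_polys_eq restricted_polys_eq
  by (intro antisym dim_linear_image_le linear_pullback_germ linear_restriction_germ)
    (simp_all add: restriction_germ_eq_0_iff[OF assms])

lemma sum_hilbert_function:
  "(\<Sum>i=0..d. hilbert_function X a i) = int (germ.dim (restricted_polys X a d))"
  by (induction d) (simp_all add: hilbert_function_def)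

text \<open>
  By the identity theorem, a polynomial vanishing on the germ vanishes on the image of one fixed
  ball; this takes the place of the Hilbert basis theorem for the existence of the closure.
\<close>

lemma local_parametrisation_ball:
  fixes \<Phi> :: "complex ^ 'n \<Rightarrow> complex ^ 'm"
  assumes "local_parametrisation X a \<Phi> b"
  shows "\<exists>E. prime_vanishing E \<and> E \<noteq> {} \<and> zariski_closure X a = zariski_hull E \<and>
    (\<forall>p q. (\<forall>x\<in>E. mp_eval p x = mp_eval q x) \<longrightarrow> pullback_germ \<Phi> b p = pullback_germ \<Phi> b q)"
proof -
  obtain W U \<Psi> where W: "\<Phi> b = a" "open W" "b \<in> W" "open U" "a \<in> U" "hol_map_on W \<Phi>" "hol_map_on U \<Psi>"
    "homeomorphism W (X \<inter> U) \<Phi> \<Psi>"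
    using assms unfolding local_parametrisation_def by (elim exE conjE) (rule that)
  have cont: "continuous_on W \<Phi>" and im: "\<Phi> ` W = X \<inter> U" using W(8) by (auto simp: homeomorphism_def)
  obtain r where r: "r > 0" "ball b r \<subseteq> W" using W(2,3) open_contains_ball by blast
  let ?B = "ball b r"
  define E where "E = \<Phi> ` ?B"
  have bB: "b \<in> ?B" using r(1) by simp
  have lh: "line_hol ?B (\<lambda>t. \<Phi> t $ j)" for j
  proof (rule line_hol_hol_at)
    show "continuous_on ?B (\<lambda>t. \<Phi> t $ j)"
      using continuous_on_subset[OF cont r(2)] by (rule continuous_on_component)
    show "hol_at (\<lambda>t. \<Phi> t $ j) p" if "p \<in> ?B" for p
      using W(6) that r(2) unfolding hol_map_on_def by blast
  qed
  have "prime_vanishing (\<Phi> ` {u \<in> ?B. \<forall>i\<in>{}. u $ i = 0})"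
    by (rule prime_vanishing_line_hol_image) (use lh in auto)
  moreover have "{u \<in> ?B. \<forall>i\<in>{}. u $ i = 0} = ?B" by blast
  ultimately have "prime_vanishing E" by (simp only: E_def)
  moreover have "E \<noteq> {}" using bB by (auto simp: E_def)
  moreover have "pullback_germ \<Phi> b p = pullback_germ \<Phi> b q" if "\<forall>x\<in>E. mp_eval p x = mp_eval q x" for p q
    unfolding pullback_germ_def germ_at_eq_iff eventually_nhds
    using that bB by (intro exI[of _ ?B]) (simp add: E_def)
  moreover have "zariski_closure X a = zariski_hull E"
    unfolding zariski_closure_def
  proof (rule Least_equality)
    obtain V where V: "open V" "\<Phi> b \<in> V" "X \<inter> V = \<Phi> ` ?B"
      by (rule local_parametrisation_open_image[of ?B b W X U \<Phi> \<Psi>]) (use W r in auto)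
    have "X \<inter> V \<subseteq> zariski_hull E"
      unfolding V(3) E_def[symmetric] by (rule subset_zariski_hull)
    then show "algebraic_set (zariski_hull E) \<and> (\<exists>V. open V \<and> a \<in> V \<and> X \<inter> V \<subseteq> zariski_hull E)"
      using algebraic_set_zariski_hull V(1,2) W(1) by (intro conjI exI[of _ V]) simp_all
  next
    fix Z assume "algebraic_set Z \<and> (\<exists>V. open V \<and> a \<in> V \<and> X \<inter> V \<subseteq> Z)"
    then obtain V where Z: "algebraic_set Z" and V: "open V" "a \<in> V" "X \<inter> V \<subseteq> Z" by blast
    obtain S where S: "Z = {x. \<forall>p\<in>S. mp_eval p x = 0}" using Z by (auto simp: algebraic_set_def)
    \<comment> \<open>A defining polynomial of \<open>Z\<close> vanishes along \<open>\<Phi>\<close>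
      near \<open>b\<close>, by the choice of \<open>V\<close>; the identity theorem extends this to
      the whole ball, whose radius does not depend on \<open>Z\<close>.\<close>
    have "mp_eval p (\<Phi> u) = 0" if p: "p \<in> S" and u: "u \<in> ?B" for p u
    proof (rule line_hol_eq_0[of ?B "\<lambda>t. mp_eval p (\<Phi> t)" b])
      show "line_hol ?B (\<lambda>t. mp_eval p (\<Phi> t))"
        by (rule line_hol_polyfun[OF polyfun_mp_eval lh])
      have "open (W \<inter> \<Phi> -` V)" by (rule continuous_open_preimage[OF cont W(2) V(1)])
      moreover have "mp_eval p (\<Phi> t) = 0" if "t \<in> W \<inter> \<Phi> -` V" for t
      proof -
        have "\<Phi> t \<in> Z" using that im V(3) by blast
        then show ?thesis using p by (simp add: S)
      qed
      ultimately show "\<forall>\<^sub>F t in nhds b. mp_eval p (\<Phi> t) = 0"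
        unfolding eventually_nhds using W V(2) by (intro exI[of _ "W \<inter> \<Phi> -` V"]) auto
    qed (use u bB in auto)
    then have "E \<subseteq> Z" by (auto simp: E_def S)
    then show "zariski_hull E \<subseteq> Z" by (rule zariski_hull_minimal[OF Z])
  qed
  ultimately show ?thesis by blast
qed

text \<open>The multiples of one unit exponent already number \<open>d + 1\<close>. This absorbs the
  \<open>- d\<close> of the dimension bound, so that \<theta> itself is at most the
  dimension.\<close>

lemma le_binomial_sum: "d + 1 \<le> (CARD('n::finite) + d) choose CARD('n)"
proof -
  have "inj_on (\<lambda>k. axis (undefined :: 'n) (k::nat)) {..d}"
    by (rule inj_onI) (auto simp: axis_eq_axis)
  then have "card {..d} = card ((\<lambda>k. axis (undefined :: 'n) (k::nat)) ` {..d})"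
    by (simp add: card_image)
  also have "\<dots> \<le> card {\<nu> :: nat ^ 'n. weight \<nu> \<le> d}"
    by (rule card_mono) auto
  finally show ?thesis by (simp add: card_weight_le)
qed

text \<open>In base \<open>d\<close> the logarithm of a bound \<open>D * d ^ r\<close> is
  \<open>r + ln D / ln d\<close>, and the second term tends to 0. From \<open>d = 2\<close> on the
  base exceeds 1 and the logarithm is increasing.\<close>

lemma limsup_log_le:
  assumes "\<And>d. \<theta> d \<le> C * (K * d + 1) ^ r" and pos: "\<And>d. d \<ge> 2 \<Longrightarrow> \<theta> d > 0"
  shows "limsup (\<lambda>d. ereal (log (real d) (real (\<theta> d)))) \<le> ereal (real r)"
proof -
  \<comment> \<open>\<open>K * d + 1 \<le> (K + 1) * d\<close> for positive \<open>d\<close> gives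
    the constant; the added 1 keeps \<open>ln D\<close> meaningful when
    \<open>C = 0\<close>.\<close>
  define D where "D = real (C * (K + 1) ^ r) + 1"
  have D: "D > 0" unfolding D_def by (simp add: add_nonneg_pos)
  have "log (real d) (real (\<theta> d)) \<le> ln D / ln (real d) + real r" if d: "d \<ge> 2" for d
  proof -
    have "(K * d + 1) ^ r \<le> ((K + 1) * d) ^ r" using d by (intro power_mono) auto
    then have "\<theta> d \<le> C * ((K + 1) * d) ^ r"
      using assms(1)[of d] mult_le_mono2 order_trans by blast
    then have "real (\<theta> d) \<le> real (C * (K + 1) ^ r) * real d ^ r"
      by (metis (no_types, lifting) mult.assoc of_nat_le_iff of_nat_mult of_nat_power power_mult_distrib)
    also have "\<dots> \<le> D * real d ^ r" by (intro mult_right_mono) (auto simp: D_def)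
    finally have "log (real d) (real (\<theta> d)) \<le> log (real d) (D * real d ^ r)"
      using d pos[OF d] D by (intro log_mono) auto
    also have "\<dots> = log (real d) D + log (real d) (real d ^ r)"
      using d D by (simp add: log_mult)
    also have "\<dots> = ln D / ln (real d) + real r"
      using d by (simp add: log_def ln_realpow)
    finally show ?thesis .
  qed
  then have "eventually (\<lambda>d. ereal (log (real d) (real (\<theta> d))) \<le> ereal (ln D / ln (real d) + real r)) sequentially"
    by (intro eventually_sequentiallyI[of 2]) simp
  then have "limsup (\<lambda>d. ereal (log (real d) (real (\<theta> d)))) \<le> limsup (\<lambda>d. ereal (ln D / ln (real d) + real r))"
    by (rule Limsup_mono)
  also have "\<dots> = ereal (real r)"
  proof (rule lim_imp_Limsup)
    have "filterlim (\<lambda>d. ln (real d)) at_top sequentially"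
      by (rule filterlim_compose[OF ln_at_top filterlim_real_sequentially])
    then have "(\<lambda>d. ln D / ln (real d)) \<longlonglongrightarrow> 0"
      by (rule tendsto_divide_0[OF tendsto_const filterlim_at_top_imp_at_infinity])
    then have "(\<lambda>d. ln D / ln (real d) + real r) \<longlonglongrightarrow> 0 + real r"
      by (intro tendsto_intros)
    then show "(\<lambda>d. ereal (ln D / ln (real d) + real r)) \<longlonglongrightarrow> ereal (real r)" by simp
  qed simp
  finally show ?thesis .
qed

theorem theorem12p5:
  fixes X :: "(complex ^ 'm) set" and a :: "complex ^ 'm"
    and \<Phi> :: "complex ^ 'n \<Rightarrow> complex ^ 'm" and b :: "complex ^ 'n"
  assumes "embedded_complex_manifold CARD('n) X" and "a \<in> X"
    and "local_parametrisation X a \<Phi> b"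
  shows "(\<forall>d. D_invariant \<Phi> b d \<longrightarrow>
            int ((CARD('n) + d) choose CARD('n)) + int (zero_estimate \<Phi> b d) - int d
              \<le> int (germ.dim (pullback_polys \<Phi> b d)) \<and>
            int (germ.dim (pullback_polys \<Phi> b d)) = (\<Sum>i=0..d. hilbert_function X a i) \<and>
            (\<Sum>i=0..d. hilbert_function X a i) \<le> int ((CARD('m) + d) choose CARD('m))) \<and>
         (D_invariant_infinity \<Phi> b \<longrightarrow>
            1 \<le> transcendency_index \<Phi> b \<and>
            transcendency_index \<Phi> b \<le> ereal_of_enat (algebraic_dim (zariski_closure X a)) \<and>
            algebraic_dim (zariski_closure X a) \<le> enat CARD('m))"
proof -
  let ?\<theta> = "zero_estimate \<Phi> b" and ?dim = "\<lambda>d. germ.dim (pullback_polys \<Phi> b d)"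
  note lp = assms(3)
  have lower: "d \<le> ?\<theta> d" "((CARD('n) + d) choose CARD('n)) + (?\<theta> d - d) \<le> ?dim d"
    if "D_invariant \<Phi> b d" for d
    by (rule D_invariant_dimension_bound[OF local_parametrisation_hol_at[OF lp]
          local_parametrisation_coordinates[OF lp] that])+
  have "int ((CARD('n) + d) choose CARD('n)) + int (?\<theta> d) - int d \<le> int (?dim d)"
    if "D_invariant \<Phi> b d" for d
    using lower[OF that] by linarith
  moreover have "int (?dim d) = (\<Sum>i=0..d. hilbert_function X a i)" for d
    unfolding sum_hilbert_function dim_pullback_polys_eq[OF lp] ..
  moreover have "(\<Sum>i=0..d. hilbert_function X a i) \<le> int ((CARD('m) + d) choose CARD('m))" for d
    unfolding sum_hilbert_function restricted_polys_eq
    using dim_linear_image_polys_upto_le[OF linear_restriction_germ] by simp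
  moreover have "1 \<le> transcendency_index \<Phi> b \<and>
      transcendency_index \<Phi> b \<le> ereal_of_enat (algebraic_dim (zariski_closure X a))"
    if "D_invariant_infinity \<Phi> b"
  proof
    have D: "D_invariant \<Phi> b d" for d using that by (simp add: D_invariant_infinity_def)
    have "1 \<le> ereal (log (real d) (real (?\<theta> d)))" if "d \<ge> 2" for d
    proof -
      have "log (real d) (real d) \<le> log (real d) (real (?\<theta> d))"
        using lower(1)[OF D, of d] that by (intro log_mono) auto
      then show ?thesis using that by simp
    qed
    then show "1 \<le> transcendency_index \<Phi> b"
      unfolding transcendency_index_def
      by (intro le_Limsup eventually_sequentiallyI[of 2]) auto
    obtain E where E: "prime_vanishing E" "E \<noteq> {}" "zariski_closure X a = zariski_hull E"
      and E_germ: "\<forall>p q. (\<forall>x\<in>E. mp_eval p x = mp_eval q x) \<longrightarrow> pullback_germ \<Phi> b p = pullback_germ \<Phi> b q"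
      using local_parametrisation_ball[OF lp] by (elim exE conjE) (rule that)
    \<comment> \<open>The maximum exists because there are finitely many coordinate sets and the
      empty one is independent. A set attaining it cannot be enlarged, as the graph construction
      requires.\<close>
    define r where "r = Max (card ` {S. indep_coords E S})"
    have "r \<in> card ` {S. indep_coords E S}"
      unfolding r_def using indep_coords_empty[OF E(2)] by (intro Max_in) auto
    then obtain S where S: "indep_coords E S" "card S = r" by auto
    have r: "card T \<le> r" if "indep_coords E T" for T
      unfolding r_def using that by (intro Max_ge) auto
    have "\<forall>j. j \<notin> S \<longrightarrow> \<not> indep_coords E (insert j S)"
    proof (intro allI impI notI)
      fix j assume "j \<notin> S" "indep_coords E (insert j S)"
      then show False using r[of "insert j S"] S(2) by simp
    qed
    from card_indep_coords_le_algebraic_dim[OF E(1,2) S(1) this]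
    have r_dim: "enat r \<le> algebraic_dim (zariski_closure X a)" by (simp add: S(2) E(3))
    have "\<exists>C K. \<forall>d. \<exists>A. finite A \<and> card A \<le> C * (K * d + 1) ^ r \<and>
      (\<forall>p\<in>polys_upto d. \<exists>q\<in>mp.span ((\<lambda>\<nu>. Poly_Mapping.single \<nu> 1) ` A). \<forall>x\<in>E. mp_eval q x = mp_eval p x)"
      (is "\<exists>C K. \<forall>d. ?growth C K d")
      by (rule polynomial_growth, erule r)
    then obtain C K where CK: "\<forall>d. ?growth C K d"
      by (elim exE) (erule that)
    have dim_le: "?dim d \<le> C * (K * d + 1) ^ r" for d
    proof -
      interpret pb: Vector_Spaces.linear mp_scale germ_scale "pullback_germ \<Phi> b"
        by (rule linear_pullback_germ)
      obtain A where A: "finite A" "card A \<le> C * (K * d + 1) ^ r"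
        "\<forall>p\<in>polys_upto d. \<exists>q\<in>mp.span ((\<lambda>\<nu>. Poly_Mapping.single \<nu> 1) ` A). \<forall>x\<in>E. mp_eval q x = mp_eval p x"
        using spec[OF CK, of d] by (elim exE conjE) (rule that)
      \<comment> \<open>Polynomials that agree on \<open>E\<close> have the same pullback germ, so
        normal forms modulo the relations on \<open>E\<close> already span all pullbacks.\<close>
      have "pullback_polys \<Phi> b d \<subseteq> germ.span (pullback_germ \<Phi> b ` (\<lambda>\<nu>. Poly_Mapping.single \<nu> 1) ` A)"
        unfolding pullback_polys_eq pb.span_image
      proof (rule image_subsetI)
        fix p :: "'m mpoly" assume "p \<in> polys_upto d"
        from bspec[OF A(3) this] obtain q where
          q: "q \<in> mp.span ((\<lambda>\<nu>. Poly_Mapping.single \<nu> 1) ` A)" "\<forall>x\<in>E. mp_eval q x = mp_eval p x" by blast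
        have "pullback_germ \<Phi> b q = pullback_germ \<Phi> b p" using E_germ q(2) by simp
        then show "pullback_germ \<Phi> b p \<in> pullback_germ \<Phi> b ` mp.span ((\<lambda>\<nu>. Poly_Mapping.single \<nu> 1) ` A)"
          using q(1) by (metis imageI)
      qed
      then have "?dim d \<le> card (pullback_germ \<Phi> b ` (\<lambda>\<nu>. Poly_Mapping.single \<nu> 1) ` A)"
        using A(1) by (intro germ.dim_le_card) auto
      also have "\<dots> \<le> card A"
        using A(1) by (simp add: image_image card_image_le)
      finally show ?thesis using A(2) by simp
    qed
    have "?\<theta> d \<le> C * (K * d + 1) ^ r" for d
      using lower[OF D, of d] le_binomial_sum[of d, where 'n = 'n] dim_le[of d] by linarith
    moreover have "?\<theta> d > 0" if "d \<ge> 2" for d using lower(1)[OF D, of d] that by simp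
    ultimately have "transcendency_index \<Phi> b \<le> ereal (real r)"
      unfolding transcendency_index_def by (rule limsup_log_le)
    also have "\<dots> = ereal_of_enat (enat r)" by simp
    also have "\<dots> \<le> ereal_of_enat (algebraic_dim (zariski_closure X a))"
      using r_dim by (simp only: ereal_of_enat_le_iff)
    finally show "transcendency_index \<Phi> b \<le> ereal_of_enat (algebraic_dim (zariski_closure X a))" .
  qed
  ultimately show ?thesis
    using algebraic_dim_le[of "zariski_closure X a"] by blast
qed

end
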